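(* The models of the type theory $\mathsf{Glob}$ are the globular sets: there is an equivalence of categories $\mathrm{Mod}(\mathrm{Syn}(\mathsf{Glob}))\simeq\mathbf{GSet}$.
   Context: A category with families (CwF) is a category $\mathcal C$ with a functor $T:\mathcal C^{op}\to\mathbf{Fam}$, $T\Gamma=(\mathrm{Tm}^\Gamma_A)_{A\in\mathrm{Ty}^\Gamma}$, a chosen terminal object, and context comprehension: objects $(\Gamma,A)$ with $\pi:(\Gamma,A)\to\Gamma$ and $p\in\mathrm{Tm}^{(\Gamma,A)}_{A[\pi]}$ such that each $\sigma:\Delta\to\Gamma$, $t\in\mathrm{Tm}^\Delta_{A[\sigma]}$ give a unique $\langle\sigma,t\rangle$ with $\pi\langle\sigma,t\rangle=\sigma$, $p[\langle\sigma,t\rangle]=t$. Morphisms of CwFs are functors with a natural transformation $\phi:T\to T'F$ preserving terminal object and comprehension on the nose; 2-morphisms are natural transformations $\theta$ with $T'\theta\circ\phi=\phi'$. $\mathbf{Set}$ is a CwF with $\mathrm{Ty}^X$ the functions into $X$ and $\mathrm{Tm}^X_f$ the sections of $f$. $\mathrm{Mod}(\mathcal C)$ is the category of CwF morphisms $\mathcal C\to\mathbf{Set}$ and 2-morphisms. The type theory $\mathsf{Glob}$ has only variables as terms, types $\star$ and $t\to_Au$, and the usual rules for contexts, types ($\star$; $t\to_Au$ from $\Gamma\vdash A,\Gamma\vdash t:A,\Gamma\vdash u:A$), variables and substitutions; $\mathrm{Syn}(\mathsf{Glob})$ is its syntactic CwF (derivable contexts up to renaming, derivable substitutions, $\mathrm{Ty}^\Gamma$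 derivable types, $\mathrm{Tm}^\Gamma_A$ derivable terms). $\mathbf{GSet}$ is the category of presheaves on the category of globes $\mathbb G$ (generators $\sigma_i,\tau_i:i\to i+1$, relations $\sigma_{i+1}\sigma_i=\tau_{i+1}\sigma_i$, $\sigma_{i+1}\tau_i=\tau_{i+1}\tau_i$).
   Formalization: The condition T'θ∘φ=φ' on 2-morphisms, which would leave only identities in Mod, is replaced by compatibility of θ with φ, φ' along θ_(Γ,A), so all natural transformations count; Set means subsets of an arbitrary set, with any strictly functorial choice of pullbacks. *)

theory Defs
  imports Main "HOL-Library.FuncSet"
begin

section \<open>Categories, functors, natural transformations\<close>

text \<open>Hom-sets need not be disjoint, so the operations on morphisms take the objects involved:
  \<open>cmp C a b c g f\<close> is the composite of \<open>f : a \<rightarrow> b\<close> and \<open>g : b \<rightarrow> c\<close>.\<close>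

record ('o, 'a) cat =
  obj :: "'o set"
  hom :: "'o \<Rightarrow> 'o \<Rightarrow> 'a set"
  idm :: "'o \<Rightarrow> 'a"
  cmp :: "'o \<Rightarrow> 'o \<Rightarrow> 'o \<Rightarrow> 'a \<Rightarrow> 'a \<Rightarrow> 'a"

locale category =
  fixes C :: "('o, 'a, 'z) cat_scheme"
  assumes idm_hom: "a \<in> obj C \<Longrightarrow> idm C a \<in> hom C a a"
    and cmp_hom: "\<lbrakk>a \<in> obj C; b \<in> obj C; c \<in> obj C; f \<in> hom C a b; g \<in> hom C b c\<rbrakk>
      \<Longrightarrow> cmp C a b c g f \<in> hom C a c"
    and cmp_idm: "\<lbrakk>a \<in> obj C; b \<in> obj C; f \<in> hom C a b\<rbrakk> \<Longrightarrow> cmp C a a b f (idm C a) = f"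
    and idm_cmp: "\<lbrakk>a \<in> obj C; b \<in> obj C; f \<in> hom C a b\<rbrakk> \<Longrightarrow> cmp C a b b (idm C b) f = f"
    and cmp_assoc: "\<lbrakk>a \<in> obj C; b \<in> obj C; c \<in> obj C; d \<in> obj C;
        f \<in> hom C a b; g \<in> hom C b c; h \<in> hom C c d\<rbrakk>
      \<Longrightarrow> cmp C a c d h (cmp C a b c g f) = cmp C a b d (cmp C b c d h g) f"

definition op_cat :: "('o, 'a, 'z) cat_scheme \<Rightarrow> ('o, 'a) cat" where
  "op_cat C = \<lparr>obj = obj C, hom = (\<lambda>a b. hom C b a), idm = idm C,
     cmp = (\<lambda>a b c g f. cmp C c b a f g)\<rparr>"

definition is_iso :: "('o, 'a, 'z) cat_scheme \<Rightarrow> 'o \<Rightarrow> 'o \<Rightarrow> 'a \<Rightarrow> bool" where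
  "is_iso C a b f \<longleftrightarrow> f \<in> hom C a b \<and>
     (\<exists>g \<in> hom C b a. cmp C a b a g f = idm C a \<and> cmp C b a b f g = idm C b)"

record ('o, 'a, 'p, 'b) functr =
  omap :: "'o \<Rightarrow> 'p"
  amap :: "'o \<Rightarrow> 'o \<Rightarrow> 'a \<Rightarrow> 'b"

text \<open>Functors, and all other maps below, take the value \<^const>\<open>undefined\<close> outside their domain, so
  that equality in HOL is equality of the mathematical objects.\<close>

locale is_functor =
  fixes C :: "('o, 'a, 'z) cat_scheme" and D :: "('p, 'b, 'y) cat_scheme"
    and F :: "('o, 'a, 'p, 'b, 'x) functr_scheme"
  assumes omap_ext: "omap F \<in> extensional (obj C)"
    and amap_ext: "\<not> (a \<in> obj C \<and> b \<in> obj C \<and> f \<in> hom C a b) \<Longrightarrow> amap F a b f = undefined"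
    and omap_obj: "a \<in> obj C \<Longrightarrow> omap F a \<in> obj D"
    and amap_hom: "\<lbrakk>a \<in> obj C; b \<in> obj C; f \<in> hom C a b\<rbrakk>
      \<Longrightarrow> amap F a b f \<in> hom D (omap F a) (omap F b)"
    and amap_idm: "a \<in> obj C \<Longrightarrow> amap F a a (idm C a) = idm D (omap F a)"
    and amap_cmp: "\<lbrakk>a \<in> obj C; b \<in> obj C; c \<in> obj C; f \<in> hom C a b; g \<in> hom C b c\<rbrakk>
      \<Longrightarrow> amap F a c (cmp C a b c g f)
        = cmp D (omap F a) (omap F b) (omap F c) (amap F b c g) (amap F a b f)"

locale nat_trans =
  fixes C :: "('o, 'a, 'z) cat_scheme" and D :: "('p, 'b, 'y) cat_scheme"
    and F :: "('o, 'a, 'p, 'b, 'x) functr_scheme" and G :: "('o, 'a, 'p, 'b, 'w) functr_scheme"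
    and \<theta> :: "'o \<Rightarrow> 'b"
  assumes nt_ext: "\<theta> \<in> extensional (obj C)"
    and nt_hom: "a \<in> obj C \<Longrightarrow> \<theta> a \<in> hom D (omap F a) (omap G a)"
    and nt_nat: "\<lbrakk>a \<in> obj C; b \<in> obj C; f \<in> hom C a b\<rbrakk> \<Longrightarrow>
        cmp D (omap F a) (omap F b) (omap G b) (\<theta> b) (amap F a b f)
      = cmp D (omap F a) (omap G a) (omap G b) (amap G a b f) (\<theta> a)"

definition nt_id :: "('o, 'a, 'z) cat_scheme \<Rightarrow> ('p, 'b, 'y) cat_scheme
    \<Rightarrow> ('o, 'a, 'p, 'b, 'x) functr_scheme \<Rightarrow> 'o \<Rightarrow> 'b" where
  "nt_id C D F = (\<lambda>a \<in> obj C. idm D (omap F a))"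

definition nt_cmp :: "('o, 'a, 'z) cat_scheme \<Rightarrow> ('p, 'b, 'y) cat_scheme
    \<Rightarrow> ('o, 'a, 'p, 'b, 'x) functr_scheme \<Rightarrow> ('o, 'a, 'p, 'b, 'x) functr_scheme
    \<Rightarrow> ('o, 'a, 'p, 'b, 'x) functr_scheme \<Rightarrow> ('o \<Rightarrow> 'b) \<Rightarrow> ('o \<Rightarrow> 'b) \<Rightarrow> 'o \<Rightarrow> 'b" where
  "nt_cmp C D F G H \<eta> \<theta> = (\<lambda>a \<in> obj C. cmp D (omap F a) (omap G a) (omap H a) (\<eta> a) (\<theta> a))"

definition functor_cat :: "('o, 'a, 'z) cat_scheme \<Rightarrow> ('p, 'b, 'y) cat_scheme
    \<Rightarrow> (('o, 'a, 'p, 'b) functr, 'o \<Rightarrow> 'b) cat" where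
  "functor_cat C D = \<lparr>obj = {F. is_functor C D F}, hom = (\<lambda>F G. {\<theta>. nat_trans C D F G \<theta>}),
     idm = nt_id C D, cmp = nt_cmp C D\<rparr>"

lemma nat_trans_nt_id:
  assumes "category D" and "is_functor C D F"
  shows "nat_trans C D F F (nt_id C D F)"
proof -
  interpret D: category D by fact
  interpret F: is_functor C D F by fact
  show ?thesis
    by unfold_locales
      (simp_all add: nt_id_def D.idm_hom D.cmp_idm D.idm_cmp F.omap_obj F.amap_hom)
qed

lemma nat_trans_nt_cmp:
  assumes "category D" and "is_functor C D F" and "is_functor C D G" and "is_functor C D H"
    and "nat_trans C D F G \<theta>" and "nat_trans C D G H \<eta>"
  shows "nat_trans C D F H (nt_cmp C D F G H \<eta> \<theta>)"
proof -
  interpret D: category D by fact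
  interpret F: is_functor C D F by fact
  interpret G: is_functor C D G by fact
  interpret H: is_functor C D H by fact
  interpret \<theta>: nat_trans C D F G \<theta> by fact
  interpret \<eta>: nat_trans C D G H \<eta> by fact
  show ?thesis
  proof
    show "nt_cmp C D F G H \<eta> \<theta> \<in> extensional (obj C)" by (simp add: nt_cmp_def)
    fix a assume a: "a \<in> obj C"
    then show "nt_cmp C D F G H \<eta> \<theta> a \<in> hom D (omap F a) (omap H a)"
      by (simp add: nt_cmp_def D.cmp_hom[OF F.omap_obj G.omap_obj H.omap_obj] \<theta>.nt_hom \<eta>.nt_hom)
    fix b f assume b: "b \<in> obj C" and f: "f \<in> hom C a b"
    note o = F.omap_obj[OF a] F.omap_obj[OF b] G.omap_obj[OF a] G.omap_obj[OF b]
      H.omap_obj[OF a] H.omap_obj[OF b]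
    note h = F.amap_hom[OF a b f] G.amap_hom[OF a b f] H.amap_hom[OF a b f]
      \<theta>.nt_hom[OF a] \<theta>.nt_hom[OF b] \<eta>.nt_hom[OF a] \<eta>.nt_hom[OF b]
    have "cmp D (omap F a) (omap F b) (omap H b)
        (cmp D (omap F b) (omap G b) (omap H b) (\<eta> b) (\<theta> b)) (amap F a b f)
      = cmp D (omap F a) (omap G b) (omap H b) (\<eta> b)
          (cmp D (omap F a) (omap F b) (omap G b) (\<theta> b) (amap F a b f))"
      using D.cmp_assoc[OF o(1,2,4,6) h(1,5,7)] by simp
    also have "\<dots> = cmp D (omap F a) (omap G a) (omap H b)
        (cmp D (omap G a) (omap G b) (omap H b) (\<eta> b) (amap G a b f)) (\<theta> a)"
      using D.cmp_assoc[OF o(1,3,4,6) h(4,2,7)] by (simp add: \<theta>.nt_nat[OF a b f])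
    also have "\<dots> = cmp D (omap F a) (omap H a) (omap H b) (amap H a b f)
        (cmp D (omap F a) (omap G a) (omap H a) (\<eta> a) (\<theta> a))"
      using D.cmp_assoc[OF o(1,3,5,6) h(4,6,3)] by (simp add: \<eta>.nt_nat[OF a b f])
    finally show "cmp D (omap F a) (omap F b) (omap H b) (nt_cmp C D F G H \<eta> \<theta> b) (amap F a b f)
      = cmp D (omap F a) (omap H a) (omap H b) (amap H a b f) (nt_cmp C D F G H \<eta> \<theta> a)"
      using a b by (simp add: nt_cmp_def)
  qed
qed

lemma nt_cmp_nt_id:
  assumes "category D" and "is_functor C D F" and "is_functor C D G" and "nat_trans C D F G \<theta>"
  shows "nt_cmp C D F F G \<theta> (nt_id C D F) = \<theta>" and "nt_cmp C D F G G (nt_id C D G) \<theta> = \<theta>"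
proof -
  interpret D: category D by fact
  interpret F: is_functor C D F by fact
  interpret G: is_functor C D G by fact
  interpret \<theta>: nat_trans C D F G \<theta> by fact
  show "nt_cmp C D F F G \<theta> (nt_id C D F) = \<theta>" "nt_cmp C D F G G (nt_id C D G) \<theta> = \<theta>"
    by (rule extensionalityI[OF _ \<theta>.nt_ext];
        simp add: nt_cmp_def nt_id_def D.cmp_idm D.idm_cmp F.omap_obj G.omap_obj \<theta>.nt_hom)+
qed

lemma nt_cmp_assoc:
  assumes "category D" and "is_functor C D F" and "is_functor C D G" and "is_functor C D H"
    and "is_functor C D K"
    and "nat_trans C D F G \<theta>" and "nat_trans C D G H \<eta>" and "nat_trans C D H K \<zeta>"
  shows "nt_cmp C D F H K \<zeta> (nt_cmp C D F G H \<eta> \<theta>) = nt_cmp C D F G K (nt_cmp C D G H K \<zeta> \<eta>) \<theta>"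
proof (rule extensionalityI[where A = "obj C"])
  interpret D: category D by fact
  fix a assume a: "a \<in> obj C"
  show "nt_cmp C D F H K \<zeta> (nt_cmp C D F G H \<eta> \<theta>) a
      = nt_cmp C D F G K (nt_cmp C D G H K \<zeta> \<eta>) \<theta> a"
    using a assms(2-) unfolding nt_cmp_def
    by (simp add: D.cmp_assoc is_functor.omap_obj nat_trans.nt_hom)
qed (simp_all add: nt_cmp_def)

lemma category_functor_cat:
  assumes "category D"
  shows "category (functor_cat C D)"
  by unfold_locales
    (auto simp: functor_cat_def assms intro: nat_trans_nt_id nat_trans_nt_cmp nt_cmp_nt_id nt_cmp_assoc)

definition id_functor :: "('o, 'a, 'z) cat_scheme \<Rightarrow> ('o, 'a, 'o, 'a) functr" where
  "id_functor C = \<lparr>omap = (\<lambda>a \<in> obj C. a),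
     amap = (\<lambda>a b f. if a \<in> obj C \<and> b \<in> obj C \<and> f \<in> hom C a b then f else undefined)\<rparr>"

definition comp_functor :: "('o, 'a, 'z) cat_scheme \<Rightarrow> ('p, 'b, 'q, 'c) functr
    \<Rightarrow> ('o, 'a, 'p, 'b) functr \<Rightarrow> ('o, 'a, 'q, 'c) functr" where
  "comp_functor C G F = \<lparr>omap = (\<lambda>a \<in> obj C. omap G (omap F a)),
     amap = (\<lambda>a b f. if a \<in> obj C \<and> b \<in> obj C \<and> f \<in> hom C a b
       then amap G (omap F a) (omap F b) (amap F a b f) else undefined)\<rparr>"

definition naturally_isomorphic :: "('o, 'a, 'z) cat_scheme \<Rightarrow> ('p, 'b, 'y) cat_scheme
    \<Rightarrow> ('o, 'a, 'p, 'b) functr \<Rightarrow> ('o, 'a, 'p, 'b) functr \<Rightarrow> bool" where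
  "naturally_isomorphic C D F G \<longleftrightarrow>
     (\<exists>\<theta>. nat_trans C D F G \<theta> \<and> (\<forall>a \<in> obj C. is_iso D (omap F a) (omap G a) (\<theta> a)))"

definition equivalent_categories ::
    "('o, 'a, 'z) cat_scheme \<Rightarrow> ('p, 'b, 'y) cat_scheme \<Rightarrow> bool" where
  "equivalent_categories C D \<longleftrightarrow>
     (\<exists>F G. is_functor C D F \<and> is_functor D C G \<and>
        naturally_isomorphic C C (comp_functor C G F) (id_functor C) \<and>
        naturally_isomorphic D D (comp_functor D F G) (id_functor D))"


section \<open>Categories with families\<close>

text \<open>For \<open>\<sigma> : \<Delta> \<rightarrow> \<Gamma>\<close>, the action of the functor into families is \<open>A[\<sigma>] = tysub C \<Delta> \<Gamma> \<sigma> A\<close> and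
  \<open>t[\<sigma>] = tmsub C \<Delta> \<Gamma> \<sigma> A t\<close>. The display map \<open>\<pi>\<close> of \<open>(\<Gamma>, A)\<close> is \<open>wk C \<Gamma> A\<close>, and \<open>p\<close> is
  \<open>var C \<Gamma> A\<close>.\<close>

record ('o, 'a, 't, 'e) cwf = "('o, 'a) cat" +
  ty :: "'o \<Rightarrow> 't set"
  tm :: "'o \<Rightarrow> 't \<Rightarrow> 'e set"
  tysub :: "'o \<Rightarrow> 'o \<Rightarrow> 'a \<Rightarrow> 't \<Rightarrow> 't"
  tmsub :: "'o \<Rightarrow> 'o \<Rightarrow> 'a \<Rightarrow> 't \<Rightarrow> 'e \<Rightarrow> 'e"
  emp :: "'o"
  ext :: "'o \<Rightarrow> 't \<Rightarrow> 'o"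
  wk :: "'o \<Rightarrow> 't \<Rightarrow> 'a"
  var :: "'o \<Rightarrow> 't \<Rightarrow> 'e"

locale is_cwf = category C for C :: "('o, 'a, 't, 'e, 'z) cwf_scheme" +
  assumes tysub_ty: "\<lbrakk>\<Delta> \<in> obj C; \<Gamma> \<in> obj C; \<sigma> \<in> hom C \<Delta> \<Gamma>; A \<in> ty C \<Gamma>\<rbrakk>
      \<Longrightarrow> tysub C \<Delta> \<Gamma> \<sigma> A \<in> ty C \<Delta>"
    and tmsub_tm: "\<lbrakk>\<Delta> \<in> obj C; \<Gamma> \<in> obj C; \<sigma> \<in> hom C \<Delta> \<Gamma>; A \<in> ty C \<Gamma>; t \<in> tm C \<Gamma> A\<rbrakk>
      \<Longrightarrow> tmsub C \<Delta> \<Gamma> \<sigma> A t \<in> tm C \<Delta> (tysub C \<Delta> \<Gamma> \<sigma> A)"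
    and tysub_idm: "\<lbrakk>\<Gamma> \<in> obj C; A \<in> ty C \<Gamma>\<rbrakk> \<Longrightarrow> tysub C \<Gamma> \<Gamma> (idm C \<Gamma>) A = A"
    and tmsub_idm: "\<lbrakk>\<Gamma> \<in> obj C; A \<in> ty C \<Gamma>; t \<in> tm C \<Gamma> A\<rbrakk>
      \<Longrightarrow> tmsub C \<Gamma> \<Gamma> (idm C \<Gamma>) A t = t"
    and tysub_cmp: "\<lbrakk>\<Theta> \<in> obj C; \<Delta> \<in> obj C; \<Gamma> \<in> obj C; \<tau> \<in> hom C \<Theta> \<Delta>; \<sigma> \<in> hom C \<Delta> \<Gamma>;
        A \<in> ty C \<Gamma>\<rbrakk>
      \<Longrightarrow> tysub C \<Theta> \<Gamma> (cmp C \<Theta> \<Delta> \<Gamma> \<sigma> \<tau>) A = tysub C \<Theta> \<Delta> \<tau> (tysub C \<Delta> \<Gamma> \<sigma> A)"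
    and tmsub_cmp: "\<lbrakk>\<Theta> \<in> obj C; \<Delta> \<in> obj C; \<Gamma> \<in> obj C; \<tau> \<in> hom C \<Theta> \<Delta>; \<sigma> \<in> hom C \<Delta> \<Gamma>;
        A \<in> ty C \<Gamma>; t \<in> tm C \<Gamma> A\<rbrakk>
      \<Longrightarrow> tmsub C \<Theta> \<Gamma> (cmp C \<Theta> \<Delta> \<Gamma> \<sigma> \<tau>) A t
        = tmsub C \<Theta> \<Delta> \<tau> (tysub C \<Delta> \<Gamma> \<sigma> A) (tmsub C \<Delta> \<Gamma> \<sigma> A t)"
    and emp_obj: "emp C \<in> obj C"
    and emp_terminal: "\<Gamma> \<in> obj C \<Longrightarrow> \<exists>!\<sigma>. \<sigma> \<in> hom C \<Gamma> (emp C)"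
    and ext_obj: "\<lbrakk>\<Gamma> \<in> obj C; A \<in> ty C \<Gamma>\<rbrakk> \<Longrightarrow> ext C \<Gamma> A \<in> obj C"
    and wk_hom: "\<lbrakk>\<Gamma> \<in> obj C; A \<in> ty C \<Gamma>\<rbrakk> \<Longrightarrow> wk C \<Gamma> A \<in> hom C (ext C \<Gamma> A) \<Gamma>"
    and var_tm: "\<lbrakk>\<Gamma> \<in> obj C; A \<in> ty C \<Gamma>\<rbrakk>
      \<Longrightarrow> var C \<Gamma> A \<in> tm C (ext C \<Gamma> A) (tysub C (ext C \<Gamma> A) \<Gamma> (wk C \<Gamma> A) A)"
    and comprehension: "\<lbrakk>\<Delta> \<in> obj C; \<Gamma> \<in> obj C; \<sigma> \<in> hom C \<Delta> \<Gamma>; A \<in> ty C \<Gamma>;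
        t \<in> tm C \<Delta> (tysub C \<Delta> \<Gamma> \<sigma> A)\<rbrakk>
      \<Longrightarrow> \<exists>!\<rho>. \<rho> \<in> hom C \<Delta> (ext C \<Gamma> A) \<and> cmp C \<Delta> (ext C \<Gamma> A) \<Gamma> (wk C \<Gamma> A) \<rho> = \<sigma> \<and>
            tmsub C \<Delta> (ext C \<Gamma> A) \<rho> (tysub C (ext C \<Gamma> A) \<Gamma> (wk C \<Gamma> A) A) (var C \<Gamma> A) = t"

definition cwf_pair ::
    "('o, 'a, 't, 'e, 'z) cwf_scheme \<Rightarrow> 'o \<Rightarrow> 'o \<Rightarrow> 'a \<Rightarrow> 't \<Rightarrow> 'e \<Rightarrow> 'a" where
  "cwf_pair C \<Delta> \<Gamma> \<sigma> A t = (THE \<rho>. \<rho> \<in> hom C \<Delta> (ext C \<Gamma> A) \<and>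
     cmp C \<Delta> (ext C \<Gamma> A) \<Gamma> (wk C \<Gamma> A) \<rho> = \<sigma> \<and>
     tmsub C \<Delta> (ext C \<Gamma> A) \<rho> (tysub C (ext C \<Gamma> A) \<Gamma> (wk C \<Gamma> A) A) (var C \<Gamma> A) = t)"

record ('o, 'a, 't, 'e, 'p, 'b, 's, 'd) cwf_mor = "('o, 'a, 'p, 'b) functr" +
  tymap :: "'o \<Rightarrow> 't \<Rightarrow> 's"
  tmmap :: "'o \<Rightarrow> 't \<Rightarrow> 'e \<Rightarrow> 'd"

locale is_cwf_mor = is_functor C D M
  for C :: "('o, 'a, 't, 'e, 'z) cwf_scheme" and D :: "('p, 'b, 's, 'd, 'y) cwf_scheme"
    and M :: "('o, 'a, 't, 'e, 'p, 'b, 's, 'd, 'x) cwf_mor_scheme" +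
  assumes tymap_ext: "\<not> (\<Gamma> \<in> obj C \<and> A \<in> ty C \<Gamma>) \<Longrightarrow> tymap M \<Gamma> A = undefined"
    and tmmap_ext: "\<not> (\<Gamma> \<in> obj C \<and> A \<in> ty C \<Gamma> \<and> t \<in> tm C \<Gamma> A) \<Longrightarrow> tmmap M \<Gamma> A t = undefined"
    and tymap_ty: "\<lbrakk>\<Gamma> \<in> obj C; A \<in> ty C \<Gamma>\<rbrakk> \<Longrightarrow> tymap M \<Gamma> A \<in> ty D (omap M \<Gamma>)"
    and tmmap_tm: "\<lbrakk>\<Gamma> \<in> obj C; A \<in> ty C \<Gamma>; t \<in> tm C \<Gamma> A\<rbrakk>
      \<Longrightarrow> tmmap M \<Gamma> A t \<in> tm D (omap M \<Gamma>) (tymap M \<Gamma> A)"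
    and tymap_nat: "\<lbrakk>\<Delta> \<in> obj C; \<Gamma> \<in> obj C; \<sigma> \<in> hom C \<Delta> \<Gamma>; A \<in> ty C \<Gamma>\<rbrakk>
      \<Longrightarrow> tymap M \<Delta> (tysub C \<Delta> \<Gamma> \<sigma> A)
        = tysub D (omap M \<Delta>) (omap M \<Gamma>) (amap M \<Delta> \<Gamma> \<sigma>) (tymap M \<Gamma> A)"
    and tmmap_nat: "\<lbrakk>\<Delta> \<in> obj C; \<Gamma> \<in> obj C; \<sigma> \<in> hom C \<Delta> \<Gamma>; A \<in> ty C \<Gamma>; t \<in> tm C \<Gamma> A\<rbrakk>
      \<Longrightarrow> tmmap M \<Delta> (tysub C \<Delta> \<Gamma> \<sigma> A) (tmsub C \<Delta> \<Gamma> \<sigma> A t)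
        = tmsub D (omap M \<Delta>) (omap M \<Gamma>) (amap M \<Delta> \<Gamma> \<sigma>) (tymap M \<Gamma> A) (tmmap M \<Gamma> A t)"
    and emp_pres: "omap M (emp C) = emp D"
    and ext_pres: "\<lbrakk>\<Gamma> \<in> obj C; A \<in> ty C \<Gamma>\<rbrakk>
      \<Longrightarrow> omap M (ext C \<Gamma> A) = ext D (omap M \<Gamma>) (tymap M \<Gamma> A)"
    and wk_pres: "\<lbrakk>\<Gamma> \<in> obj C; A \<in> ty C \<Gamma>\<rbrakk>
      \<Longrightarrow> amap M (ext C \<Gamma> A) \<Gamma> (wk C \<Gamma> A) = wk D (omap M \<Gamma>) (tymap M \<Gamma> A)"
    and var_pres: "\<lbrakk>\<Gamma> \<in> obj C; A \<in> ty C \<Gamma>\<rbrakk>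
      \<Longrightarrow> tmmap M (ext C \<Gamma> A) (tysub C (ext C \<Gamma> A) \<Gamma> (wk C \<Gamma> A) A) (var C \<Gamma> A)
        = var D (omap M \<Gamma>) (tymap M \<Gamma> A)"

text \<open>A 2-morphism \<open>(M, \<phi>) \<Rightarrow> (N, \<psi>)\<close> is a natural transformation \<open>\<theta> : M \<Rightarrow> N\<close> compatible with
  \<open>\<phi>\<close> and \<open>\<psi>\<close>. Since \<open>T'\<close> is contravariant, the compatibility compares \<open>\<phi>\<close> with \<open>T'\<theta> \<circ> \<psi>\<close>, which
  sends a type \<open>A\<close> over \<open>\<Gamma>\<close> to \<open>(\<psi> A)[\<theta>\<^sub>\<Gamma>]\<close> and a term \<open>t\<close> to \<open>(\<psi> t)[\<theta>\<^sub>\<Gamma>]\<close>. The comparison cannot be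
  equality: by lemma \<open>strict_2mor_collapse\<close> below, only identities would satisfy it between models of
  globular type theory. It is made
  along the component \<open>\<theta>\<^bsub>(\<Gamma>,A)\<^esub>\<close>: this is a map from the type \<open>\<phi> A\<close> to the type \<open>\<psi> A\<close> over \<open>\<theta>\<^sub>\<Gamma>\<close>
  (equivalently, from \<open>\<phi> A\<close> to \<open>(\<psi> A)[\<theta>\<^sub>\<Gamma>]\<close> over \<open>M \<Gamma>\<close>), and it sends \<open>\<phi> t\<close> to \<open>(\<psi> t)[\<theta>\<^sub>\<Gamma>]\<close>. As \<open>M\<close> and
  \<open>N\<close> preserve comprehension, every natural transformation is compatible in this sense; see
  \<open>is_cwf_2mor_iff\<close>.\<close>

locale is_cwf_2mor = nat_trans C D M N \<theta>
  for C :: "('o, 'a, 't, 'e, 'z) cwf_scheme" and D :: "('p, 'b, 's, 'd, 'y) cwf_scheme"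
    and M :: "('o, 'a, 't, 'e, 'p, 'b, 's, 'd, 'x) cwf_mor_scheme"
    and N :: "('o, 'a, 't, 'e, 'p, 'b, 's, 'd, 'w) cwf_mor_scheme" and \<theta> :: "'o \<Rightarrow> 'b" +
  assumes ty_compat: "\<lbrakk>\<Gamma> \<in> obj C; A \<in> ty C \<Gamma>\<rbrakk> \<Longrightarrow>
        cmp D (omap M (ext C \<Gamma> A)) (omap N (ext C \<Gamma> A)) (omap N \<Gamma>)
          (wk D (omap N \<Gamma>) (tymap N \<Gamma> A)) (\<theta> (ext C \<Gamma> A))
      = cmp D (omap M (ext C \<Gamma> A)) (omap M \<Gamma>) (omap N \<Gamma>)
          (\<theta> \<Gamma>) (wk D (omap M \<Gamma>) (tymap M \<Gamma> A))"
    and tm_compat: "\<lbrakk>\<Gamma> \<in> obj C; A \<in> ty C \<Gamma>; t \<in> tm C \<Gamma> A\<rbrakk> \<Longrightarrow>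
        cmp D (omap M \<Gamma>) (omap M (ext C \<Gamma> A)) (omap N (ext C \<Gamma> A)) (\<theta> (ext C \<Gamma> A))
          (cwf_pair D (omap M \<Gamma>) (omap M \<Gamma>) (idm D (omap M \<Gamma>)) (tymap M \<Gamma> A) (tmmap M \<Gamma> A t))
      = cwf_pair D (omap M \<Gamma>) (omap N \<Gamma>) (\<theta> \<Gamma>) (tymap N \<Gamma> A)
          (tmsub D (omap M \<Gamma>) (omap N \<Gamma>) (\<theta> \<Gamma>) (tymap N \<Gamma> A) (tmmap N \<Gamma> A t))"

definition cwf_hom_cat :: "('o, 'a, 't, 'e, 'z) cwf_scheme \<Rightarrow> ('p, 'b, 's, 'd, 'y) cwf_scheme
    \<Rightarrow> (('o, 'a, 't, 'e, 'p, 'b, 's, 'd) cwf_mor, 'o \<Rightarrow> 'b) cat" where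
  "cwf_hom_cat C D = \<lparr>obj = {M. is_cwf_mor C D M}, hom = (\<lambda>M N. {\<theta>. is_cwf_2mor C D M N \<theta>}),
     idm = nt_id C D, cmp = nt_cmp C D\<rparr>"

lemma cwf_pair:
  assumes "is_cwf C" and "\<Delta> \<in> obj C" and "\<Gamma> \<in> obj C" and "\<sigma> \<in> hom C \<Delta> \<Gamma>" and "A \<in> ty C \<Gamma>"
    and "t \<in> tm C \<Delta> (tysub C \<Delta> \<Gamma> \<sigma> A)"
  shows "cwf_pair C \<Delta> \<Gamma> \<sigma> A t \<in> hom C \<Delta> (ext C \<Gamma> A)"
    and "cmp C \<Delta> (ext C \<Gamma> A) \<Gamma> (wk C \<Gamma> A) (cwf_pair C \<Delta> \<Gamma> \<sigma> A t) = \<sigma>"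
    and "tmsub C \<Delta> (ext C \<Gamma> A) (cwf_pair C \<Delta> \<Gamma> \<sigma> A t)
      (tysub C (ext C \<Gamma> A) \<Gamma> (wk C \<Gamma> A) A) (var C \<Gamma> A) = t"
    and "\<And>\<rho>. \<lbrakk>\<rho> \<in> hom C \<Delta> (ext C \<Gamma> A); cmp C \<Delta> (ext C \<Gamma> A) \<Gamma> (wk C \<Gamma> A) \<rho> = \<sigma>;
        tmsub C \<Delta> (ext C \<Gamma> A) \<rho> (tysub C (ext C \<Gamma> A) \<Gamma> (wk C \<Gamma> A) A) (var C \<Gamma> A) = t\<rbrakk>
      \<Longrightarrow> cwf_pair C \<Delta> \<Gamma> \<sigma> A t = \<rho>"
  using theI'[OF is_cwf.comprehension[OF assms]] the1_equality[OF is_cwf.comprehension[OF assms]]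
  unfolding cwf_pair_def by blast+

lemma is_cwf_2mor_iff:
  fixes C :: "('o, 'a, 't, 'e, 'z) cwf_scheme" and D :: "('p, 'b, 's, 'd, 'y) cwf_scheme"
    and M N :: "('o, 'a, 't, 'e, 'p, 'b, 's, 'd, 'x) cwf_mor_scheme"
  assumes "is_cwf C" and "is_cwf D" and "is_cwf_mor C D M" and "is_cwf_mor C D N"
  shows "is_cwf_2mor C D M N \<theta> \<longleftrightarrow> nat_trans C D M N \<theta>"
proof
  assume "is_cwf_2mor C D M N \<theta>" then show "nat_trans C D M N \<theta>" by (rule is_cwf_2mor.axioms)
next
  assume "nat_trans C D M N \<theta>"
  then interpret T: nat_trans C D M N \<theta> .
  interpret C: is_cwf C by fact
  interpret D: is_cwf D by fact
  interpret M: is_cwf_mor C D M by fact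
  interpret N: is_cwf_mor C D N by fact
  show "is_cwf_2mor C D M N \<theta>"
  proof
    fix \<Gamma> A assume G: "\<Gamma> \<in> obj C" and A: "A \<in> ty C \<Gamma>"
    let ?E = "ext C \<Gamma> A"
    note E = C.ext_obj[OF G A]
    show "cmp D (omap M ?E) (omap N ?E) (omap N \<Gamma>) (wk D (omap N \<Gamma>) (tymap N \<Gamma> A)) (\<theta> ?E)
      = cmp D (omap M ?E) (omap M \<Gamma>) (omap N \<Gamma>) (\<theta> \<Gamma>) (wk D (omap M \<Gamma>) (tymap M \<Gamma> A))"
      using T.nt_nat[OF E G C.wk_hom[OF G A]] by (simp add: M.wk_pres[OF G A] N.wk_pres[OF G A])
    fix t assume t: "t \<in> tm C \<Gamma> A"
    let ?W = "tysub C ?E \<Gamma> (wk C \<Gamma> A) A"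
    have W: "?W \<in> ty C ?E" by (rule C.tysub_ty[OF E G C.wk_hom[OF G A] A])
    have t': "t \<in> tm C \<Gamma> (tysub C \<Gamma> \<Gamma> (idm C \<Gamma>) A)" using t by (simp add: C.tysub_idm[OF G A])
    define r where "r = cwf_pair C \<Gamma> \<Gamma> (idm C \<Gamma>) A t"
    note r = cwf_pair(1-3)[OF assms(1) G G C.idm_hom[OF G] A t', folded r_def]
    have *: "cmp D (omap K \<Gamma>) (ext D (omap K \<Gamma>) (tymap K \<Gamma> A)) (omap K \<Gamma>)
          (wk D (omap K \<Gamma>) (tymap K \<Gamma> A)) (amap K \<Gamma> ?E r) = idm D (omap K \<Gamma>)"
        "tmsub D (omap K \<Gamma>) (ext D (omap K \<Gamma>) (tymap K \<Gamma> A)) (amap K \<Gamma> ?E r)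
          (tysub D (ext D (omap K \<Gamma>) (tymap K \<Gamma> A)) (omap K \<Gamma>) (wk D (omap K \<Gamma>) (tymap K \<Gamma> A))
             (tymap K \<Gamma> A)) (var D (omap K \<Gamma>) (tymap K \<Gamma> A)) = tmmap K \<Gamma> A t"
        "amap K \<Gamma> ?E r \<in> hom D (omap K \<Gamma>) (ext D (omap K \<Gamma>) (tymap K \<Gamma> A))"
      if "is_cwf_mor C D K" for K :: "('o, 'a, 't, 'e, 'p, 'b, 's, 'd, 'x) cwf_mor_scheme"
    proof -
      interpret K: is_cwf_mor C D K by fact
      note KE = K.ext_pres[OF G A]
      show "cmp D (omap K \<Gamma>) (ext D (omap K \<Gamma>) (tymap K \<Gamma> A)) (omap K \<Gamma>)
          (wk D (omap K \<Gamma>) (tymap K \<Gamma> A)) (amap K \<Gamma> ?E r) = idm D (omap K \<Gamma>)"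
        using K.amap_cmp[OF G E G r(1) C.wk_hom[OF G A]]
        by (simp add: r(2) K.amap_idm[OF G] K.wk_pres[OF G A] KE)
      have sw: "tysub C \<Gamma> ?E r ?W = A"
        using C.tysub_cmp[OF G E G r(1) C.wk_hom[OF G A] A] by (simp add: r(2) C.tysub_idm[OF G A])
      show "tmsub D (omap K \<Gamma>) (ext D (omap K \<Gamma>) (tymap K \<Gamma> A)) (amap K \<Gamma> ?E r)
          (tysub D (ext D (omap K \<Gamma>) (tymap K \<Gamma> A)) (omap K \<Gamma>) (wk D (omap K \<Gamma>) (tymap K \<Gamma> A))
             (tymap K \<Gamma> A)) (var D (omap K \<Gamma>) (tymap K \<Gamma> A)) = tmmap K \<Gamma> A t"
        using K.tmmap_nat[OF G E r(1) W C.var_tm[OF G A]]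
        by (simp add: r(3) sw K.var_pres[OF G A] K.tymap_nat[OF E G C.wk_hom[OF G A] A]
            K.wk_pres[OF G A] KE)
      show "amap K \<Gamma> ?E r \<in> hom D (omap K \<Gamma>) (ext D (omap K \<Gamma>) (tymap K \<Gamma> A))"
        using K.amap_hom[OF G E r(1)] KE by simp
    qed
    note MG = M.omap_obj[OF G] and NG = N.omap_obj[OF G]
    note MA = M.tymap_ty[OF G A] and NA = N.tymap_ty[OF G A]
    note NE = D.ext_obj[OF NG NA]
    note Mr = *[OF assms(3)] and Nr = *[OF assms(4)]
    have Mpair: "cwf_pair D (omap M \<Gamma>) (omap M \<Gamma>) (idm D (omap M \<Gamma>)) (tymap M \<Gamma> A) (tmmap M \<Gamma> A t)
        = amap M \<Gamma> ?E r"
      using M.tmmap_tm[OF G A t]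
      by (intro cwf_pair(4)[OF assms(2) MG MG D.idm_hom[OF MG] MA] Mr)
        (simp add: D.tysub_idm[OF MG MA])
    note th = T.nt_hom[OF G]
    note s = D.tmsub_tm[OF MG NG th NA N.tmmap_tm[OF G A t]]
    let ?r = "cmp D (omap M \<Gamma>) (omap N \<Gamma>) (ext D (omap N \<Gamma>) (tymap N \<Gamma> A)) (amap N \<Gamma> ?E r) (\<theta> \<Gamma>)"
    have "cwf_pair D (omap M \<Gamma>) (omap N \<Gamma>) (\<theta> \<Gamma>) (tymap N \<Gamma> A)
          (tmsub D (omap M \<Gamma>) (omap N \<Gamma>) (\<theta> \<Gamma>) (tymap N \<Gamma> A) (tmmap N \<Gamma> A t)) = ?r"
    proof (rule cwf_pair(4)[OF assms(2) MG NG th NA s])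
      show "?r \<in> hom D (omap M \<Gamma>) (ext D (omap N \<Gamma>) (tymap N \<Gamma> A))"
        by (rule D.cmp_hom[OF MG NG NE th Nr(3)])
      note w = D.wk_hom[OF NG NA]
      show "cmp D (omap M \<Gamma>) (ext D (omap N \<Gamma>) (tymap N \<Gamma> A)) (omap N \<Gamma>)
          (wk D (omap N \<Gamma>) (tymap N \<Gamma> A)) ?r = \<theta> \<Gamma>"
        using D.cmp_assoc[OF MG NG NE NG th Nr(3) w] by (simp add: Nr(1) D.idm_cmp[OF MG NG th])
      let ?V = "tysub D (ext D (omap N \<Gamma>) (tymap N \<Gamma> A)) (omap N \<Gamma>)
        (wk D (omap N \<Gamma>) (tymap N \<Gamma> A)) (tymap N \<Gamma> A)"
      have sV: "tysub D (omap N \<Gamma>) (ext D (omap N \<Gamma>) (tymap N \<Gamma> A)) (amap N \<Gamma> ?E r) ?V = tymap N \<Gamma> A"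
        using D.tysub_cmp[OF NG NE NG Nr(3) w NA] by (simp add: Nr(1) D.tysub_idm[OF NG NA])
      show "tmsub D (omap M \<Gamma>) (ext D (omap N \<Gamma>) (tymap N \<Gamma> A)) ?r ?V (var D (omap N \<Gamma>) (tymap N \<Gamma> A))
        = tmsub D (omap M \<Gamma>) (omap N \<Gamma>) (\<theta> \<Gamma>) (tymap N \<Gamma> A) (tmmap N \<Gamma> A t)"
        using D.tmsub_cmp[OF MG NG NE th Nr(3) D.tysub_ty[OF NE NG w NA] D.var_tm[OF NG NA]]
        by (simp add: Nr(2) sV)
    qed
    then show "cmp D (omap M \<Gamma>) (omap M ?E) (omap N ?E) (\<theta> ?E)
          (cwf_pair D (omap M \<Gamma>) (omap M \<Gamma>) (idm D (omap M \<Gamma>)) (tymap M \<Gamma> A) (tmmap M \<Gamma> A t))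
      = cwf_pair D (omap M \<Gamma>) (omap N \<Gamma>) (\<theta> \<Gamma>) (tymap N \<Gamma> A)
          (tmsub D (omap M \<Gamma>) (omap N \<Gamma>) (\<theta> \<Gamma>) (tymap N \<Gamma> A) (tmmap N \<Gamma> A t))"
      using T.nt_nat[OF G E r(1)] by (simp add: Mpair N.ext_pres[OF G A])
  qed
qed

lemma category_cwf_hom_cat:
  assumes "is_cwf C" and "is_cwf D"
  shows "category (cwf_hom_cat C D)"
proof -
  have D: "category D" using assms(2) by (rule is_cwf.axioms)
  show ?thesis
    by (unfold_locales; unfold cwf_hom_cat_def cat.simps mem_Collect_eq)
      (simp_all add: is_cwf_2mor_iff[OF assms] is_cwf_mor.axioms(1) nat_trans_nt_id[OF D]
        nat_trans_nt_cmp[OF D] nt_cmp_nt_id[OF D] nt_cmp_assoc[OF D])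
qed

lemma strict_2mor_ext:
  fixes C :: "('o, 'a, 't, 'e, 'z) cwf_scheme" and D :: "('p, 'b, 's, 'd, 'y) cwf_scheme"
    and M :: "('o, 'a, 't, 'e, 'p, 'b, 's, 'd, 'x) cwf_mor_scheme"
    and N :: "('o, 'a, 't, 'e, 'p, 'b, 's, 'd, 'w) cwf_mor_scheme" and \<theta> :: "'o \<Rightarrow> 'b"
  assumes "is_cwf C" and "is_cwf D" and "is_cwf_mor C D M" and "is_cwf_mor C D N"
    and "nat_trans C D M N \<theta>"
    and ty_eq: "\<And>\<Gamma> A. \<lbrakk>\<Gamma> \<in> obj C; A \<in> ty C \<Gamma>\<rbrakk>
      \<Longrightarrow> tysub D (omap M \<Gamma>) (omap N \<Gamma>) (\<theta> \<Gamma>) (tymap N \<Gamma> A) = tymap M \<Gamma> A"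
    and tm_eq: "\<And>\<Gamma> A t. \<lbrakk>\<Gamma> \<in> obj C; A \<in> ty C \<Gamma>; t \<in> tm C \<Gamma> A\<rbrakk>
      \<Longrightarrow> tmsub D (omap M \<Gamma>) (omap N \<Gamma>) (\<theta> \<Gamma>) (tymap N \<Gamma> A) (tmmap N \<Gamma> A t) = tmmap M \<Gamma> A t"
    and eC: "\<Gamma> \<in> obj C" and A: "A \<in> ty C \<Gamma>"
    and o_eq: "omap M \<Gamma> = omap N \<Gamma>" and th_e: "\<theta> \<Gamma> = idm D (omap M \<Gamma>)"
  shows "omap M (ext C \<Gamma> A) = omap N (ext C \<Gamma> A)"
    and "\<theta> (ext C \<Gamma> A) = idm D (omap M (ext C \<Gamma> A))"
proof -
  interpret C: is_cwf C by fact
  interpret D: is_cwf D by fact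
  interpret M: is_cwf_mor C D M by fact
  interpret N: is_cwf_mor C D N by fact
  interpret T: nat_trans C D M N \<theta> by fact
  let ?E = "omap N \<Gamma>" and ?G = "ext C \<Gamma> A" and ?B = "tymap M \<Gamma> A"
  let ?Y = "ext D ?E ?B"
  have eD: "?E \<in> obj D" using N.omap_obj[OF eC] .
  have G: "?G \<in> obj C" using C.ext_obj[OF eC A] .
  have N_ty: "tymap N \<Gamma> A \<in> ty D ?E" using N.tymap_ty[OF eC A] .
  have same_ty: "tymap N \<Gamma> A = ?B"
    using ty_eq[OF eC A] D.tysub_idm[OF eD N_ty] by (simp add: o_eq th_e)
  have B: "?B \<in> ty D ?E" using N_ty same_ty by simp
  have MG: "omap M ?G = ?Y" using M.ext_pres[OF eC A] by (simp add: o_eq)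
  have NG: "omap N ?G = ?Y" using N.ext_pres[OF eC A] by (simp add: same_ty)
  show "omap M ?G = omap N ?G" using MG NG by simp
  have Y: "?Y \<in> obj D" using D.ext_obj[OF eD B] .
  have th: "\<theta> ?G \<in> hom D ?Y ?Y" using T.nt_hom[OF G] MG NG by simp
  have wk: "wk D ?E ?B \<in> hom D ?Y ?E" using D.wk_hom[OF eD B] .
  let ?W = "tysub D ?Y ?E (wk D ?E ?B) ?B"
  have th_wk: "cmp D ?Y ?Y ?E (wk D ?E ?B) (\<theta> ?G) = wk D ?E ?B"
    using T.nt_nat[OF G eC C.wk_hom[OF eC A]] D.idm_cmp[OF Y eD wk]
    by (simp add: MG NG M.wk_pres[OF eC A] N.wk_pres[OF eC A] o_eq th_e same_ty)
  have wA: "tysub C ?G \<Gamma> (wk C \<Gamma> A) A \<in> ty C ?G"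
    by (rule C.tysub_ty[OF G eC C.wk_hom[OF eC A] A])
  have tyW: "tymap N ?G (tysub C ?G \<Gamma> (wk C \<Gamma> A) A) = ?W"
    using N.tymap_nat[OF G eC C.wk_hom[OF eC A] A] N.wk_pres[OF eC A]
    by (simp add: NG same_ty)
  have "tmsub D ?Y ?Y (\<theta> ?G) ?W (var D ?E ?B) = var D ?E ?B"
    using tm_eq[OF G wA C.var_tm[OF eC A]] N.var_pres[OF eC A] M.var_pres[OF eC A]
    by (simp add: MG NG o_eq same_ty tyW)
  moreover have "?W \<in> ty D ?Y" by (rule D.tysub_ty[OF Y eD wk B])
  then have "tmsub D ?Y ?Y (idm D ?Y) ?W (var D ?E ?B) = var D ?E ?B"
    using D.tmsub_idm[OF Y _ D.var_tm[OF eD B]] by simp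
  moreover have "cmp D ?Y ?Y ?E (wk D ?E ?B) (idm D ?Y) = wk D ?E ?B"
    by (rule D.cmp_idm[OF Y eD wk])
  ultimately have "\<theta> ?G = idm D ?Y"
    using D.comprehension[OF Y eD wk B D.var_tm[OF eD B]] th D.idm_hom[OF Y] th_wk by metis
  then show "\<theta> ?G = idm D (omap M ?G)" using MG by simp
qed


section \<open>The CwF of sets\<close>

definition set_cat :: "('u set, 'u \<Rightarrow> 'u) cat" where
  "set_cat = \<lparr>obj = UNIV, hom = (\<lambda>X Y. X \<rightarrow>\<^sub>E Y), idm = (\<lambda>X. \<lambda>x \<in> X. x),
     cmp = (\<lambda>X Y Z g f. compose X g f)\<rparr>"

definition set_ty :: "'u set \<Rightarrow> ('u set \<times> ('u \<Rightarrow> 'u)) set" where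
  "set_ty X = {(Y, f). f \<in> Y \<rightarrow>\<^sub>E X}"

definition set_tm :: "'u set \<Rightarrow> 'u set \<times> ('u \<Rightarrow> 'u) \<Rightarrow> ('u \<Rightarrow> 'u) set" where
  "set_tm X A = {s \<in> X \<rightarrow>\<^sub>E fst A. \<forall>x \<in> X. snd A (s x) = x}"

text \<open>Reindexing of functions into a set is by pullback. For it to be a functor, the pullbacks must
  be chosen compatibly with identities and composites. For \<open>g : X' \<rightarrow> X\<close> and a type \<open>A = (Y, f)\<close> over
  \<open>X\<close>, the type \<open>pull P X' X g A\<close> over \<open>X'\<close> and the map \<open>lift P X' X g A\<close> from its domain to \<open>Y\<close>
  form the chosen pullback square. Such choices exist on every infinite type; see
  \<open>split_pullbacks_exist\<close>.\<close>

record 'u pullbacks =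
  pull :: "'u set \<Rightarrow> 'u set \<Rightarrow> ('u \<Rightarrow> 'u) \<Rightarrow> 'u set \<times> ('u \<Rightarrow> 'u) \<Rightarrow> 'u set \<times> ('u \<Rightarrow> 'u)"
  lift :: "'u set \<Rightarrow> 'u set \<Rightarrow> ('u \<Rightarrow> 'u) \<Rightarrow> 'u set \<times> ('u \<Rightarrow> 'u) \<Rightarrow> 'u \<Rightarrow> 'u"

locale split_pullbacks =
  fixes P :: "'u pullbacks"
  assumes pull_ty: "\<lbrakk>g \<in> X' \<rightarrow>\<^sub>E X; A \<in> set_ty X\<rbrakk> \<Longrightarrow> pull P X' X g A \<in> set_ty X'"
    and lift_hom: "\<lbrakk>g \<in> X' \<rightarrow>\<^sub>E X; A \<in> set_ty X\<rbrakk>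
      \<Longrightarrow> lift P X' X g A \<in> fst (pull P X' X g A) \<rightarrow>\<^sub>E fst A"
    and pullback: "\<lbrakk>g \<in> X' \<rightarrow>\<^sub>E X; A \<in> set_ty X\<rbrakk>
      \<Longrightarrow> bij_betw (\<lambda>y. (snd (pull P X' X g A) y, lift P X' X g A y)) (fst (pull P X' X g A))
            {(x, y). x \<in> X' \<and> y \<in> fst A \<and> g x = snd A y}"
    and pull_id: "A \<in> set_ty X \<Longrightarrow> pull P X X (\<lambda>x \<in> X. x) A = A"
    and lift_id: "A \<in> set_ty X \<Longrightarrow> lift P X X (\<lambda>x \<in> X. x) A = (\<lambda>y \<in> fst A. y)"
    and pull_comp: "\<lbrakk>h \<in> X'' \<rightarrow>\<^sub>E X'; g \<in> X' \<rightarrow>\<^sub>E X; A \<in> set_ty X\<rbrakk>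
      \<Longrightarrow> pull P X'' X (compose X'' g h) A = pull P X'' X' h (pull P X' X g A)"
    and lift_comp: "\<lbrakk>h \<in> X'' \<rightarrow>\<^sub>E X'; g \<in> X' \<rightarrow>\<^sub>E X; A \<in> set_ty X\<rbrakk>
      \<Longrightarrow> lift P X'' X (compose X'' g h) A
        = compose (fst (pull P X'' X (compose X'' g h) A))
            (lift P X' X g A) (lift P X'' X' h (pull P X' X g A))"

lemma Banach_decomposition:
  assumes "i ` T \<subseteq> B" and "j ` B \<subseteq> T"
  obtains S where "S \<subseteq> T" and "j ` (B - i ` S) = T - S"
proof -
  define S where "S = lfp (\<lambda>S. T - j ` (B - i ` S))"
  have "mono (\<lambda>S. T - j ` (B - i ` S))" by (rule monoI) blast
  then have "S = T - j ` (B - i ` S)" unfolding S_def by (rule lfp_unfold)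
  moreover have "j ` (B - i ` S) \<subseteq> T" using assms(2) by blast
  ultimately have "S \<subseteq> T" "j ` (B - i ` S) = T - S" by blast+
  then show thesis by (rule that)
qed

text \<open>Functions into \<open>X\<close> correspond bijectively to families of sets over \<open>X\<close>, in such a way that
  each function is isomorphic over \<open>X\<close> to the projection from the sum of its family.\<close>

lemma set_ty_families:
  assumes "infinite (UNIV :: 'u set)"
  shows "\<exists>h e. bij_betw h (set_ty (X :: 'u set)) (X \<rightarrow>\<^sub>E (UNIV :: 'u set set)) \<and>
    (\<forall>A \<in> set_ty X. bij_betw (\<lambda>y. (snd A y, e A y :: 'u)) (fst A) (Sigma X (h A)))"
proof -
  obtain pr :: "'u \<times> 'u \<Rightarrow> 'u" where pr: "inj pr"
    using card_of_Times_same_infinite[OF assms] unfolding card_of_ordIso[symmetric] bij_betw_def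
    by auto
  have pr_eq [simp]: "pr p = pr q \<longleftrightarrow> p = q" for p q using pr by (auto dest: injD)
  define i where "i = (\<lambda>A :: 'u set \<times> ('u \<Rightarrow> 'u). \<lambda>x \<in> X. {y \<in> fst A. snd A y = x})"
  define j where "j = (\<lambda>F :: 'u \<Rightarrow> 'u set. (pr ` Sigma X F, \<lambda>y \<in> pr ` Sigma X F. fst (inv pr y)))"
  let ?B = "X \<rightarrow>\<^sub>E (UNIV :: 'u set set)"
  have iB: "i ` set_ty X \<subseteq> ?B" by (auto simp: i_def)
  have jT: "j ` ?B \<subseteq> set_ty X" by (auto simp: j_def set_ty_def pr)
  have i_inj: "inj_on i (set_ty X)"
  proof (rule inj_onI)
    fix A A' assume A: "A \<in> set_ty X" "A' \<in> set_ty X" and eq: "i A = i A'"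
    have *: "{y \<in> fst A. snd A y = x} = {y \<in> fst A'. snd A' y = x}" if "x \<in> X" for x
      using fun_cong[OF eq, of x] that by (simp add: i_def)
    obtain Y f Y' f' where [simp]: "A = (Y, f)" "A' = (Y', f')" by (cases A, cases A')
    have f: "f \<in> Y \<rightarrow>\<^sub>E X" "f' \<in> Y' \<rightarrow>\<^sub>E X" using A by (auto simp: set_ty_def)
    have iff: "y \<in> Y \<and> f y = x \<longleftrightarrow> y \<in> Y' \<and> f' y = x" if "x \<in> X" for x y
      using *[OF that] by auto
    have mem: "y \<in> Y \<Longrightarrow> f y \<in> X" "y \<in> Y' \<Longrightarrow> f' y \<in> X" for y using f by (auto dest: PiE_mem)
    have "y \<in> Y \<longleftrightarrow> y \<in> Y'" for y
      using iff[of "f y" y] iff[of "f' y" y] mem[of y] by blast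
    then have "Y = Y'" by blast
    moreover have "f = f'"
    proof
      fix y
      show "f y = f' y"
      proof (cases "y \<in> Y")
        case True then show ?thesis using iff[of "f y" y] mem(1)[of y] by simp
      next
        case False
        then show ?thesis using PiE_arb[OF f(1)] PiE_arb[OF f(2)] \<open>Y = Y'\<close> by simp
      qed
    qed
    ultimately show "A = A'" by simp
  qed
  have j_inj: "inj_on j ?B"
  proof (rule inj_onI)
    fix F F' assume F: "F \<in> ?B" "F' \<in> ?B" and "j F = j F'"
    then have "pr ` Sigma X F = pr ` Sigma X F'" by (simp add: j_def)
    then have S: "Sigma X F = Sigma X F'" by (simp add: inj_image_eq_iff[OF pr])
    have "F x = F' x" if "x \<in> X" for x
    proof (rule set_eqI)
      fix b show "b \<in> F x \<longleftrightarrow> b \<in> F' x" using arg_cong[OF S, of "\<lambda>S. (x, b) \<in> S"] that by simp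
    qed
    then show "F = F'" by (rule PiE_ext[OF F])
  qed
  obtain S where S: "S \<subseteq> set_ty X" and jS: "j ` (?B - i ` S) = set_ty X - S"
    using Banach_decomposition[OF iB jT] by blast
  define k where "k = inv_into (?B - i ` S) j"
  define h where "h = (\<lambda>A. if A \<in> S then i A else k A)"
  define e where "e = (\<lambda>A y. if A \<in> S then y else snd (inv pr y))"
  have j_bij: "bij_betw j (?B - i ` S) (set_ty X - S)"
    using jS j_inj by (auto simp: bij_betw_def inj_on_diff)
  have k_bij: "bij_betw k (set_ty X - S) (?B - i ` S)"
    unfolding k_def by (rule bij_betw_inv_into[OF j_bij])
  have jk: "j (k A) = A" if "A \<in> set_ty X - S" for A
    unfolding k_def by (rule bij_betw_inv_into_right[OF j_bij that])
  have "bij_betw h S (i ` S)"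
    using i_inj S by (auto simp: bij_betw_def h_def inj_on_def)
  moreover have "bij_betw h (set_ty X - S) (?B - i ` S)"
    using k_bij by (subst bij_betw_cong[where g = k]) (auto simp: h_def)
  ultimately have "bij_betw h (S \<union> (set_ty X - S)) (i ` S \<union> (?B - i ` S))"
    by (rule bij_betw_combine) blast
  moreover have "S \<union> (set_ty X - S) = set_ty X" "i ` S \<union> (?B - i ` S) = ?B"
    using S iB by blast+
  ultimately have "bij_betw h (set_ty X) ?B" by simp
  moreover have "bij_betw (\<lambda>y. (snd A y, e A y)) (fst A) (Sigma X (h A))" if A: "A \<in> set_ty X" for A
  proof (cases "A \<in> S")
    case True
    have "snd A \<in> fst A \<rightarrow>\<^sub>E X" using A by (auto simp: set_ty_def)
    then show ?thesis using True by (auto simp: bij_betw_def inj_on_def h_def e_def i_def)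
  next
    case False
    then have jkA: "A = j (k A)" using jk A by simp
    have fA: "fst A = pr ` Sigma X (k A)"
      and sA: "snd A = (\<lambda>y \<in> pr ` Sigma X (k A). fst (inv pr y))"
      by (subst jkA, simp add: j_def)+
    have "bij_betw (\<lambda>y. (snd A y, e A y)) (pr ` Sigma X (k A)) (Sigma X (k A))"
      using False by (intro bij_betw_byWitness[where f' = pr]) (auto simp: sA e_def pr)
    then show ?thesis using False by (simp add: h_def fA)
  qed
  ultimately show ?thesis by blast
qed

lemma split_pullbacks_exist:
  assumes "infinite (UNIV :: 'u set)"
  shows "\<exists>P :: 'u pullbacks. split_pullbacks P"
proof -
  have "\<forall>X :: 'u set. \<exists>h e. bij_betw h (set_ty X) (X \<rightarrow>\<^sub>E (UNIV :: 'u set set)) \<and>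
    (\<forall>A \<in> set_ty X. bij_betw (\<lambda>y. (snd A y, e A y :: 'u)) (fst A) (Sigma X (h A)))"
    using set_ty_families[OF assms] by blast
  then obtain h e where
      h: "\<And>X :: 'u set. bij_betw (h X) (set_ty X) (X \<rightarrow>\<^sub>E (UNIV :: 'u set set))"
      and e: "\<And>X A. A \<in> set_ty X
        \<Longrightarrow> bij_betw (\<lambda>y. (snd A y, e X A y :: 'u)) (fst A) (Sigma X (h X A))"
    by metis
  define pl where "pl = (\<lambda>X' X g A. inv_into (set_ty X') (h X') (\<lambda>x \<in> X'. h X A (g x)))"
  define lf where "lf = (\<lambda>X' X g A. \<lambda>y \<in> fst (pl X' X g A).
    inv_into (fst A) (\<lambda>y. (snd A y, e X A y)) (g (snd (pl X' X g A) y), e X' (pl X' X g A) y))"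
  have fam: "(\<lambda>x \<in> X'. h X A (g x)) \<in> X' \<rightarrow>\<^sub>E UNIV" for X' X g A by auto
  have pl_ty: "pl X' X g A \<in> set_ty X'" for X' X g A
    unfolding pl_def by (rule inv_into_into) (unfold bij_betw_imp_surj_on[OF h], rule fam)
  have h_pl: "h X' (pl X' X g A) = (\<lambda>x \<in> X'. h X A (g x))" for X' X g A
    unfolding pl_def by (rule bij_betw_inv_into_right[OF h fam])
  have h_eq: "A = A'" if "h X A = h X A'" "A \<in> set_ty X" "A' \<in> set_ty X" for X A A'
    using bij_betw_imp_inj_on[OF h] that by (meson inj_onD)
  have snd_ty: "snd A y \<in> X" if "A \<in> set_ty X" "y \<in> fst A" for A X y
    using that by (auto simp: set_ty_def)
  have e_in: "e X A y \<in> h X A (snd A y)" if "A \<in> set_ty X" "y \<in> fst A" for X A y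
    using bij_betwE[OF e[OF that(1)]] that(2) by auto
  have e_eq: "y = y'" if "A \<in> set_ty X" "y \<in> fst A" "y' \<in> fst A" "snd A y = snd A y'"
    "e X A y = e X A y'" for X A y y'
    using bij_betw_imp_inj_on[OF e[OF that(1)]] that(2-) by (auto dest: inj_onD)
  have e_ex: "\<exists>y \<in> fst A. snd A y = x \<and> e X A y = b" if "A \<in> set_ty X" "x \<in> X" "b \<in> h X A x" for X A x b
  proof -
    have "(x, b) \<in> (\<lambda>y. (snd A y, e X A y)) ` fst A"
      using bij_betw_imp_surj_on[OF e[OF that(1)]] that by auto
    then show ?thesis by auto
  qed
  have lf: "lf X' X g A y \<in> fst A \<and> snd A (lf X' X g A y) = g (snd (pl X' X g A) y) \<and>
      e X A (lf X' X g A y) = e X' (pl X' X g A) y"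
    if g: "g \<in> X' \<rightarrow>\<^sub>E X" and A: "A \<in> set_ty X" and y: "y \<in> fst (pl X' X g A)" for X' X g A y
  proof -
    let ?p = "(g (snd (pl X' X g A) y), e X' (pl X' X g A) y)"
    have sx: "snd (pl X' X g A) y \<in> X'" using snd_ty[OF pl_ty y] .
    then have "?p \<in> Sigma X (h X A)"
      using e_in[OF pl_ty y] g by (auto simp: h_pl)
    then have p: "?p \<in> (\<lambda>y. (snd A y, e X A y)) ` fst A"
      using bij_betw_imp_surj_on[OF e[OF A]] by simp
    show ?thesis using f_inv_into_f[OF p] inv_into_into[OF p] y by (simp add: lf_def)
  qed
  have lf_eqI: "lf X' X g A y = z" if "g \<in> X' \<rightarrow>\<^sub>E X" "A \<in> set_ty X" "y \<in> fst (pl X' X g A)"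
    "z \<in> fst A" "snd A z = g (snd (pl X' X g A) y)" "e X A z = e X' (pl X' X g A) y" for X' X g A y z
    using lf[OF that(1-3)] that by - (rule e_eq[OF that(2), of "lf X' X g A y" z], simp_all)
  have pl_id: "pl X X (\<lambda>x \<in> X. x) A = A" if A: "A \<in> set_ty X" for X A
  proof (rule h_eq[OF _ pl_ty A])
    have "h X A \<in> X \<rightarrow>\<^sub>E UNIV" using bij_betwE[OF h] A by blast
    then show "h X (pl X X (\<lambda>x \<in> X. x) A) = h X A"
      by (simp add: h_pl PiE_restrict cong: restrict_cong)
  qed
  have pl_comp: "pl X'' X (compose X'' g k) A = pl X'' X' k (pl X' X g A)"
    if "k \<in> X'' \<rightarrow>\<^sub>E X'" "g \<in> X' \<rightarrow>\<^sub>E X" "A \<in> set_ty X" for X'' X' X g k A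
    using that by - (rule h_eq[OF _ pl_ty pl_ty], auto simp: h_pl compose_def dest: PiE_mem intro!: restrict_ext)
  have "split_pullbacks \<lparr>pull = pl, lift = lf\<rparr>"
  proof (unfold_locales, simp_all only: pullbacks.simps)
    fix g :: "'u \<Rightarrow> 'u" and X' X :: "'u set" and A :: "'u set \<times> ('u \<Rightarrow> 'u)"
    assume g: "g \<in> X' \<rightarrow>\<^sub>E X" and A: "A \<in> set_ty X"
    show "pl X' X g A \<in> set_ty X'" by (rule pl_ty)
    show "lf X' X g A \<in> fst (pl X' X g A) \<rightarrow>\<^sub>E fst A"
      using lf[OF g A] by (intro PiE_I) (auto simp: lf_def)
    show "bij_betw (\<lambda>y. (snd (pl X' X g A) y, lf X' X g A y)) (fst (pl X' X g A))
        {(x, y). x \<in> X' \<and> y \<in> fst A \<and> g x = snd A y}"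
    proof (rule bij_betw_imageI)
      show "inj_on (\<lambda>y. (snd (pl X' X g A) y, lf X' X g A y)) (fst (pl X' X g A))"
      proof (rule inj_onI, clarsimp)
        fix y y' assume y: "y \<in> fst (pl X' X g A)" "y' \<in> fst (pl X' X g A)"
          and eq: "snd (pl X' X g A) y = snd (pl X' X g A) y'" "lf X' X g A y = lf X' X g A y'"
        show "y = y'"
          using lf[OF g A y(1)] lf[OF g A y(2)] eq by - (rule e_eq[OF pl_ty y], auto)
      qed
      show "(\<lambda>y. (snd (pl X' X g A) y, lf X' X g A y)) ` fst (pl X' X g A)
        = {(x, y). x \<in> X' \<and> y \<in> fst A \<and> g x = snd A y}"
      proof (intro equalityI subsetI)
        fix p assume "p \<in> (\<lambda>y. (snd (pl X' X g A) y, lf X' X g A y)) ` fst (pl X' X g A)"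
        then show "p \<in> {(x, y). x \<in> X' \<and> y \<in> fst A \<and> g x = snd A y}"
          using lf[OF g A] snd_ty[OF pl_ty[of X' X g A]] by auto
      next
        fix p assume "p \<in> {(x, y). x \<in> X' \<and> y \<in> fst A \<and> g x = snd A y}"
        then obtain x z where p: "p = (x, z)" and x: "x \<in> X'" and z: "z \<in> fst A" "g x = snd A z"
          by auto
        have "e X A z \<in> h X' (pl X' X g A) x" using e_in[OF A z(1)] x z by (simp add: h_pl)
        then obtain y where y: "y \<in> fst (pl X' X g A)" "snd (pl X' X g A) y = x"
          "e X' (pl X' X g A) y = e X A z"
          using e_ex[OF pl_ty x] by blast
        then have "lf X' X g A y = z" using z by - (rule lf_eqI[OF g A], auto)
        then show "p \<in> (\<lambda>y. (snd (pl X' X g A) y, lf X' X g A y)) ` fst (pl X' X g A)"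
          using y p by (intro image_eqI[where x = y]) auto
      qed
    qed
  next
    fix X and A :: "'u set \<times> ('u \<Rightarrow> 'u)"
    assume A: "A \<in> set_ty X"
    show "pl X X (\<lambda>x \<in> X. x) A = A" by (rule pl_id[OF A])
    have id: "(\<lambda>x \<in> X. x) \<in> X \<rightarrow>\<^sub>E X" by auto
    show "lf X X (\<lambda>x \<in> X. x) A = (\<lambda>y \<in> fst A. y)"
    proof
      fix y show "lf X X (\<lambda>x \<in> X. x) A y = (\<lambda>y \<in> fst A. y) y"
      proof (cases "y \<in> fst A")
        case True
        then have "lf X X (\<lambda>x \<in> X. x) A y = y"
          using snd_ty[OF A True] by - (rule lf_eqI[OF id A], (simp_all add: pl_id[OF A]))
        then show ?thesis using True by simp
      next
        case False then show ?thesis by (simp add: lf_def pl_id[OF A])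
      qed
    qed
  next
    fix k g :: "'u \<Rightarrow> 'u" and X'' X' X :: "'u set" and A :: "'u set \<times> ('u \<Rightarrow> 'u)"
    assume k: "k \<in> X'' \<rightarrow>\<^sub>E X'" and g: "g \<in> X' \<rightarrow>\<^sub>E X" and A: "A \<in> set_ty X"
    have gk: "compose X'' g k \<in> X'' \<rightarrow>\<^sub>E X" using k g by (auto simp: compose_def)
    note pc = pl_comp[OF k g A]
    show "pl X'' X (compose X'' g k) A = pl X'' X' k (pl X' X g A)" by (rule pc)
    show "lf X'' X (compose X'' g k) A = compose (fst (pl X'' X (compose X'' g k) A))
            (lf X' X g A) (lf X'' X' k (pl X' X g A))"
    proof
      fix y show "lf X'' X (compose X'' g k) A y = compose (fst (pl X'' X (compose X'' g k) A))
            (lf X' X g A) (lf X'' X' k (pl X' X g A)) y"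
      proof (cases "y \<in> fst (pl X'' X (compose X'' g k) A)")
        case True
        then have y: "y \<in> fst (pl X'' X' k (pl X' X g A))" by (simp add: pc)
        note l1 = lf[OF k pl_ty y]
        note l2 = lf[OF g A conjunct1[OF l1]]
        have "lf X'' X (compose X'' g k) A y = lf X' X g A (lf X'' X' k (pl X' X g A) y)"
          using l1 l2 snd_ty[OF pl_ty y]
          by - (rule lf_eqI[OF gk A True], (simp_all add: pc compose_eq))
        then show ?thesis using True by (simp add: compose_def)
      next
        case False then show ?thesis by (simp add: lf_def compose_def)
      qed
    qed
  qed
  then show ?thesis by blast
qed

text \<open>The reindexing of a section along \<open>g\<close>, as the section of the pullback induced by its universal
  property.\<close>

definition set_tmsub :: "'u pullbacks \<Rightarrow> 'u set \<Rightarrow> 'u set \<Rightarrow> ('u \<Rightarrow> 'u)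
    \<Rightarrow> 'u set \<times> ('u \<Rightarrow> 'u) \<Rightarrow> ('u \<Rightarrow> 'u) \<Rightarrow> 'u \<Rightarrow> 'u" where
  "set_tmsub P X' X g A s =
     (THE s'. s' \<in> set_tm X' (pull P X' X g A) \<and> (\<forall>x \<in> X'. lift P X' X g A (s' x) = s (g x)))"

definition set_cwf :: "'u pullbacks
    \<Rightarrow> ('u set, 'u \<Rightarrow> 'u, 'u set \<times> ('u \<Rightarrow> 'u), 'u \<Rightarrow> 'u) cwf" where
  "set_cwf P = cat.extend set_cat (cwf.fields
     set_ty
     set_tm
     (pull P)
     (set_tmsub P)
     {undefined}
     (\<lambda>X A. fst A)
     (\<lambda>X A. snd A)
     (\<lambda>X A. THE s. s \<in> set_tm (fst A) (pull P (fst A) X (snd A) A) \<and>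
        (\<forall>y \<in> fst A. lift P (fst A) X (snd A) A (s y) = y)))"

lemma set_cwf_simps:
  "obj (set_cwf P) = UNIV"
  "hom (set_cwf P) = (\<lambda>X Y. X \<rightarrow>\<^sub>E Y)"
  "idm (set_cwf P) = (\<lambda>X. \<lambda>x \<in> X. x)"
  "cmp (set_cwf P) = (\<lambda>X Y Z g f. compose X g f)"
  "ty (set_cwf P) = set_ty"
  "tm (set_cwf P) = set_tm"
  "tysub (set_cwf P) = pull P"
  "tmsub (set_cwf P) = set_tmsub P"
  "emp (set_cwf P) = {undefined}"
  "ext (set_cwf P) = (\<lambda>X A. fst A)"
  "wk (set_cwf P) = (\<lambda>X A. snd A)"
  "var (set_cwf P) = (\<lambda>X A. THE s. s \<in> set_tm (fst A) (pull P (fst A) X (snd A) A) \<and>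
     (\<forall>y \<in> fst A. lift P (fst A) X (snd A) A (s y) = y))"
  by (simp_all add: set_cwf_def cat.defs cwf.defs set_cat_def)

lemma compose_PiE: "f \<in> A \<rightarrow>\<^sub>E B \<Longrightarrow> g \<in> B \<rightarrow>\<^sub>E C \<Longrightarrow> compose A g f \<in> A \<rightarrow>\<^sub>E C"
  by (auto simp: compose_def)

lemma PiE_imp_Pi: "f \<in> A \<rightarrow>\<^sub>E B \<Longrightarrow> f \<in> A \<rightarrow> B"
  by (simp add: PiE_def)

lemma PiE_imp_extensional: "f \<in> A \<rightarrow>\<^sub>E B \<Longrightarrow> f \<in> extensional A"
  by (simp add: PiE_def)

lemma set_cat_laws:
  "(\<lambda>x \<in> A. x) \<in> A \<rightarrow>\<^sub>E A"
  "f \<in> A \<rightarrow>\<^sub>E B \<Longrightarrow> compose A f (\<lambda>x \<in> A. x) = f"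
  "f \<in> A \<rightarrow>\<^sub>E B \<Longrightarrow> compose A (\<lambda>x \<in> B. x) f = f"
  "f \<in> A \<rightarrow>\<^sub>E B \<Longrightarrow> g \<in> B \<rightarrow>\<^sub>E C \<Longrightarrow> h \<in> C \<rightarrow>\<^sub>E D
    \<Longrightarrow> compose A h (compose A g f) = compose A (compose B h g) f"
  by (auto intro: compose_Id Id_compose compose_assoc dest: PiE_imp_Pi PiE_imp_extensional)

lemma category_set_cat: "category (set_cat :: ('u set, 'u \<Rightarrow> 'u) cat)"
  unfolding set_cat_def
  by unfold_locales (simp_all only: cat.simps set_cat_laws compose_PiE)

lemma is_cwf_set_cwf:
  assumes "split_pullbacks (P :: 'u pullbacks)"
  shows "is_cwf (set_cwf P)"
proof -
  interpret split_pullbacks P by fact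
  have jm: "y = y'" if "g \<in> X' \<rightarrow>\<^sub>E X" "A \<in> set_ty X" "y \<in> fst (pull P X' X g A)"
      "y' \<in> fst (pull P X' X g A)" "snd (pull P X' X g A) y = snd (pull P X' X g A) y'"
      "lift P X' X g A y = lift P X' X g A y'" for g X' X A y y'
    using bij_betw_imp_inj_on[OF pullback[OF that(1,2)]] that(3-) by (auto dest: inj_onD)
  have ex: "\<exists>y \<in> fst (pull P X' X g A). snd (pull P X' X g A) y = x \<and> lift P X' X g A y = z"
    if "g \<in> X' \<rightarrow>\<^sub>E X" "A \<in> set_ty X" "x \<in> X'" "z \<in> fst A" "g x = snd A z" for g X' X A x z
  proof -
    have "(x, z) \<in> (\<lambda>y. (snd (pull P X' X g A) y, lift P X' X g A y)) ` fst (pull P X' X g A)"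
      using bij_betw_imp_surj_on[OF pullback[OF that(1,2)]] that(3-) by auto
    then show ?thesis by auto
  qed
  have sq: "snd A (lift P X' X g A y) = g (snd (pull P X' X g A) y)"
    if "g \<in> X' \<rightarrow>\<^sub>E X" "A \<in> set_ty X" "y \<in> fst (pull P X' X g A)" for g X' X A y
    using bij_betwE[OF pullback[OF that(1,2)]] that(3) by auto
  have sect: "\<exists>!s. s \<in> set_tm X' (pull P X' X g A) \<and> (\<forall>x \<in> X'. lift P X' X g A (s x) = r x)"
    if g: "g \<in> X' \<rightarrow>\<^sub>E X" and A: "A \<in> set_ty X" and r: "\<And>x. x \<in> X' \<Longrightarrow> r x \<in> fst A"
      "\<And>x. x \<in> X' \<Longrightarrow> g x = snd A (r x)" for g X' X A r
  proof -
    obtain s where s: "\<And>x. x \<in> X' \<Longrightarrow> s x \<in> fst (pull P X' X g A) \<and>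
        snd (pull P X' X g A) (s x) = x \<and> lift P X' X g A (s x) = r x"
      using ex[OF g A _ r] by metis
    show ?thesis
    proof (rule ex1I[of _ "restrict s X'"])
      show "restrict s X' \<in> set_tm X' (pull P X' X g A) \<and>
          (\<forall>x \<in> X'. lift P X' X g A (restrict s X' x) = r x)"
        using s by (auto simp: set_tm_def)
    next
      fix s' assume s': "s' \<in> set_tm X' (pull P X' X g A) \<and>
          (\<forall>x \<in> X'. lift P X' X g A (s' x) = r x)"
      then have "s' \<in> X' \<rightarrow>\<^sub>E fst (pull P X' X g A)" by (auto simp: set_tm_def)
      moreover have "restrict s X' \<in> X' \<rightarrow>\<^sub>E fst (pull P X' X g A)" using s by auto
      moreover have "s' x = restrict s X' x" if "x \<in> X'" for x
        using s[OF that] s' that by - (rule jm[OF g A], auto simp: set_tm_def)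
      ultimately show "s' = restrict s X'" by (rule PiE_ext)
    qed
  qed
  have tm_sect: "\<exists>!s'. s' \<in> set_tm X' (pull P X' X g A) \<and> (\<forall>x \<in> X'. lift P X' X g A (s' x) = s (g x))"
    if g: "g \<in> X' \<rightarrow>\<^sub>E X" and A: "A \<in> set_ty X" and s: "s \<in> set_tm X A" for g X' X A s
  proof (rule sect[OF g A, where r = "\<lambda>x. s (g x)"])
    fix x assume "x \<in> X'"
    then have "g x \<in> X" using g by auto
    then show "s (g x) \<in> fst A" "g x = snd A (s (g x))" using s by (auto simp: set_tm_def)
  qed
  have tms: "set_tmsub P X' X g A s \<in> set_tm X' (pull P X' X g A) \<and>
      (\<forall>x \<in> X'. lift P X' X g A (set_tmsub P X' X g A s x) = s (g x))"
    if "g \<in> X' \<rightarrow>\<^sub>E X" "A \<in> set_ty X" "s \<in> set_tm X A" for g X' X A s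
    unfolding set_tmsub_def using theI'[OF tm_sect[OF that]] .
  have tms_eq: "set_tmsub P X' X g A s = s'"
    if "g \<in> X' \<rightarrow>\<^sub>E X" "A \<in> set_ty X" "s \<in> set_tm X A" "s' \<in> set_tm X' (pull P X' X g A)"
      "\<And>x. x \<in> X' \<Longrightarrow> lift P X' X g A (s' x) = s (g x)" for g X' X A s s'
    unfolding set_tmsub_def by (rule the1_equality[OF tm_sect[OF that(1-3)]]) (use that in blast)
  let ?v = "\<lambda>X A. THE s. s \<in> set_tm (fst A) (pull P (fst A) X (snd A) A) \<and>
        (\<forall>y \<in> fst A. lift P (fst A) X (snd A) A (s y) = y)"
  have sndA: "snd A \<in> fst A \<rightarrow>\<^sub>E X" if "A \<in> set_ty X" for A :: "'u set \<times> ('u \<Rightarrow> 'u)" and X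
    using that by (auto simp: set_ty_def)
  have v: "?v X A \<in> set_tm (fst A) (pull P (fst A) X (snd A) A) \<and>
      (\<forall>y \<in> fst A. lift P (fst A) X (snd A) A (?v X A y) = y)" if A: "A \<in> set_ty X" for X A
    using theI'[OF sect[OF sndA[OF A] A, where r = "\<lambda>y. y"]] by simp

  show ?thesis
  proof (unfold_locales; unfold set_cwf_simps)
    fix a :: "'u set" show "(\<lambda>x \<in> a. x) \<in> a \<rightarrow>\<^sub>E a" by (rule set_cat_laws)
  next
    fix a b c :: "'u set" and f g :: "'u \<Rightarrow> 'u" assume "f \<in> a \<rightarrow>\<^sub>E b" "g \<in> b \<rightarrow>\<^sub>E c"
    then show "compose a g f \<in> a \<rightarrow>\<^sub>E c" by (rule compose_PiE)
  next
    fix a b :: "'u set" and f :: "'u \<Rightarrow> 'u" assume "f \<in> a \<rightarrow>\<^sub>E b"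
    then show "compose a f (\<lambda>x \<in> a. x) = f" "compose a (\<lambda>x \<in> b. x) f = f"
      by (rule set_cat_laws)+
  next
    fix a b c d :: "'u set" and f g h :: "'u \<Rightarrow> 'u"
    assume "f \<in> a \<rightarrow>\<^sub>E b" "g \<in> b \<rightarrow>\<^sub>E c" "h \<in> c \<rightarrow>\<^sub>E d"
    then show "compose a h (compose a g f) = compose a (compose b h g) f" by (rule set_cat_laws)
  next
    fix \<Delta> \<Gamma> :: "'u set" and \<sigma> :: "'u \<Rightarrow> 'u" and A
    assume \<sigma>: "\<sigma> \<in> \<Delta> \<rightarrow>\<^sub>E \<Gamma>" and A: "A \<in> set_ty \<Gamma>"
    show "pull P \<Delta> \<Gamma> \<sigma> A \<in> set_ty \<Delta>" by (rule pull_ty[OF \<sigma> A])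
    fix t assume t: "t \<in> set_tm \<Gamma> A"
    show "set_tmsub P \<Delta> \<Gamma> \<sigma> A t \<in> set_tm \<Delta> (pull P \<Delta> \<Gamma> \<sigma> A)" using tms[OF \<sigma> A t] by blast
  next
    fix \<Gamma> :: "'u set" and A assume A: "A \<in> set_ty \<Gamma>"
    show "pull P \<Gamma> \<Gamma> (\<lambda>x \<in> \<Gamma>. x) A = A" by (rule pull_id[OF A])
    fix t assume t: "t \<in> set_tm \<Gamma> A"
    then have "x \<in> \<Gamma> \<Longrightarrow> t x \<in> fst A" for x by (auto simp: set_tm_def)
    then show "set_tmsub P \<Gamma> \<Gamma> (\<lambda>x \<in> \<Gamma>. x) A t = t"
      using t by (intro tms_eq[OF set_cat_laws(1) A]) (simp_all add: pull_id[OF A] lift_id[OF A])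
  next
    fix \<Theta> \<Delta> \<Gamma> :: "'u set" and \<tau> \<sigma> :: "'u \<Rightarrow> 'u" and A
    assume \<tau>: "\<tau> \<in> \<Theta> \<rightarrow>\<^sub>E \<Delta>" and \<sigma>: "\<sigma> \<in> \<Delta> \<rightarrow>\<^sub>E \<Gamma>" and A: "A \<in> set_ty \<Gamma>"
    note pc = pull_comp[OF \<tau> \<sigma> A]
    show "pull P \<Theta> \<Gamma> (compose \<Theta> \<sigma> \<tau>) A = pull P \<Theta> \<Delta> \<tau> (pull P \<Delta> \<Gamma> \<sigma> A)" by (rule pc)
    fix t assume t: "t \<in> set_tm \<Gamma> A"
    note A' = pull_ty[OF \<sigma> A]
    note t1 = tms[OF \<sigma> A t]
    note t2 = tms[OF \<tau> A' conjunct1[OF t1]]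
    let ?s = "set_tmsub P \<Theta> \<Delta> \<tau> (pull P \<Delta> \<Gamma> \<sigma> A) (set_tmsub P \<Delta> \<Gamma> \<sigma> A t)"
    show "set_tmsub P \<Theta> \<Gamma> (compose \<Theta> \<sigma> \<tau>) A t = ?s"
    proof (rule tms_eq[OF compose_PiE[OF \<tau> \<sigma>] A t])
      show "?s \<in> set_tm \<Theta> (pull P \<Theta> \<Gamma> (compose \<Theta> \<sigma> \<tau>) A)" using t2 by (simp add: pc)
      fix x assume x: "x \<in> \<Theta>"
      have "?s x \<in> fst (pull P \<Theta> \<Delta> \<tau> (pull P \<Delta> \<Gamma> \<sigma> A))" using t2 x by (auto simp: set_tm_def)
      moreover have "\<tau> x \<in> \<Delta>" using \<tau> x by auto
      ultimately show "lift P \<Theta> \<Gamma> (compose \<Theta> \<sigma> \<tau>) A (?s x) = t (compose \<Theta> \<sigma> \<tau> x)"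
        using t1 t2 x by (simp add: lift_comp[OF \<tau> \<sigma> A] pc compose_eq)
    qed
  next
    fix \<Gamma> :: "'u set"
    show "\<exists>!\<sigma>. \<sigma> \<in> \<Gamma> \<rightarrow>\<^sub>E {undefined :: 'u}"
    proof (rule ex1I)
      show "(\<lambda>_. undefined) \<in> \<Gamma> \<rightarrow>\<^sub>E {undefined :: 'u}" by auto
      fix \<sigma> assume \<sigma>: "\<sigma> \<in> \<Gamma> \<rightarrow>\<^sub>E {undefined :: 'u}"
      show "\<sigma> = (\<lambda>_. undefined)"
      proof
        fix x show "\<sigma> x = undefined" using PiE_mem[OF \<sigma>, of x] PiE_arb[OF \<sigma>, of x] by blast
      qed
    qed
  next
    fix \<Gamma> :: "'u set" and A assume A: "A \<in> set_ty \<Gamma>"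
    show "snd A \<in> fst A \<rightarrow>\<^sub>E \<Gamma>" by (rule sndA[OF A])
    show "?v \<Gamma> A \<in> set_tm (fst A) (pull P (fst A) \<Gamma> (snd A) A)" using v[OF A] by blast
  next
    fix \<Delta> \<Gamma> :: "'u set" and \<sigma> :: "'u \<Rightarrow> 'u" and A t
    assume \<sigma>: "\<sigma> \<in> \<Delta> \<rightarrow>\<^sub>E \<Gamma>" and A: "A \<in> set_ty \<Gamma>" and t: "t \<in> set_tm \<Delta> (pull P \<Delta> \<Gamma> \<sigma> A)"
    note A' = pull_ty[OF sndA[OF A] A]
    let ?W = "pull P (fst A) \<Gamma> (snd A) A" and ?L = "lift P \<Delta> \<Gamma> \<sigma> A"
    have t_mem: "t x \<in> fst (pull P \<Delta> \<Gamma> \<sigma> A)" "snd (pull P \<Delta> \<Gamma> \<sigma> A) (t x) = x" if "x \<in> \<Delta>" for x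
      using t that by (auto simp: set_tm_def)
    have Lt: "?L (t x) \<in> fst A" if "x \<in> \<Delta>" for x
      using lift_hom[OF \<sigma> A] t_mem(1)[OF that] by auto
    have key: "set_tmsub P \<Delta> (fst A) \<rho> ?W (?v \<Gamma> A) = t \<longleftrightarrow> (\<forall>x \<in> \<Delta>. ?L (t x) = \<rho> x)"
      if \<rho>: "\<rho> \<in> \<Delta> \<rightarrow>\<^sub>E fst A" and c: "compose \<Delta> (snd A) \<rho> = \<sigma>" for \<rho>
    proof -
      note pc = pull_comp[OF \<rho> sndA[OF A] A, unfolded c]
      note lc = lift_comp[OF \<rho> sndA[OF A] A, unfolded c]
      note vt = conjunct1[OF v[OF A]]
      note m = tms[OF \<rho> A' vt]
      have v1: "lift P (fst A) \<Gamma> (snd A) A (?v \<Gamma> A y) = y" if "y \<in> fst A" for y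
        using v[OF A] that by blast
      have \<rho>x: "\<rho> x \<in> fst A" if "x \<in> \<Delta>" for x using \<rho> that by auto
      let ?s = "set_tmsub P \<Delta> (fst A) \<rho> ?W (?v \<Gamma> A)"
      have L: "?L y = lift P (fst A) \<Gamma> (snd A) A (lift P \<Delta> (fst A) \<rho> ?W y)"
        if "y \<in> fst (pull P \<Delta> \<Gamma> \<sigma> A)" for y
        using that by (subst lc) (simp add: compose_eq)
      have s_mem: "?s \<in> set_tm \<Delta> (pull P \<Delta> \<Gamma> \<sigma> A)" using m by (simp add: pc)
      have s_L: "?L (?s x) = \<rho> x" if x: "x \<in> \<Delta>" for x
      proof -
        have "?s x \<in> fst (pull P \<Delta> \<Gamma> \<sigma> A)" using s_mem x by (auto simp: set_tm_def)
        then show ?thesis using m x v1[OF \<rho>x[OF x]] by (simp add: L)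
      qed
      show ?thesis
      proof
        assume "?s = t" then show "\<forall>x \<in> \<Delta>. ?L (t x) = \<rho> x" using s_L by auto
      next
        assume eq: "\<forall>x \<in> \<Delta>. ?L (t x) = \<rho> x"
        have "?s \<in> \<Delta> \<rightarrow>\<^sub>E fst (pull P \<Delta> \<Gamma> \<sigma> A)" "t \<in> \<Delta> \<rightarrow>\<^sub>E fst (pull P \<Delta> \<Gamma> \<sigma> A)"
          using s_mem t by (auto simp: set_tm_def)
        moreover have "?s x = t x" if x: "x \<in> \<Delta>" for x
        proof (rule jm[OF \<sigma> A])
          show "?s x \<in> fst (pull P \<Delta> \<Gamma> \<sigma> A)" "t x \<in> fst (pull P \<Delta> \<Gamma> \<sigma> A)"
            "snd (pull P \<Delta> \<Gamma> \<sigma> A) (?s x) = snd (pull P \<Delta> \<Gamma> \<sigma> A) (t x)"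
            using s_mem t x by (auto simp: set_tm_def)
          show "?L (?s x) = ?L (t x)" using s_L[OF x] eq x by simp
        qed
        ultimately show "?s = t" by (rule PiE_ext)
      qed
    qed
    let ?r = "\<lambda>x \<in> \<Delta>. ?L (t x)"
    have r: "?r \<in> \<Delta> \<rightarrow>\<^sub>E fst A" using Lt by auto
    have rc: "compose \<Delta> (snd A) ?r = \<sigma>"
    proof (rule PiE_ext[OF compose_PiE[OF r sndA[OF A]] \<sigma>])
      fix x assume "x \<in> \<Delta>"
      then show "compose \<Delta> (snd A) ?r x = \<sigma> x"
        using sq[OF \<sigma> A t_mem(1)[of x]] t_mem(2)[of x] by (simp add: compose_eq)
    qed
    show "\<exists>!\<rho>. \<rho> \<in> \<Delta> \<rightarrow>\<^sub>E fst A \<and> compose \<Delta> (snd A) \<rho> = \<sigma> \<and>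
        set_tmsub P \<Delta> (fst A) \<rho> ?W (?v \<Gamma> A) = t"
    proof (rule ex1I[of _ ?r])
      show "?r \<in> \<Delta> \<rightarrow>\<^sub>E fst A \<and> compose \<Delta> (snd A) ?r = \<sigma> \<and>
          set_tmsub P \<Delta> (fst A) ?r ?W (?v \<Gamma> A) = t"
        using r rc key[OF r rc] by simp
    next
      fix \<rho> assume \<rho>: "\<rho> \<in> \<Delta> \<rightarrow>\<^sub>E fst A \<and> compose \<Delta> (snd A) \<rho> = \<sigma> \<and>
          set_tmsub P \<Delta> (fst A) \<rho> ?W (?v \<Gamma> A) = t"
      then have "\<forall>x \<in> \<Delta>. ?L (t x) = \<rho> x" using key by blast
      then show "\<rho> = ?r" using \<rho> r by (intro PiE_ext[of \<rho> \<Delta> "\<lambda>_. fst A"]) auto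
    qed
  qed simp_all
qed


section \<open>The type theory of globular sets\<close>

text \<open>Variables are de Bruijn levels, which gives one representative for each context up to renaming:
  \<open>V i\<close> is the variable declared at position \<open>i\<close> of the context, so weakening leaves types and terms
  unchanged. \<open>Arr A t u\<close> is the type of arrows from \<open>t\<close> to \<open>u\<close> in \<open>A\<close>.\<close>

datatype gtm = V nat

datatype gty = Star | Arr gty gtm gtm

inductive wf_ctx :: "gty list \<Rightarrow> bool"
  and wf_ty :: "gty list \<Rightarrow> gty \<Rightarrow> bool"
  and wf_tm :: "gty list \<Rightarrow> gtm \<Rightarrow> gty \<Rightarrow> bool" where
  ctx_empty: "wf_ctx []"
| ctx_ext: "wf_ctx \<Gamma> \<Longrightarrow> wf_ty \<Gamma> A \<Longrightarrow> wf_ctx (\<Gamma> @ [A])"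
| ty_star: "wf_ctx \<Gamma> \<Longrightarrow> wf_ty \<Gamma> Star"
| ty_arr: "wf_ty \<Gamma> A \<Longrightarrow> wf_tm \<Gamma> t A \<Longrightarrow> wf_tm \<Gamma> u A \<Longrightarrow> wf_ty \<Gamma> (Arr A t u)"
| tm_var: "wf_ctx \<Gamma> \<Longrightarrow> i < length \<Gamma> \<Longrightarrow> wf_tm \<Gamma> (V i) (\<Gamma> ! i)"

primrec sub_tm :: "gtm list \<Rightarrow> gtm \<Rightarrow> gtm" where
  "sub_tm \<sigma> (V i) = \<sigma> ! i"

primrec sub_ty :: "gtm list \<Rightarrow> gty \<Rightarrow> gty" where
  "sub_ty \<sigma> Star = Star"
| "sub_ty \<sigma> (Arr A t u) = Arr (sub_ty \<sigma> A) (sub_tm \<sigma> t) (sub_tm \<sigma> u)"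

inductive wf_sub :: "gty list \<Rightarrow> gtm list \<Rightarrow> gty list \<Rightarrow> bool" where
  sub_empty: "wf_ctx \<Delta> \<Longrightarrow> wf_sub \<Delta> [] []"
| sub_ext: "wf_sub \<Delta> \<sigma> \<Gamma> \<Longrightarrow> wf_ty \<Gamma> A \<Longrightarrow> wf_tm \<Delta> t (sub_ty \<sigma> A)
    \<Longrightarrow> wf_sub \<Delta> (\<sigma> @ [t]) (\<Gamma> @ [A])"

definition syn_glob :: "(gty list, gtm list, gty, gtm) cwf" where
  "syn_glob =
     \<lparr>obj = {\<Gamma>. wf_ctx \<Gamma>},
      hom = (\<lambda>\<Delta> \<Gamma>. {\<sigma>. wf_sub \<Delta> \<sigma> \<Gamma>}),
      idm = (\<lambda>\<Gamma>. map V [0..<length \<Gamma>]),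
      cmp = (\<lambda>\<Theta> \<Delta> \<Gamma> \<sigma> \<tau>. map (sub_tm \<tau>) \<sigma>),
      ty = (\<lambda>\<Gamma>. {A. wf_ty \<Gamma> A}),
      tm = (\<lambda>\<Gamma> A. {t. wf_tm \<Gamma> t A}),
      tysub = (\<lambda>\<Delta> \<Gamma> \<sigma> A. sub_ty \<sigma> A),
      tmsub = (\<lambda>\<Delta> \<Gamma> \<sigma> A t. sub_tm \<sigma> t),
      emp = [],
      ext = (\<lambda>\<Gamma> A. \<Gamma> @ [A]),
      wk = (\<lambda>\<Gamma> A. map V [0..<length \<Gamma>]),
      var = (\<lambda>\<Gamma> A. V (length \<Gamma>))\<rparr>"

lemma wf_ctx_snoc: "wf_ctx (\<Gamma> @ [A]) \<longleftrightarrow> wf_ctx \<Gamma> \<and> wf_ty \<Gamma> A"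
  by (auto elim: wf_ctx.cases intro: ctx_ext)

lemma wf_ty_Star: "wf_ty \<Gamma> Star \<longleftrightarrow> wf_ctx \<Gamma>"
  by (auto elim: wf_ty.cases intro: ty_star)

lemma wf_ty_Arr: "wf_ty \<Gamma> (Arr A t u) \<longleftrightarrow> wf_ty \<Gamma> A \<and> wf_tm \<Gamma> t A \<and> wf_tm \<Gamma> u A"
  by (auto elim: wf_ty.cases intro: ty_arr)

lemma wf_tm_iff: "wf_tm \<Gamma> t A \<longleftrightarrow> wf_ctx \<Gamma> \<and> (\<exists>i < length \<Gamma>. t = V i \<and> A = \<Gamma> ! i)"
  by (auto elim: wf_tm.cases intro: tm_var)

lemma wf_ty_ctx: "wf_ty \<Gamma> A \<Longrightarrow> wf_ctx \<Gamma>"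
  by (induction A) (auto simp: wf_ty_Star wf_ty_Arr)

lemma wf_ty_weaken: "wf_ctx (\<Gamma> @ [B]) \<Longrightarrow> wf_ty \<Gamma> A \<Longrightarrow> wf_ty (\<Gamma> @ [B]) A"
  by (induction A) (auto simp: wf_ty_Star wf_ty_Arr wf_tm_iff nth_append)

lemma wf_ty_nth: "wf_ctx \<Gamma> \<Longrightarrow> i < length \<Gamma> \<Longrightarrow> wf_ty \<Gamma> (\<Gamma> ! i)"
  by (induction \<Gamma> rule: rev_induct)
    (auto simp: wf_ctx_snoc nth_append less_Suc_eq intro: wf_ty_weaken)

lemma sub_ty_cong:
  "wf_ty \<Gamma> A \<Longrightarrow> (\<And>i. i < length \<Gamma> \<Longrightarrow> \<sigma> ! i = \<tau> ! i) \<Longrightarrow> sub_ty \<sigma> A = sub_ty \<tau> A"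
  by (induction A) (auto simp: wf_ty_Arr wf_tm_iff)

lemma wf_sub_iff: "wf_sub \<Delta> \<sigma> \<Gamma> \<longleftrightarrow> wf_ctx \<Delta> \<and> wf_ctx \<Gamma> \<and> length \<sigma> = length \<Gamma> \<and>
  (\<forall>i < length \<Gamma>. wf_tm \<Delta> (\<sigma> ! i) (sub_ty \<sigma> (\<Gamma> ! i)))"
proof (intro iffI)
  assume "wf_sub \<Delta> \<sigma> \<Gamma>"
  then show "wf_ctx \<Delta> \<and> wf_ctx \<Gamma> \<and> length \<sigma> = length \<Gamma> \<and>
    (\<forall>i < length \<Gamma>. wf_tm \<Delta> (\<sigma> ! i) (sub_ty \<sigma> (\<Gamma> ! i)))"
  proof induction
    case (sub_empty \<Delta>) then show ?case by (simp add: ctx_empty)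
  next
    case (sub_ext \<Delta> \<sigma> \<Gamma> A t)
    have "sub_ty (\<sigma> @ [t]) B = sub_ty \<sigma> B" if "wf_ty \<Gamma> B" for B
      using sub_ext by (intro sub_ty_cong[OF that]) (simp add: nth_append)
    then show ?case using sub_ext by (auto simp: wf_ctx_snoc nth_append less_Suc_eq wf_ty_nth)
  qed
next
  assume "wf_ctx \<Delta> \<and> wf_ctx \<Gamma> \<and> length \<sigma> = length \<Gamma> \<and>
    (\<forall>i < length \<Gamma>. wf_tm \<Delta> (\<sigma> ! i) (sub_ty \<sigma> (\<Gamma> ! i)))"
  then show "wf_sub \<Delta> \<sigma> \<Gamma>"
  proof (induction \<Gamma> arbitrary: \<sigma> rule: rev_induct)
    case Nil then show ?case by (simp add: sub_empty)
  next
    case (snoc A \<Gamma>)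
    then obtain \<sigma>' t where \<sigma>: "\<sigma> = \<sigma>' @ [t]" and len: "length \<sigma>' = length \<Gamma>"
      by (cases \<sigma> rule: rev_cases) auto
    have *: "sub_ty (\<sigma>' @ [t]) B = sub_ty \<sigma>' B" if "wf_ty \<Gamma> B" for B
      using len by (intro sub_ty_cong[OF that]) (simp add: nth_append)
    have "wf_tm \<Delta> (\<sigma>' ! i) (sub_ty \<sigma>' (\<Gamma> ! i))" if "i < length \<Gamma>" for i
      using snoc.prems that *[OF wf_ty_nth[of \<Gamma> i]] len
      by (auto simp: \<sigma> nth_append wf_ctx_snoc dest!: spec[of _ i])
    then have "wf_sub \<Delta> \<sigma>' \<Gamma>" using snoc.prems len by (intro snoc.IH) (simp add: wf_ctx_snoc)
    moreover have A: "wf_ty \<Gamma> A" using snoc.prems by (simp add: wf_ctx_snoc)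
    moreover have "wf_tm \<Delta> t (sub_ty \<sigma>' A)"
      using snoc.prems len *[OF A] by (auto simp: \<sigma> nth_append dest!: spec[of _ "length \<Gamma>"])
    ultimately show ?case unfolding \<sigma> by (rule sub_ext)
  qed
qed

lemma wf_tm_sub: "wf_sub \<Delta> \<sigma> \<Gamma> \<Longrightarrow> wf_tm \<Gamma> t A \<Longrightarrow> wf_tm \<Delta> (sub_tm \<sigma> t) (sub_ty \<sigma> A)"
  by (auto simp: wf_sub_iff wf_tm_iff[of \<Gamma>])

lemma wf_ty_sub: "wf_sub \<Delta> \<sigma> \<Gamma> \<Longrightarrow> wf_ty \<Gamma> A \<Longrightarrow> wf_ty \<Delta> (sub_ty \<sigma> A)"
proof (induction A)
  case Star then show ?case by (simp add: wf_ty_Star wf_sub_iff)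
next
  case (Arr A t u) then show ?case by (simp add: wf_ty_Arr wf_tm_sub)
qed

lemma sub_ty_map:
  "wf_ty \<Gamma> A \<Longrightarrow> length \<sigma> = length \<Gamma> \<Longrightarrow> sub_ty (map (sub_tm \<tau>) \<sigma>) A = sub_ty \<tau> (sub_ty \<sigma> A)"
  by (induction A) (auto simp: wf_ty_Arr wf_tm_iff)

lemma sub_ty_vars: "wf_ty \<Gamma> A \<Longrightarrow> length \<Gamma> \<le> n \<Longrightarrow> sub_ty (map V [0..<n]) A = A"
  by (induction A) (auto simp: wf_ty_Arr wf_tm_iff)

lemma syn_glob_simps:
  "obj syn_glob = {\<Gamma>. wf_ctx \<Gamma>}"
  "hom syn_glob = (\<lambda>\<Delta> \<Gamma>. {\<sigma>. wf_sub \<Delta> \<sigma> \<Gamma>})"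
  "idm syn_glob = (\<lambda>\<Gamma>. map V [0..<length \<Gamma>])"
  "cmp syn_glob = (\<lambda>\<Theta> \<Delta> \<Gamma> \<sigma> \<tau>. map (sub_tm \<tau>) \<sigma>)"
  "ty syn_glob = (\<lambda>\<Gamma>. {A. wf_ty \<Gamma> A})"
  "tm syn_glob = (\<lambda>\<Gamma> A. {t. wf_tm \<Gamma> t A})"
  "tysub syn_glob = (\<lambda>\<Delta> \<Gamma> \<sigma> A. sub_ty \<sigma> A)"
  "tmsub syn_glob = (\<lambda>\<Delta> \<Gamma> \<sigma> A t. sub_tm \<sigma> t)"
  "emp syn_glob = []"
  "ext syn_glob = (\<lambda>\<Gamma> A. \<Gamma> @ [A])"
  "wk syn_glob = (\<lambda>\<Gamma> A. map V [0..<length \<Gamma>])"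
  "var syn_glob = (\<lambda>\<Gamma> A. V (length \<Gamma>))"
  by (simp_all add: syn_glob_def)

lemma is_cwf_syn_glob: "is_cwf syn_glob"
proof (unfold_locales; unfold syn_glob_simps mem_Collect_eq)
  fix \<Gamma> assume "wf_ctx \<Gamma>"
  then show "wf_sub \<Gamma> (map V [0..<length \<Gamma>]) \<Gamma>"
    by (auto simp: wf_sub_iff sub_ty_vars[OF wf_ty_nth] intro: tm_var)
next
  fix a b c f g assume f: "wf_sub a f b" and g: "wf_sub b g c"
  then have "wf_tm a (sub_tm f (g ! i)) (sub_ty (map (sub_tm f) g) (c ! i))" if "i < length c" for i
    using that wf_tm_sub[OF f] by (auto simp: wf_sub_iff[of b g] sub_ty_map[OF wf_ty_nth])
  then show "wf_sub a (map (sub_tm f) g) c" using f g by (simp add: wf_sub_iff)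
next
  fix a b f assume "wf_sub a f b"
  then show "map (sub_tm (map V [0..<length a])) f = f" "map (sub_tm f) (map V [0..<length b]) = f"
    by (intro nth_equalityI; auto simp: wf_sub_iff wf_tm_iff)+
next
  fix a b c d f g h assume "wf_sub a f b" "wf_sub b g c" "wf_sub c h d"
  then show "map (sub_tm (map (sub_tm f) g)) h = map (sub_tm f) (map (sub_tm g) h)"
    by (intro nth_equalityI; auto simp: wf_sub_iff wf_tm_iff)
next
  fix \<Delta> \<Gamma> \<sigma> A assume "wf_sub \<Delta> \<sigma> \<Gamma>" "wf_ty \<Gamma> A"
  then show "wf_ty \<Delta> (sub_ty \<sigma> A)" by (rule wf_ty_sub)
next
  fix \<Delta> \<Gamma> \<sigma> A t assume "wf_sub \<Delta> \<sigma> \<Gamma>" "wf_tm \<Gamma> t A"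
  then show "wf_tm \<Delta> (sub_tm \<sigma> t) (sub_ty \<sigma> A)" by (rule wf_tm_sub)
next
  fix \<Gamma> A assume "wf_ty \<Gamma> A"
  then show "sub_ty (map V [0..<length \<Gamma>]) A = A" by (rule sub_ty_vars) simp
next
  fix \<Gamma> A t assume "wf_tm \<Gamma> t A"
  then show "sub_tm (map V [0..<length \<Gamma>]) t = t" by (auto simp: wf_tm_iff)
next
  fix \<Theta> \<Delta> \<Gamma> \<tau> \<sigma> A assume "wf_sub \<Delta> \<sigma> \<Gamma>" "wf_ty \<Gamma> A"
  then show "sub_ty (map (sub_tm \<tau>) \<sigma>) A = sub_ty \<tau> (sub_ty \<sigma> A)"
    by (simp add: sub_ty_map wf_sub_iff)
next
  fix \<Theta> \<Delta> \<Gamma> \<tau> \<sigma> A t assume "wf_sub \<Delta> \<sigma> \<Gamma>" "wf_tm \<Gamma> t A"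
  then show "sub_tm (map (sub_tm \<tau>) \<sigma>) t = sub_tm \<tau> (sub_tm \<sigma> t)"
    by (auto simp: wf_tm_iff wf_sub_iff)
next
  show "wf_ctx []" by (rule ctx_empty)
  fix \<Gamma> assume "wf_ctx \<Gamma>"
  then show "\<exists>!\<sigma>. wf_sub \<Gamma> \<sigma> []" by (auto simp: wf_sub_iff ctx_empty)
next
  fix \<Gamma> A assume A: "wf_ctx \<Gamma>" "wf_ty \<Gamma> A"
  then show E: "wf_ctx (\<Gamma> @ [A])" by (rule ctx_ext)
  show "wf_sub (\<Gamma> @ [A]) (map V [0..<length \<Gamma>]) \<Gamma>"
    using A E by (auto simp: wf_sub_iff sub_ty_vars[OF wf_ty_nth] wf_tm_iff nth_append)
  show "wf_tm (\<Gamma> @ [A]) (V (length \<Gamma>)) (sub_ty (map V [0..<length \<Gamma>]) A)"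
    using A E by (simp add: sub_ty_vars wf_tm_iff)
next
  fix \<Delta> \<Gamma> \<sigma> A t
  assume \<sigma>: "wf_sub \<Delta> \<sigma> \<Gamma>" and A: "wf_ty \<Gamma> A" and t: "wf_tm \<Delta> t (sub_ty \<sigma> A)"
  have len: "length \<sigma> = length \<Gamma>" using \<sigma> by (simp add: wf_sub_iff)
  show "\<exists>!\<rho>. wf_sub \<Delta> \<rho> (\<Gamma> @ [A]) \<and> map (sub_tm \<rho>) (map V [0..<length \<Gamma>]) = \<sigma> \<and>
      sub_tm \<rho> (V (length \<Gamma>)) = t"
  proof (rule ex1I[of _ "\<sigma> @ [t]"])
    show "wf_sub \<Delta> (\<sigma> @ [t]) (\<Gamma> @ [A]) \<and>
        map (sub_tm (\<sigma> @ [t])) (map V [0..<length \<Gamma>]) = \<sigma> \<and> sub_tm (\<sigma> @ [t]) (V (length \<Gamma>)) = t"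
      using sub_ext[OF \<sigma> A t] len by (auto simp: nth_append intro!: nth_equalityI)
  next
    fix \<rho> assume \<rho>: "wf_sub \<Delta> \<rho> (\<Gamma> @ [A]) \<and> map (sub_tm \<rho>) (map V [0..<length \<Gamma>]) = \<sigma> \<and>
        sub_tm \<rho> (V (length \<Gamma>)) = t"
    then have "length \<rho> = Suc (length \<Gamma>)" by (simp add: wf_sub_iff)
    then show "\<rho> = \<sigma> @ [t]"
      using \<rho> by (cases \<rho> rule: rev_cases) (auto simp: nth_append intro!: nth_equalityI)
  qed
qed

text \<open>With an equality of types and terms as compatibility condition, a 2-morphism between models of
  the theory would be an identity.\<close>

lemma strict_2mor_collapse:
  fixes D :: "('p, 'b, 's, 'd, 'y) cwf_scheme"
    and M :: "(gty list, gtm list, gty, gtm, 'p, 'b, 's, 'd, 'x) cwf_mor_scheme"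
    and N :: "(gty list, gtm list, gty, gtm, 'p, 'b, 's, 'd, 'w) cwf_mor_scheme"
  assumes "is_cwf D" and "is_cwf_mor syn_glob D M" and "is_cwf_mor syn_glob D N"
    and "nat_trans syn_glob D M N \<theta>"
    and ty_eq: "\<And>\<Gamma> A. \<lbrakk>\<Gamma> \<in> obj syn_glob; A \<in> ty syn_glob \<Gamma>\<rbrakk>
      \<Longrightarrow> tysub D (omap M \<Gamma>) (omap N \<Gamma>) (\<theta> \<Gamma>) (tymap N \<Gamma> A) = tymap M \<Gamma> A"
    and tm_eq: "\<And>\<Gamma> A t. \<lbrakk>\<Gamma> \<in> obj syn_glob; A \<in> ty syn_glob \<Gamma>; t \<in> tm syn_glob \<Gamma> A\<rbrakk>
      \<Longrightarrow> tmsub D (omap M \<Gamma>) (omap N \<Gamma>) (\<theta> \<Gamma>) (tymap N \<Gamma> A) (tmmap N \<Gamma> A t) = tmmap M \<Gamma> A t"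
    and "wf_ctx \<Gamma>"
  shows "omap M \<Gamma> = omap N \<Gamma> \<and> \<theta> \<Gamma> = idm D (omap M \<Gamma>)"
  using \<open>wf_ctx \<Gamma>\<close>
proof (induction \<Gamma> rule: rev_induct)
  case Nil
  interpret D: is_cwf D by fact
  interpret M: is_cwf_mor syn_glob D M by fact
  interpret N: is_cwf_mor syn_glob D N by fact
  interpret T: nat_trans syn_glob D M N \<theta> by fact
  have "omap M [] = emp D" "omap N [] = emp D"
    using M.emp_pres N.emp_pres by (simp_all add: syn_glob_simps)
  moreover have "\<theta> [] \<in> hom D (omap M []) (omap N [])"
    using T.nt_hom[of "[]"] by (simp add: syn_glob_simps ctx_empty)
  ultimately show ?case
    using D.emp_terminal[OF D.emp_obj] D.idm_hom[OF D.emp_obj] by auto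
next
  case (snoc A \<Gamma>)
  then have "\<Gamma> \<in> obj syn_glob" "A \<in> ty syn_glob \<Gamma>"
    by (simp_all add: syn_glob_simps wf_ctx_snoc)
  then show ?case
    using strict_2mor_ext[OF is_cwf_syn_glob assms(1-6), of \<Gamma> A] snoc
    by (simp add: syn_glob_simps wf_ctx_snoc)
qed


section \<open>Globular sets\<close>

text \<open>The category of globes is presented by generators and relations. A morphism \<open>i \<rightarrow> j\<close> is a class
  of words \<open>[g\<^sub>i, \<dots>, g\<^bsub>j-1\<^esub>]\<close>, written in the order in which the generators are applied:
  \<open>Src\<close> at position \<open>k\<close> is the generator \<open>\<sigma> : i + k \<rightarrow> i + k + 1\<close>, and \<open>Tgt\<close> is \<open>\<tau>\<close>.\<close>

datatype globe_gen = Src | Tgt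

inductive globe_eq :: "globe_gen list \<Rightarrow> globe_gen list \<Rightarrow> bool" where
  src_rel: "globe_eq [Src, Src] [Src, Tgt]"
| tgt_rel: "globe_eq [Tgt, Src] [Tgt, Tgt]"
| globe_refl: "globe_eq v v"
| globe_sym: "globe_eq v w \<Longrightarrow> globe_eq w v"
| globe_trans: "globe_eq u v \<Longrightarrow> globe_eq v w \<Longrightarrow> globe_eq u w"
| globe_cong: "globe_eq v w \<Longrightarrow> globe_eq (a @ v @ b) (a @ w @ b)"

definition globe_class :: "globe_gen list \<Rightarrow> globe_gen list set" where
  "globe_class w = {v. globe_eq w v}"

definition globe_cat :: "(nat, globe_gen list set) cat" where
  "globe_cat =
     \<lparr>obj = UNIV,
      hom = (\<lambda>i j. {globe_class w |w. i + length w = j}),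
      idm = (\<lambda>i. globe_class []),
      cmp = (\<lambda>i j k g f. \<Union>v \<in> f. \<Union>w \<in> g. globe_class (v @ w))\<rparr>"

lemma globe_eq_length: "globe_eq v w \<Longrightarrow> length v = length w"
  by (induction rule: globe_eq.induct) auto

lemma globe_class_eq: "globe_class v = globe_class w \<longleftrightarrow> globe_eq v w"
  unfolding globe_class_def by (auto intro: globe_refl globe_sym globe_trans)

lemma globe_eq_append: "globe_eq v v' \<Longrightarrow> globe_eq w w' \<Longrightarrow> globe_eq (v @ w) (v' @ w')"
  using globe_cong[of v v' "[]" w] globe_cong[of w w' v' "[]"] by (auto intro: globe_trans)

lemma globe_cmp: "cmp globe_cat i j k (globe_class w) (globe_class v) = globe_class (v @ w)"
proof -
  have "globe_class (v' @ w') = globe_class (v @ w)"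
    if "v' \<in> globe_class v" "w' \<in> globe_class w" for v' w'
    unfolding globe_class_eq
    using that globe_eq_append[of v v' w w'] by (auto simp: globe_class_def intro: globe_sym)
  moreover have "v \<in> globe_class v" "w \<in> globe_class w" by (auto simp: globe_class_def globe_refl)
  ultimately show ?thesis unfolding globe_cat_def cat.simps by blast
qed

lemma globe_cat_simps:
  "obj globe_cat = UNIV"
  "hom globe_cat = (\<lambda>i j. {globe_class w |w. i + length w = j})"
  "idm globe_cat = (\<lambda>i. globe_class [])"
  by (simp_all add: globe_cat_def)

lemma category_globe_cat: "category globe_cat"
proof (unfold_locales; unfold globe_cat_simps)
  fix a b c f g
  assume "f \<in> {globe_class w |w. a + length w = b}" "g \<in> {globe_class w |w. b + length w = c}"
  then obtain v w where "f = globe_class v" "a + length v = b" "g = globe_class w" "b + length w = c"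
    by blast
  then show "cmp globe_cat a b c g f \<in> {globe_class w |w. a + length w = c}"
    by (auto simp: globe_cmp intro!: exI[of _ "v @ w"])
qed (auto simp: globe_cmp)

definition gset_cat :: "((nat, globe_gen list set, 'u set, 'u \<Rightarrow> 'u) functr, nat \<Rightarrow> 'u \<Rightarrow> 'u) cat"
  where "gset_cat = functor_cat (op_cat globe_cat) set_cat"

end

theory Submission
  imports Defs
begin

text \<open>The functor sends a model \<open>M\<close> to the globular set \<open>n \<mapsto> M (disk n)\<close>, where \<open>disk n\<close> is the context
  presenting the \<open>n\<close>-globe. A type of dimension \<open>n\<close> over \<open>\<Gamma>\<close> is the reindexing of the universal one,
  \<open>globe_ty n\<close> over \<open>sphere n\<close>, along a substitution \<open>\<Gamma> \<rightarrow> sphere n\<close>. As \<open>M\<close> preserves comprehension,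
  \<open>M (\<Gamma>, A)\<close> is therefore the pullback of \<open>M \<Gamma> \<rightarrow> M (sphere n) \<leftarrow> M (disk n)\<close>, and by induction on \<open>\<Gamma>\<close>
  the set \<open>M \<Gamma>\<close> is in natural bijection with the environments for \<open>\<Gamma>\<close> in the globular set of \<open>M\<close>:
  the assignments of cells to the variables of \<open>\<Gamma>\<close> with the sources and targets that \<open>\<Gamma>\<close> prescribes.
  Hence a morphism of globular sets extends to a unique natural transformation of models. Conversely,
  the environments of an arbitrary globular set, coded inside \<open>'u\<close> by iterating the chosen pullbacks,
  form a model.\<close>

section \<open>Fully faithful, essentially surjective functors\<close>

text \<open>Strictness is the obstacle. A model must carry comprehension and reindexing exactly to
  the sets and pullbacks chosen by \<open>P\<close>, so its value at a context cannot be adjusted up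
  to bijection: it has to be built from those choices, one variable at a time. Points are therefore
  compared through environments, where equations become equations between lists of cells. Variables
  suffice as coordinates because a variable of type \<open>A\<close> in \<Gamma> amounts to a
  substitution from \<Gamma> to \<open>disk (dim A)\<close>. Naturality at these substitutions
  determines a transformation from its components at the disks. In the converse direction, the
  universal types live over all of \<open>'u\<close> and not over the set attached to a sphere. That
  set is itself a product of the construction, whereas a boundary can be coded at once as a pair of
  cells. The coding returns a given globular set only up to isomorphism, so the equivalence is
  derived from full faithfulness and essential surjectivity.\<close>

lemma equivalent_categoriesI:
  fixes F :: "('o, 'a, 'p, 'b) functr"
  assumes "category C" and "category D" and "is_functor C D F"
    and ff: "\<And>a b g. \<lbrakk>a \<in> obj C; b \<in> obj C; g \<in> hom D (omap F a) (omap F b)\<rbrakk>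
      \<Longrightarrow> \<exists>!f. f \<in> hom C a b \<and> amap F a b f = g"
    and es: "\<And>d. d \<in> obj D \<Longrightarrow> \<exists>c \<in> obj C. \<exists>e. is_iso D (omap F c) d e"
  shows "equivalent_categories C D"
proof -
  interpret C: category C by fact
  interpret D: category D by fact
  interpret F: is_functor C D F by fact
  have "\<forall>d. \<exists>c e e'. d \<in> obj D \<longrightarrow> c \<in> obj C \<and> e \<in> hom D (omap F c) d \<and> e' \<in> hom D d (omap F c) \<and>
      cmp D (omap F c) d (omap F c) e' e = idm D (omap F c) \<and> cmp D d (omap F c) d e e' = idm D d"
    using es unfolding is_iso_def by metis
  then obtain K e e' where Ke: "\<And>d. d \<in> obj D \<Longrightarrow> K d \<in> obj C \<and> e d \<in> hom D (omap F (K d)) d \<and>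
      e' d \<in> hom D d (omap F (K d)) \<and>
      cmp D (omap F (K d)) d (omap F (K d)) (e' d) (e d) = idm D (omap F (K d)) \<and>
      cmp D d (omap F (K d)) d (e d) (e' d) = idm D d"
    by metis
  define H where "H = (\<lambda>d. omap F (K d))"
  have FK: "omap F (K d) = H d" for d by (simp add: H_def)
  have K: "K d \<in> obj C" and H: "H d \<in> obj D" and e: "e d \<in> hom D (H d) d"
    and e': "e' d \<in> hom D d (H d)" and e'e: "cmp D (H d) d (H d) (e' d) (e d) = idm D (H d)"
    and ee': "cmp D d (H d) d (e d) (e' d) = idm D d" if "d \<in> obj D" for d
    using Ke[OF that] F.omap_obj by (auto simp: H_def)
  have FH: "amap F (K a) (K b) h \<in> hom D (H a) (H b)"
    if "a \<in> obj D" "b \<in> obj D" "h \<in> hom C (K a) (K b)" for a b h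
    using F.amap_hom[OF K[OF that(1)] K[OF that(2)] that(3)] by (simp add: H_def)
  \<comment> \<open>Composition with \<open>e d\<close> is inverted by composition with
    \<open>e' d\<close>. The quasi-inverse can thus be characterised by equations in which
    \<open>e'\<close> does not occur.\<close>
  have e_cancel: "g = cmp D a d (H d) (e' d) k \<longleftrightarrow> cmp D a (H d) d (e d) g = k"
    if "a \<in> obj D" "d \<in> obj D" "g \<in> hom D a (H d)" "k \<in> hom D a d" for a d g k
    using D.cmp_assoc[OF that(1) H[OF that(2)] that(2) H[OF that(2)] that(3) e e']
      D.cmp_assoc[OF that(1,2) H[OF that(2)] that(2) that(4) e' e] that
    by (auto simp: e'e ee' D.idm_cmp H)
  \<comment> \<open>The condition on \<open>h\<close> is the naturality square of \<open>e\<close>.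
    Taking it as the definition of the quasi-inverse on arrows makes \<open>e\<close> natural by
    construction and yields functoriality from uniqueness.\<close>
  have tr: "\<exists>!h. h \<in> hom C (K a) (K b) \<and>
      cmp D (H a) (H b) b (e b) (amap F (K a) (K b) h) = cmp D (H a) a b f (e a)"
    if "a \<in> obj D" "b \<in> obj D" "f \<in> hom D a b" for a b f
  proof -
    let ?k = "cmp D (H a) a b f (e a)"
    have k: "?k \<in> hom D (H a) b" using that by (intro D.cmp_hom[of _ a]) (auto intro: H e)
    have "cmp D (H a) b (H b) (e' b) ?k \<in> hom D (H a) (H b)"
      using that k by (intro D.cmp_hom[of _ b]) (auto intro: H e')
    then have "\<exists>!h. h \<in> hom C (K a) (K b) \<and>
        amap F (K a) (K b) h = cmp D (H a) b (H b) (e' b) ?k"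
      using ff[OF K K, of a b] that unfolding H_def by blast
    then show ?thesis using e_cancel[OF H _ FH k] that by (metis (no_types, lifting))
  qed
  define T where "T = (\<lambda>a b f. THE h. h \<in> hom C (K a) (K b) \<and>
      cmp D (H a) (H b) b (e b) (amap F (K a) (K b) h) = cmp D (H a) a b f (e a))"
  have T: "T a b f \<in> hom C (K a) (K b)"
      "cmp D (H a) (H b) b (e b) (amap F (K a) (K b) (T a b f)) = cmp D (H a) a b f (e a)"
    if "a \<in> obj D" "b \<in> obj D" "f \<in> hom D a b" for a b f
    using theI'[OF tr[OF that]] unfolding T_def by blast+
  have T_eq: "T a b f = h" if "a \<in> obj D" "b \<in> obj D" "f \<in> hom D a b" "h \<in> hom C (K a) (K b)"
      "cmp D (H a) (H b) b (e b) (amap F (K a) (K b) h) = cmp D (H a) a b f (e a)" for a b f h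
    unfolding T_def by (rule the1_equality[OF tr[OF that(1-3)]]) (use that in blast)
  define G where "G = \<lparr>omap = (\<lambda>d \<in> obj D. K d),
      amap = (\<lambda>a b f. if a \<in> obj D \<and> b \<in> obj D \<and> f \<in> hom D a b then T a b f else undefined)\<rparr>"
  have G: "is_functor D C G"
  proof
    show "omap G \<in> extensional (obj D)" by (simp add: G_def)
    show "amap G a b f = undefined" if "\<not> (a \<in> obj D \<and> b \<in> obj D \<and> f \<in> hom D a b)" for a b f
      using that by (auto simp: G_def)
    show "omap G a \<in> obj C" if "a \<in> obj D" for a using that by (simp add: G_def K)
    show "amap G a b f \<in> hom C (omap G a) (omap G b)"
      if "a \<in> obj D" "b \<in> obj D" "f \<in> hom D a b" for a b f
      using that T by (simp add: G_def)
    show "amap G a a (idm D a) = idm C (omap G a)" if a: "a \<in> obj D" for a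
    proof -
      have "T a a (idm D a) = idm C (K a)"
        using a by (intro T_eq) (auto simp: C.idm_hom D.idm_hom K F.amap_idm FK
          D.cmp_idm[OF H _ e] D.idm_cmp[OF H _ e])
      then show ?thesis using a by (simp add: G_def D.idm_hom)
    qed
    show "amap G a c (cmp D a b c g f)
        = cmp C (omap G a) (omap G b) (omap G c) (amap G b c g) (amap G a b f)"
      if a: "a \<in> obj D" and b: "b \<in> obj D" and c: "c \<in> obj D" and f: "f \<in> hom D a b"
        and g: "g \<in> hom D b c" for a b c f g
    proof -
      note gf = D.cmp_hom[OF a b c f g]
      note Tf = T[OF a b f] and Tg = T[OF b c g]
      have "T a c (cmp D a b c g f) = cmp C (K a) (K b) (K c) (T b c g) (T a b f)"
      proof (rule T_eq[OF a c gf C.cmp_hom[OF K[OF a] K[OF b] K[OF c] Tf(1) Tg(1)]])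
        let ?Ff = "amap F (K a) (K b) (T a b f)" and ?Fg = "amap F (K b) (K c) (T b c g)"
        note Ff = FH[OF a b Tf(1)] and Fg = FH[OF b c Tg(1)]
        have "cmp D (H a) (H c) c (e c) (cmp D (H a) (H b) (H c) ?Fg ?Ff)
          = cmp D (H a) (H b) c (cmp D (H b) b c g (e b)) ?Ff"
          using D.cmp_assoc[OF H[OF a] H[OF b] H[OF c] c Ff Fg e[OF c]] by (simp add: Tg(2))
        also have "\<dots> = cmp D (H a) b c g (cmp D (H a) a b f (e a))"
          using D.cmp_assoc[OF H[OF a] H[OF b] b c Ff e[OF b] g] by (simp add: Tf(2))
        also have "\<dots> = cmp D (H a) a c (cmp D a b c g f) (e a)"
          using D.cmp_assoc[OF H[OF a] a b c e[OF a] f g] by simp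
        finally show "cmp D (H a) (H c) c (e c)
            (amap F (K a) (K c) (cmp C (K a) (K b) (K c) (T b c g) (T a b f)))
          = cmp D (H a) a c (cmp D a b c g f) (e a)"
          using F.amap_cmp[OF K[OF a] K[OF b] K[OF c] Tf(1) Tg(1)] by (simp add: H_def)
      qed
      then show ?thesis using a b c f g gf by (simp add: G_def)
    qed
  qed
  have FG: "naturally_isomorphic D D (comp_functor D F G) (id_functor D)"
    unfolding naturally_isomorphic_def
  proof (intro exI conjI ballI)
    show "nat_trans D D (comp_functor D F G) (id_functor D) (\<lambda>d \<in> obj D. e d)"
      using T e by unfold_locales (simp_all add: comp_functor_def id_functor_def G_def H_def)
    show "is_iso D (omap (comp_functor D F G) a) (omap (id_functor D) a) ((\<lambda>d \<in> obj D. e d) a)"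
      if "a \<in> obj D" for a
      using that e[OF that] e'[OF that] e'e[OF that] ee'[OF that] unfolding is_iso_def
      by (auto simp: comp_functor_def id_functor_def G_def FK)
  qed
  have ff_eq: "f = f'" if "a \<in> obj C" "b \<in> obj C" "f \<in> hom C a b" "f' \<in> hom C a b"
      "amap F a b f = amap F a b f'" for a b f f'
    using ff[OF that(1,2) F.amap_hom[OF that(1,2,3)]] that by metis
  \<comment> \<open>The other natural isomorphism is the preimage of \<open>e\<close> under
    \<open>F\<close>; its naturality and invertibility are reflected along the faithful
    functor.\<close>
  define q where "q = (\<lambda>c. SOME f. f \<in> hom C (K (omap F c)) c \<and>
      amap F (K (omap F c)) c f = e (omap F c))"
  have q: "q c \<in> hom C (K (omap F c)) c" "amap F (K (omap F c)) c (q c) = e (omap F c)"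
    if "c \<in> obj C" for c
    using someI_ex[OF ex1_implies_ex[OF ff[OF K[OF F.omap_obj[OF that]] that]], of "e (omap F c)"]
      e[OF F.omap_obj[OF that]]
    by (auto simp: q_def H_def)
  have GF: "naturally_isomorphic C C (comp_functor C G F) (id_functor C)"
    unfolding naturally_isomorphic_def
  proof (intro exI conjI ballI)
    show "nat_trans C C (comp_functor C G F) (id_functor C) (\<lambda>c \<in> obj C. q c)"
    proof
      fix a b f assume a: "a \<in> obj C" and b: "b \<in> obj C" and f: "f \<in> hom C a b"
      note Fa = F.omap_obj[OF a] and Fb = F.omap_obj[OF b] and Ff = F.amap_hom[OF a b f]
      note Tf = T[OF Fa Fb Ff]
      let ?Tf = "T (omap F a) (omap F b) (amap F a b f)"
      have "cmp C (K (omap F a)) (K (omap F b)) b (q b) ?Tf = cmp C (K (omap F a)) a b f (q a)"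
      proof (rule ff_eq[OF K[OF Fa] b])
        show "cmp C (K (omap F a)) (K (omap F b)) b (q b) ?Tf \<in> hom C (K (omap F a)) b"
          by (rule C.cmp_hom[OF K[OF Fa] K[OF Fb] b Tf(1) q(1)[OF b]])
        show "cmp C (K (omap F a)) a b f (q a) \<in> hom C (K (omap F a)) b"
          by (rule C.cmp_hom[OF K[OF Fa] a b q(1)[OF a] f])
        show "amap F (K (omap F a)) b (cmp C (K (omap F a)) (K (omap F b)) b (q b) ?Tf)
          = amap F (K (omap F a)) b (cmp C (K (omap F a)) a b f (q a))"
          using F.amap_cmp[OF K[OF Fa] K[OF Fb] b Tf(1) q(1)[OF b]]
            F.amap_cmp[OF K[OF Fa] a b q(1)[OF a] f] Tf(2)
          by (simp add: q(2) a b H_def)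
      qed
      then show "cmp C (omap (comp_functor C G F) a) (omap (comp_functor C G F) b)
          (omap (id_functor C) b) (restrict q (obj C) b) (amap (comp_functor C G F) a b f)
        = cmp C (omap (comp_functor C G F) a) (omap (id_functor C) a) (omap (id_functor C) b)
          (amap (id_functor C) a b f) (restrict q (obj C) a)"
        using a b f Fa Fb Ff by (simp add: comp_functor_def id_functor_def G_def)
    qed (simp_all add: comp_functor_def id_functor_def G_def F.omap_obj q(1))
  next
    fix c assume c: "c \<in> obj C"
    note Fc = F.omap_obj[OF c]
    let ?K = "K (omap F c)"
    obtain r where r: "r \<in> hom C c ?K" "amap F c ?K r = e' (omap F c)"
      using ff[OF c K[OF Fc]] e'[OF Fc] unfolding H_def by blast
    have "cmp C ?K c ?K r (q c) = idm C ?K"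
      using F.amap_cmp[OF K[OF Fc] c K[OF Fc] q(1)[OF c] r(1)] e'e[OF Fc]
      by (intro ff_eq[OF K[OF Fc] K[OF Fc] C.cmp_hom[OF K[OF Fc] c K[OF Fc] q(1)[OF c] r(1)]
            C.idm_hom[OF K[OF Fc]]]) (simp add: q(2)[OF c] r(2) F.amap_idm[OF K[OF Fc]] H_def)
    moreover have "cmp C c ?K c (q c) r = idm C c"
      using F.amap_cmp[OF c K[OF Fc] c r(1) q(1)[OF c]] ee'[OF Fc]
      by (intro ff_eq[OF c c C.cmp_hom[OF c K[OF Fc] c r(1) q(1)[OF c]] C.idm_hom[OF c]])
        (simp add: q(2)[OF c] r(2) F.amap_idm[OF c] H_def)
    ultimately show "is_iso C (omap (comp_functor C G F) c) (omap (id_functor C) c)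
        (restrict q (obj C) c)"
      using c q(1)[OF c] r(1) Fc unfolding is_iso_def
      by (auto simp: comp_functor_def id_functor_def G_def)
  qed
  show ?thesis unfolding equivalent_categories_def using assms(3) G GF FG by blast
qed

section \<open>Spheres and disks\<close>

primrec dim :: "gty \<Rightarrow> nat" where
  "dim Star = 0"
| "dim (Arr A t u) = Suc (dim A)"

text \<open>The context \<open>sphere n\<close> is the boundary of \<open>disk n\<close>, so it presents the sphere of dimension
  \<open>n - 1\<close>.\<close>

primrec globe_ty :: "nat \<Rightarrow> gty" where
  "globe_ty 0 = Star"
| "globe_ty (Suc n) = Arr (globe_ty n) (V (2 * n)) (V (Suc (2 * n)))"

primrec sphere :: "nat \<Rightarrow> gty list" where
  "sphere 0 = []"
| "sphere (Suc n) = sphere n @ [globe_ty n, globe_ty n]"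

definition disk :: "nat \<Rightarrow> gty list" where
  "disk n = sphere n @ [globe_ty n]"

text \<open>The iterated sources and targets of a type, lowest dimension first. Read as a
  substitution into \<open>sphere (dim A)\<close>, this list is the map classifying
  \<open>A\<close>.\<close>

primrec boundary :: "gty \<Rightarrow> gtm list" where
  "boundary Star = []"
| "boundary (Arr A t u) = boundary A @ [t, u]"

lemma dim_globe_ty [simp]: "dim (globe_ty n) = n"
  by (induction n) auto

lemma length_sphere [simp]: "length (sphere n) = 2 * n"
  by (induction n) auto

lemma length_disk [simp]: "length (disk n) = Suc (2 * n)"
  by (simp add: disk_def)

lemma length_boundary [simp]: "length (boundary A) = 2 * dim A"
  by (induction A) auto

lemma dim_sub_ty [simp]: "dim (sub_ty \<sigma> A) = dim A"
  by (induction A) auto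

lemma boundary_sub_ty: "boundary (sub_ty \<sigma> A) = map (sub_tm \<sigma>) (boundary A)"
  by (induction A) auto

lemma boundary_globe_ty: "boundary (globe_ty n) = map V [0..<2 * n]"
  by (induction n) auto

text \<open>\<open>globe_ty (dim A)\<close> mentions only the first \<open>2 * dim A\<close>
  variables, so trailing terms are harmless. They have to be allowed for the induction, because the
  boundary of \<open>Arr A t u\<close> extends that of \<open>A\<close> by two terms.\<close>

lemma sub_ty_boundary: "sub_ty (boundary A @ ts) (globe_ty (dim A)) = A"
proof (induction A arbitrary: ts)
  case (Arr A t u)
  show ?case using Arr[of "[t, u] @ ts"] by (simp add: nth_append)
qed simp

lemma sub_ty_boundary_globe_ty [simp]: "sub_ty (boundary A) (globe_ty (dim A)) = A"
  using sub_ty_boundary[of A "[]"] by simp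

lemma wf_sphere: "wf_ctx (sphere n) \<and> wf_ty (sphere n) (globe_ty n)"
proof (induction n)
  case 0 then show ?case by (simp add: ctx_empty wf_ty_Star)
next
  case (Suc n)
  let ?D = "sphere n @ [globe_ty n]"
  have D: "wf_ctx ?D" using Suc by (simp add: wf_ctx_snoc)
  then have D': "wf_ty ?D (globe_ty n)" using Suc by (intro wf_ty_weaken) auto
  with D have S: "wf_ctx (?D @ [globe_ty n])" by (simp only: wf_ctx_snoc)
  then have S': "wf_ty (?D @ [globe_ty n]) (globe_ty n)" using D' by (rule wf_ty_weaken)
  show ?case using S S' by (auto simp: wf_ty_Arr wf_tm_iff nth_append)
qed

lemma wf_disk: "wf_ctx (disk n)"
  using wf_sphere[of n] by (simp add: disk_def wf_ctx_snoc)

lemma sphere_nth: "i < 2 * n \<Longrightarrow> sphere n ! i = globe_ty (i div 2)"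
proof (induction n)
  case (Suc n)
  then show ?case by (cases "i < 2 * n"; cases "i = 2 * n"; cases "i = Suc (2 * n)") (auto simp: nth_append)
qed simp

lemma disk_nth: "i \<le> 2 * n \<Longrightarrow> disk n ! i = globe_ty (i div 2)"
  by (auto simp: disk_def nth_append sphere_nth)

lemma wf_sub_boundary: "wf_ty \<Gamma> A \<Longrightarrow> wf_sub \<Gamma> (boundary A) (sphere (dim A))"
proof (induction A)
  case Star then show ?case by (simp add: sub_empty wf_ty_Star)
next
  case (Arr A t u)
  then have A: "wf_ty \<Gamma> A" and t: "wf_tm \<Gamma> t A" and u: "wf_tm \<Gamma> u A" by (simp_all add: wf_ty_Arr)
  have "wf_sub \<Gamma> (boundary A @ [t]) (sphere (dim A) @ [globe_ty (dim A)])"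
    using Arr.IH[OF A] t by (intro sub_ext) (simp_all add: wf_sphere)
  moreover have "wf_ty (sphere (dim A) @ [globe_ty (dim A)]) (globe_ty (dim A))"
    using wf_sphere[of "dim A"] by (intro wf_ty_weaken) (simp_all add: wf_ctx_snoc)
  ultimately have "wf_sub \<Gamma> ((boundary A @ [t]) @ [u])
      ((sphere (dim A) @ [globe_ty (dim A)]) @ [globe_ty (dim A)])"
    by (rule sub_ext) (simp add: sub_ty_boundary u)
  then show ?case by simp
qed

section \<open>Terms as substitutions into disks, and the action of globes on disks\<close>

lemma wf_tm_ty: "wf_tm \<Gamma> t A \<Longrightarrow> wf_ty \<Gamma> A"
  by (auto simp: wf_tm_iff wf_ty_nth)

text \<open>The substitution into \<open>disk (dim A)\<close> that classifies a term together with
  its boundary. Through it a model evaluates terms by its action on substitutions alone.\<close>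

definition point :: "gty \<Rightarrow> gtm \<Rightarrow> gtm list" where
  "point A t = boundary A @ [t]"

lemma wf_sub_point: "wf_tm \<Gamma> t A \<Longrightarrow> wf_sub \<Gamma> (point A t) (disk (dim A))"
  unfolding point_def disk_def
  by (intro sub_ext wf_sub_boundary) (simp_all add: wf_tm_ty wf_sphere)

lemma map_sub_tm_point: "map (sub_tm \<sigma>) (point A t) = point (sub_ty \<sigma> A) (sub_tm \<sigma> t)"
  by (simp add: point_def boundary_sub_ty)

lemma point_disk: "point (globe_ty n) (V (2 * n)) = map V [0..<length (disk n)]"
  by (simp add: point_def boundary_globe_ty)

text \<open>By the globular relations the class of a nonempty word is determined by its length and its
  first letter.\<close>

definition globe_sub :: "nat \<Rightarrow> globe_gen list set \<Rightarrow> gtm list" where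
  "globe_sub n f = point (globe_ty n) (V (2 * n + (if \<exists>w. Tgt # w \<in> f then 1 else 0)))"

text \<open>Both generating relations keep the first letter, and the closure rules preserve this.
  Hence the test \<open>Tgt # w \<in> f\<close> in \<open>globe_sub\<close> reads off an invariant
  of the class.\<close>

lemma globe_eq_hd: "globe_eq v w \<Longrightarrow> v = [] \<and> w = [] \<or> v \<noteq> [] \<and> w \<noteq> [] \<and> hd v = hd w"
  by (induction rule: globe_eq.induct) (auto simp: hd_append)

definition letter :: "globe_gen \<Rightarrow> nat" where
  "letter g = (case g of Src \<Rightarrow> 0 | Tgt \<Rightarrow> 1)"

lemma letter_simps [simp]: "letter Src = 0" "letter Tgt = 1"
  by (simp_all add: letter_def)

lemma letter_le: "letter g \<le> 1"
  by (cases g) simp_all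

lemma globe_sub_Nil: "globe_sub n (globe_class []) = map V [0..<length (disk n)]"
  using globe_eq_hd[of "[]"] by (force simp: globe_sub_def globe_class_def point_disk)

lemma globe_sub_Cons: "globe_sub n (globe_class (g # w)) = point (globe_ty n) (V (2 * n + letter g))"
  using globe_eq_hd[of "g # w"]
  by (cases g) (force simp: globe_sub_def globe_class_def intro: globe_refl)+

text \<open>The direction is reversed: a morphism of globes from \<open>n\<close> to
  \<open>m\<close> extracts an \<open>n\<close>-cell from an \<open>m\<close>-cell, hence maps
  \<open>disk m\<close> to \<open>disk n\<close>.\<close>

lemma wf_sub_globe_sub:
  assumes "n + length w = m"
  shows "wf_sub (disk m) (globe_sub n (globe_class w)) (disk n)"
proof (cases w)
  case Nil
  then have "wf_tm (disk m) (V (2 * n)) (globe_ty n)"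
    using assms by (auto simp: wf_tm_iff wf_disk disk_nth)
  then show ?thesis
    using wf_sub_point[of "disk m" "V (2 * n)" "globe_ty n"] Nil by (simp add: globe_sub_Nil point_disk)
next
  case (Cons g v)
  have "wf_tm (disk m) (V (2 * n + letter g)) (globe_ty n)"
    using assms Cons letter_le[of g] by (cases g) (auto simp: wf_tm_iff wf_disk disk_nth)
  then show ?thesis
    using wf_sub_point[of "disk m" _ "globe_ty n"] by (simp add: Cons globe_sub_Cons)
qed

lemma map_sub_tm_vars: "map (sub_tm \<sigma>) (map V [0..<length \<sigma>]) = \<sigma>"
  by (auto intro: nth_equalityI)

lemma globe_sub_append:
  "globe_sub n (globe_class (v @ w))
    = map (sub_tm (globe_sub (n + length v) (globe_class w))) (globe_sub n (globe_class v))"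
proof (cases v)
  case Nil
  have "length (globe_sub n (globe_class w)) = length (disk n)" by (simp add: globe_sub_def point_def)
  then show ?thesis using map_sub_tm_vars[of "globe_sub n (globe_class w)"]
    by (simp add: Nil globe_sub_Nil del: length_disk)
next
  case (Cons g v')
  define m where "m = n + length v"
  have m: "n < m" using Cons by (simp add: m_def)
  \<comment> \<open>\<open>globe_sub m\<close> alters at most the top variable. After a nonempty
    \<open>v\<close> only variables below the top of \<open>disk m\<close> occur, so the composite
    depends on the first letter alone, in agreement with the globular relations.\<close>
  have fix_var: "sub_tm (globe_sub m (globe_class w)) (V i) = V i" if "i < 2 * m" for i
    using that by (simp add: globe_sub_def point_def boundary_globe_ty nth_append)
  have "sub_ty (globe_sub m (globe_class w)) (globe_ty n) = globe_ty n" if "n < m" for n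
    using that by (induction n) (simp_all del: sub_tm.simps add: fix_var)
  moreover have "2 * n + letter g < 2 * m" using m letter_le[of g] by linarith
  ultimately have "map (sub_tm (globe_sub m (globe_class w))) (globe_sub n (globe_class (g # v')))
      = point (globe_ty n) (V (2 * n + letter g))"
    using m fix_var by (simp only: globe_sub_Cons map_sub_tm_point)
  then show ?thesis by (simp add: globe_sub_Cons m_def Cons)
qed

text \<open>This ties the two notions of endpoint together: composing a classifying substitution
  with a generating face extracts the syntactic source or target.\<close>

lemma face_point:
  "map (sub_tm (point (Arr A t u) x)) (globe_sub (dim A) (globe_class [g]))
    = point A (case g of Src \<Rightarrow> t | Tgt \<Rightarrow> u)"
proof -
  have "sub_ty (boundary (Arr A t u) @ [x]) (globe_ty (dim A)) = A"
    using sub_ty_boundary[of A "[t, u, x]"] by simp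
  then show ?thesis
    by (cases g) (simp_all add: globe_sub_Cons map_sub_tm_point, simp_all add: point_def nth_append)
qed

section \<open>Environments in a globular set\<close>

definition face :: "(nat, globe_gen list set, 'u set, 'u \<Rightarrow> 'u) functr \<Rightarrow> globe_gen \<Rightarrow> nat \<Rightarrow> 'u \<Rightarrow> 'u"
  where "face X g n = amap X (Suc n) n (globe_class [g])"

primrec tm_val :: "'u list \<Rightarrow> gtm \<Rightarrow> 'u" where
  "tm_val xs (V i) = xs ! i"

text \<open>Only the immediate faces are constrained. In an environment the values of
  \<open>t\<close> and \<open>u\<close> are themselves required to have type \<open>A\<close>, which
  takes care of all lower faces.\<close>

primrec has_ty :: "(nat, globe_gen list set, 'u set, 'u \<Rightarrow> 'u) functr \<Rightarrow> 'u list \<Rightarrow> gty \<Rightarrow> 'u \<Rightarrow> bool"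
  where
  "has_ty X xs Star x \<longleftrightarrow> x \<in> omap X 0"
| "has_ty X xs (Arr A t u) x \<longleftrightarrow> x \<in> omap X (Suc (dim A)) \<and>
     face X Src (dim A) x = tm_val xs t \<and> face X Tgt (dim A) x = tm_val xs u"

text \<open>An environment for \<open>\<Gamma>\<close> in \<open>X\<close> is a map to \<open>X\<close> from the finite globular set presented by \<open>\<Gamma>\<close>.\<close>

definition env :: "(nat, globe_gen list set, 'u set, 'u \<Rightarrow> 'u) functr \<Rightarrow> gty list \<Rightarrow> 'u list set" where
  "env X \<Gamma> = {xs. length xs = length \<Gamma> \<and> (\<forall>i < length \<Gamma>. has_ty X xs (\<Gamma> ! i) (xs ! i))}"

lemma has_ty_omap: "has_ty X xs A x \<Longrightarrow> x \<in> omap X (dim A)"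
  by (cases A) auto

lemma has_ty_cong:
  "wf_ty \<Gamma> A \<Longrightarrow> (\<And>i. i < length \<Gamma> \<Longrightarrow> xs ! i = ys ! i) \<Longrightarrow> has_ty X xs A x \<longleftrightarrow> has_ty X ys A x"
  by (cases A) (auto simp: wf_ty_Arr wf_tm_iff)

lemma has_ty_append:
  "wf_ty \<Gamma> A \<Longrightarrow> length xs = length \<Gamma> \<Longrightarrow> has_ty X (xs @ ys) A x \<longleftrightarrow> has_ty X xs A x"
  by (rule has_ty_cong) (auto simp: nth_append)

lemma has_ty_sub:
  "wf_ty \<Gamma> A \<Longrightarrow> length \<sigma> = length \<Gamma>
    \<Longrightarrow> has_ty X (map (tm_val xs) \<sigma>) A x \<longleftrightarrow> has_ty X xs (sub_ty \<sigma> A) x"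
  by (cases A) (auto simp: wf_ty_Arr wf_tm_iff)

lemma env_Nil [simp]: "env X [] = {[]}"
  by (auto simp: env_def)

lemma env_snoc:
  assumes "wf_ctx (\<Gamma> @ [A])"
  shows "xs @ [x] \<in> env X (\<Gamma> @ [A]) \<longleftrightarrow> xs \<in> env X \<Gamma> \<and> has_ty X xs A x"
proof (cases "length xs = length \<Gamma>")
  case True
  have "has_ty X (xs @ [x]) (\<Gamma> ! i) (xs ! i) \<longleftrightarrow> has_ty X xs (\<Gamma> ! i) (xs ! i)"
    if "i < length \<Gamma>" for i
    using assms that True by (intro has_ty_append[of \<Gamma>] wf_ty_nth) (auto simp: wf_ctx_snoc)
  moreover have "has_ty X (xs @ [x]) A x \<longleftrightarrow> has_ty X xs A x"
    using assms True by (intro has_ty_append[of \<Gamma>]) (auto simp: wf_ctx_snoc)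
  ultimately show ?thesis using True by (auto simp: env_def nth_append less_Suc_eq)
qed (auto simp: env_def)

lemma env_snocE:
  assumes "wf_ctx (\<Gamma> @ [A])" and "ys \<in> env X (\<Gamma> @ [A])"
  obtains xs x where "ys = xs @ [x]" and "xs \<in> env X \<Gamma>" and "has_ty X xs A x"
proof -
  have "ys \<noteq> []" using assms(2) by (auto simp: env_def)
  then have "ys = butlast ys @ [last ys]" by simp
  then show thesis using that assms(2) env_snoc[OF assms(1)] by metis
qed

lemma env_sub:
  assumes "wf_sub \<Delta> \<sigma> \<Gamma>" and "xs \<in> env X \<Delta>"
  shows "map (tm_val xs) \<sigma> \<in> env X \<Gamma>"
proof -
  have len: "length \<sigma> = length \<Gamma>" using assms by (simp add: wf_sub_iff)
  have "has_ty X (map (tm_val xs) \<sigma>) (\<Gamma> ! i) (tm_val xs (\<sigma> ! i))" if "i < length \<Gamma>" for i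
  proof -
    have "wf_tm \<Delta> (\<sigma> ! i) (sub_ty \<sigma> (\<Gamma> ! i))" "wf_ty \<Gamma> (\<Gamma> ! i)"
      using assms that by (auto simp: wf_sub_iff wf_ty_nth)
    then show ?thesis using assms len by (auto simp: has_ty_sub wf_tm_iff env_def)
  qed
  then show ?thesis using len by (simp add: env_def)
qed

lemma tm_val_map: "wf_sub \<Delta> \<sigma> \<Gamma> \<Longrightarrow> wf_tm \<Gamma> t A \<Longrightarrow> tm_val (map (tm_val xs) \<sigma>) t = tm_val xs (sub_tm \<sigma> t)"
  by (auto simp: wf_tm_iff wf_sub_iff)

lemma map_tm_val_vars: "n \<le> length xs \<Longrightarrow> map (tm_val xs) (map V [0..<n]) = take n xs"
  by (rule nth_equalityI) auto

section \<open>Environments of disks are cells\<close>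

locale gset = is_functor "op_cat globe_cat" set_cat X
  for X :: "(nat, globe_gen list set, 'u set, 'u \<Rightarrow> 'u) functr"
begin

lemma amap_globe: "n + length w = m \<Longrightarrow> amap X m n (globe_class w) \<in> omap X m \<rightarrow>\<^sub>E omap X n"
  using amap_hom[of m n "globe_class w"] by (auto simp: op_cat_def globe_cat_simps set_cat_def)

lemma face_in: "x \<in> omap X (Suc n) \<Longrightarrow> face X g n x \<in> omap X n"
  using amap_globe[of n "[g]" "Suc n"] by (auto simp: face_def)

lemma amap_Nil: "x \<in> omap X n \<Longrightarrow> amap X n n (globe_class []) x = x"
  using amap_idm[of n] by (simp add: op_cat_def globe_cat_simps set_cat_def)

lemma amap_append:
  assumes "n + length v = k" "k + length w = m" "x \<in> omap X m"
  shows "amap X m n (globe_class (v @ w)) x = amap X k n (globe_class v) (amap X m k (globe_class w) x)"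
proof -
  have "globe_class w \<in> hom globe_cat k m" "globe_class v \<in> hom globe_cat n k"
    using assms by (auto simp: globe_cat_simps)
  then show ?thesis
    using amap_cmp[of m k n "globe_class w" "globe_class v"] assms(3)
    by (simp add: op_cat_def globe_cat_simps(1) globe_cmp set_cat_def compose_def)
qed

lemma face_face:
  assumes "x \<in> omap X (Suc (Suc n))"
  shows "face X g n (face X Src (Suc n) x) = face X g n (face X Tgt (Suc n) x)"
proof -
  have "face X g n (face X h (Suc n) x) = amap X (Suc (Suc n)) n (globe_class [g, h]) x" for h
    using amap_append[of n "[g]" "Suc n" "[h]" "Suc (Suc n)" x] assms by (simp add: face_def)
  moreover have "globe_class [g, Src] = globe_class [g, Tgt]"
    unfolding globe_class_eq by (cases g) (auto intro: src_rel tgt_rel)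
  ultimately show ?thesis by simp
qed

text \<open>All other entries are forced to be iterated faces of the top cell. That these do form an
  environment is where the globular identities enter.\<close>

lemma env_disk:
  assumes "x \<in> omap X n"
  shows "\<exists>!xs. xs @ [x] \<in> env X (disk n)"
  using assms
proof (induction n arbitrary: x)
  case 0 then show ?case by (auto simp: disk_def env_def)
next
  case (Suc n)
  let ?U = "globe_ty n" and ?S = "sphere n" and ?s = "face X Src n x" and ?t = "face X Tgt n x"
  note wf = wf_sphere[of n] wf_disk[of n, unfolded disk_def] wf_sphere[of "Suc n"]
    wf_disk[of "Suc n", unfolded disk_def]
  have U: "has_ty X (xs @ [y]) ?U z \<longleftrightarrow> has_ty X xs ?U z" if "xs \<in> env X ?S" for xs y z
    using that wf(1) by (intro has_ty_append[of ?S]) (auto simp: env_def)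
  \<comment> \<open>By \<open>face_face\<close> the two faces of \<open>x\<close> are parallel, so a
    boundary that fits one of them fits the other, and the induction hypothesis is needed only for
    the source.\<close>
  have st: "has_ty X xs ?U ?s \<longleftrightarrow> has_ty X xs ?U ?t" for xs
    using face_in[OF Suc.prems] Suc.prems face_face by (cases n) auto
  have iff: "(xs @ [a, b]) @ [x] \<in> env X (disk (Suc n))
      \<longleftrightarrow> xs @ [a] \<in> env X (disk n) \<and> a = ?s \<and> b = ?t" for xs a b
  proof -
    have "(xs @ [a, b]) @ [x] \<in> env X (disk (Suc n)) \<longleftrightarrow>
        xs @ [a, b] \<in> env X (sphere (Suc n)) \<and> has_ty X (xs @ [a, b]) (globe_ty (Suc n)) x"
      unfolding disk_def by (rule env_snoc) (rule wf)
    also have "xs @ [a, b] \<in> env X (sphere (Suc n)) \<longleftrightarrow>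
        xs @ [a] \<in> env X (?S @ [?U]) \<and> has_ty X (xs @ [a]) ?U b"
      using env_snoc[of "?S @ [?U]" ?U "xs @ [a]" b X] wf(3) by simp
    also have "xs @ [a] \<in> env X (?S @ [?U]) \<longleftrightarrow> xs \<in> env X ?S \<and> has_ty X xs ?U a"
      by (rule env_snoc) (rule wf)
    finally show ?thesis
      using env_snoc[OF wf(2), of xs a X] U[of xs] st[of xs] Suc.prems
      by (auto simp: disk_def env_def nth_append)
  qed
  obtain xs where xs: "xs @ [?s] \<in> env X (disk n)" "\<And>ys. ys @ [?s] \<in> env X (disk n) \<Longrightarrow> ys = xs"
    using Suc.IH[OF face_in[OF Suc.prems], of Src] by blast
  show ?case
  proof (rule ex1I[of _ "xs @ [?s, ?t]"])
    show "(xs @ [?s, ?t]) @ [x] \<in> env X (disk (Suc n))" using xs(1) unfolding iff by simp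
    fix ys assume ys: "ys @ [x] \<in> env X (disk (Suc n))"
    then have "length ys = Suc (Suc (2 * n))" by (simp add: env_def)
    then obtain zs a b where "ys = zs @ [a, b]"
      by (cases ys rule: rev_cases; cases "butlast ys" rule: rev_cases) auto
    then show "ys = xs @ [?s, ?t]" using ys xs(2)[of zs] iff[of zs a b] by auto
  qed
qed

text \<open>A form of the Yoneda lemma: \<open>disk n\<close> presents the representable globular
  set of the \<open>n\<close>-globe, and evaluation at its top variable is the universal
  element.\<close>

lemma env_disk_bij: "bij_betw last (env X (disk n)) (omap X n)"
proof (rule bij_betw_imageI)
  have snoc: "xs = butlast xs @ [last xs] \<and> last xs \<in> omap X n" if "xs \<in> env X (disk n)" for xs
  proof -
    obtain ys y where "xs = ys @ [y]" "has_ty X ys (globe_ty n) y"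
      using env_snocE[OF wf_disk[unfolded disk_def]] \<open>xs \<in> env X (disk n)\<close> unfolding disk_def by blast
    then show ?thesis using has_ty_omap[of X ys "globe_ty n" y] by simp
  qed
  show "inj_on last (env X (disk n))"
  proof (rule inj_onI)
    fix xs ys assume xs: "xs \<in> env X (disk n)" and ys: "ys \<in> env X (disk n)" and eq: "last xs = last ys"
    then have "butlast xs = butlast ys"
      using snoc[OF xs] snoc[OF ys] env_disk[of "last xs" n] by metis
    then show "xs = ys" using snoc[OF xs] snoc[OF ys] eq by metis
  qed
  show "last ` env X (disk n) = omap X n"
  proof
    show "last ` env X (disk n) \<subseteq> omap X n" using snoc by blast
    show "omap X n \<subseteq> last ` env X (disk n)"
    proof
      fix x assume "x \<in> omap X n"
      then obtain xs where "xs @ [x] \<in> env X (disk n)" using env_disk by blast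
      then show "x \<in> last ` env X (disk n)" by force
    qed
  qed
qed

text \<open>Naturality of the bijection \<open>env_disk_bij\<close> in the dimension. The word is
  peeled from the left, so the last face applied is the one of lowest dimension.\<close>

lemma env_disk_face:
  assumes "xs \<in> env X (disk m)" and "n + length w = m"
  shows "last (map (tm_val xs) (globe_sub n (globe_class w))) = amap X m n (globe_class w) (last xs)"
  using assms(2)
proof (induction w arbitrary: n)
  have len: "length xs = Suc (2 * m)" using assms(1) by (simp add: env_def)
  then have last: "last xs = xs ! (2 * m)" by (subst last_conv_nth) auto
  have nth: "has_ty X xs (globe_ty (i div 2)) (xs ! i)" if "i \<le> 2 * m" for i
    using assms(1) disk_nth[OF that] that by (auto simp: env_def dest!: spec[of _ i])
  {
    case Nil
    then show ?case using len last nth[of "2 * m"] has_ty_omap[OF nth[of "2 * m"]]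
      by (simp add: globe_sub_Nil amap_Nil)
  next
    case (Cons g w)
    \<comment> \<open>The position at which \<open>xs\<close> stores the face of its top cell along
      \<open>w\<close>: for \<open>w = []\<close> the top position itself, otherwise the source or
      target in dimension \<open>Suc n\<close> according to the first letter.\<close>
    define j where "j = 2 * Suc n + (case w of [] \<Rightarrow> 0 | h # v \<Rightarrow> letter h)"
    have j: "j \<le> 2 * m" "j div 2 = Suc n"
      using Cons.prems by (auto simp: j_def letter_def split: list.split globe_gen.split)
    have wj: "amap X m (Suc n) (globe_class w) (last xs) = xs ! j"
      using Cons.IH[of "Suc n"] Cons.prems
      by (cases w) (simp_all add: globe_sub_Nil globe_sub_Cons point_def j_def)
    have "last xs \<in> omap X m" using has_ty_omap[OF nth[of "2 * m"]] by (simp add: last)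
    then have "amap X m n (globe_class (g # w)) (last xs) = face X g n (xs ! j)"
      using amap_append[of n "[g]" "Suc n" w m "last xs"] Cons.prems by (simp add: face_def wj)
    also have "\<dots> = xs ! (2 * n + letter g)"
      using nth[OF j(1)] j(2) by (cases g) auto
    finally show ?case by (simp add: globe_sub_Cons point_def)
  }
qed

end

text \<open>Compatibility with the generating faces is enough, since \<open>has_ty\<close> refers to
  no composite ones.\<close>

lemma env_map:
  assumes "wf_ctx \<Gamma>" and "xs \<in> env X \<Gamma>"
    and \<psi>: "\<And>n x. x \<in> omap X n \<Longrightarrow> \<psi> n x \<in> omap Y n"
    and face: "\<And>g n x. x \<in> omap X (Suc n) \<Longrightarrow> face Y g n (\<psi> (Suc n) x) = \<psi> n (face X g n x)"
  shows "map (\<lambda>i. \<psi> (dim (\<Gamma> ! i)) (xs ! i)) [0..<length \<Gamma>] \<in> env Y \<Gamma>"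
proof -
  let ?ys = "map (\<lambda>i. \<psi> (dim (\<Gamma> ! i)) (xs ! i)) [0..<length \<Gamma>]"
  have "has_ty Y ?ys (\<Gamma> ! i) (\<psi> (dim (\<Gamma> ! i)) (xs ! i))" if i: "i < length \<Gamma>" for i
  proof -
    have "has_ty X xs (\<Gamma> ! i) (xs ! i)" using assms(2) i by (simp add: env_def)
    then show ?thesis
      using wf_ty_nth[OF assms(1) i] \<psi> face by (cases "\<Gamma> ! i") (auto simp: wf_ty_Arr wf_tm_iff)
  qed
  then show ?thesis by (simp add: env_def)
qed

section \<open>Chosen pullbacks\<close>

context split_pullbacks
begin

lemma pull_eqI:
  assumes "g \<in> X' \<rightarrow>\<^sub>E X" "A \<in> set_ty X" "y \<in> fst (pull P X' X g A)" "y' \<in> fst (pull P X' X g A)"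
    "snd (pull P X' X g A) y = snd (pull P X' X g A) y'" "lift P X' X g A y = lift P X' X g A y'"
  shows "y = y'"
  using bij_betw_imp_inj_on[OF pullback[OF assms(1,2)]] assms(3-) by (auto dest: inj_onD)

lemma pull_ex:
  assumes "g \<in> X' \<rightarrow>\<^sub>E X" "A \<in> set_ty X" "x \<in> X'" "z \<in> fst A" "g x = snd A z"
  shows "\<exists>y \<in> fst (pull P X' X g A). snd (pull P X' X g A) y = x \<and> lift P X' X g A y = z"
proof -
  have "(x, z) \<in> (\<lambda>y. (snd (pull P X' X g A) y, lift P X' X g A y)) ` fst (pull P X' X g A)"
    using bij_betw_imp_surj_on[OF pullback[OF assms(1,2)]] assms(3-) by auto
  then show ?thesis by auto
qed

lemma pull_square:
  assumes "g \<in> X' \<rightarrow>\<^sub>E X" "A \<in> set_ty X" "y \<in> fst (pull P X' X g A)"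
  shows "snd (pull P X' X g A) y \<in> X'" "lift P X' X g A y \<in> fst A"
    "snd A (lift P X' X g A y) = g (snd (pull P X' X g A) y)"
  using bij_betwE[OF pullback[OF assms(1,2)]] assms(3) by auto

lemma set_ty_snd: "A \<in> set_ty X \<Longrightarrow> snd A \<in> fst A \<rightarrow>\<^sub>E X" for A :: "'u set \<times> ('u \<Rightarrow> 'u)"
  by (auto simp: set_ty_def)

text \<open>The universal property of the pullback, applied to the identity of \<open>X'\<close> and
  a map \<open>r\<close> over \<open>g\<close>. It justifies the definite descriptions in
  \<open>set_tmsub\<close> and \<open>var\<close>, which from here on are known through their
  composites with \<open>lift\<close>.\<close>

lemma section_ex1:
  assumes g: "g \<in> X' \<rightarrow>\<^sub>E X" and A: "A \<in> set_ty X" and r: "\<And>x. x \<in> X' \<Longrightarrow> r x \<in> fst A"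
    "\<And>x. x \<in> X' \<Longrightarrow> g x = snd A (r x)"
  shows "\<exists>!s. s \<in> set_tm X' (pull P X' X g A) \<and> (\<forall>x \<in> X'. lift P X' X g A (s x) = r x)"
proof -
  obtain s where s: "\<And>x. x \<in> X' \<Longrightarrow> s x \<in> fst (pull P X' X g A) \<and>
      snd (pull P X' X g A) (s x) = x \<and> lift P X' X g A (s x) = r x"
    using pull_ex[OF g A _ r] by metis
  show ?thesis
  proof (rule ex1I[of _ "restrict s X'"])
    show "restrict s X' \<in> set_tm X' (pull P X' X g A) \<and>
        (\<forall>x \<in> X'. lift P X' X g A (restrict s X' x) = r x)"
      using s by (auto simp: set_tm_def)
  next
    fix s' assume s': "s' \<in> set_tm X' (pull P X' X g A) \<and> (\<forall>x \<in> X'. lift P X' X g A (s' x) = r x)"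
    then have "s' \<in> X' \<rightarrow>\<^sub>E fst (pull P X' X g A)" by (auto simp: set_tm_def)
    moreover have "restrict s X' \<in> X' \<rightarrow>\<^sub>E fst (pull P X' X g A)" using s by auto
    moreover have "s' x = restrict s X' x" if "x \<in> X'" for x
      using s[OF that] s' that by - (rule pull_eqI[OF g A], auto simp: set_tm_def)
    ultimately show "s' = restrict s X'" by (rule PiE_ext)
  qed
qed

lemma set_tmsub_ex1:
  assumes "g \<in> X' \<rightarrow>\<^sub>E X" "A \<in> set_ty X" "s \<in> set_tm X A"
  shows "\<exists>!s'. s' \<in> set_tm X' (pull P X' X g A) \<and> (\<forall>x \<in> X'. lift P X' X g A (s' x) = s (g x))"
proof (rule section_ex1[OF assms(1,2), where r = "\<lambda>x. s (g x)"])
  fix x assume "x \<in> X'"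
  then have "g x \<in> X" using assms(1) by auto
  then show "s (g x) \<in> fst A" "g x = snd A (s (g x))" using assms(3) by (auto simp: set_tm_def)
qed

lemma lift_set_tmsub:
  assumes "g \<in> X' \<rightarrow>\<^sub>E X" "A \<in> set_ty X" "s \<in> set_tm X A" "x \<in> X'"
  shows "lift P X' X g A (set_tmsub P X' X g A s x) = s (g x)"
  using theI'[OF set_tmsub_ex1[OF assms(1-3)]] assms(4) unfolding set_tmsub_def by blast

lemma set_tmsub_eqI:
  assumes "g \<in> X' \<rightarrow>\<^sub>E X" "A \<in> set_ty X" "s \<in> set_tm X A" "s' \<in> set_tm X' (pull P X' X g A)"
    "\<And>x. x \<in> X' \<Longrightarrow> lift P X' X g A (s' x) = s (g x)"
  shows "set_tmsub P X' X g A s = s'"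
  unfolding set_tmsub_def by (rule the1_equality[OF set_tmsub_ex1[OF assms(1-3)]]) (use assms in blast)

lemma set_var_ex1:
  assumes "A \<in> set_ty X"
  shows "\<exists>!s. s \<in> set_tm (fst A) (pull P (fst A) X (snd A) A) \<and>
    (\<forall>y \<in> fst A. lift P (fst A) X (snd A) A (s y) = y)"
  by (rule section_ex1[OF set_ty_snd[OF assms] assms]) simp_all

lemma set_var:
  assumes "A \<in> set_ty X"
  shows "var (set_cwf P) X A \<in> set_tm (fst A) (pull P (fst A) X (snd A) A)"
    "y \<in> fst A \<Longrightarrow> lift P (fst A) X (snd A) A (var (set_cwf P) X A y) = y"
  using theI'[OF set_var_ex1[OF assms]] by (auto simp: set_cwf_simps)

lemma set_var_eqI:
  assumes "A \<in> set_ty X" "s \<in> set_tm (fst A) (pull P (fst A) X (snd A) A)"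
    "\<And>y. y \<in> fst A \<Longrightarrow> lift P (fst A) X (snd A) A (s y) = y"
  shows "s = var (set_cwf P) X A"
  unfolding set_cwf_simps by (rule the1_equality[OF set_var_ex1[OF assms(1)], symmetric]) (use assms in blast)

text \<open>The chosen pullback of two copies of \<open>'u\<close> over a point is a product inside \<open>'u\<close>.\<close>

lemma pairing_exists: "\<exists>pr :: 'u \<times> 'u \<Rightarrow> 'u. inj pr"
proof -
  let ?g = "\<lambda>_ :: 'u. undefined :: 'u"
  let ?A = "(UNIV, ?g)"
  let ?f = "\<lambda>y. (snd (pull P UNIV {undefined} ?g ?A) y, lift P UNIV {undefined} ?g ?A y)"
  let ?Y = "fst (pull P UNIV {undefined} ?g ?A)"
  have "?g \<in> UNIV \<rightarrow>\<^sub>E {undefined}" "?A \<in> set_ty {undefined}" by (auto simp: set_ty_def)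
  then have "bij_betw ?f ?Y UNIV" using pullback[of ?g UNIV "{undefined}" ?A] by simp
  then have "inj (inv_into ?Y ?f)" by (rule bij_betw_imp_inj_on[OF bij_betw_inv_into])
  then show ?thesis by blast
qed

text \<open>A morphism into sets sends the chosen pullback squares of \<open>C\<close> to those of \<open>P\<close>.\<close>

lemma amap_lift:
  fixes C :: "('o, 'a, 't, 'e, 'z) cwf_scheme"
    and M :: "('o, 'a, 't, 'e, 'u set, 'u \<Rightarrow> 'u, 'u set \<times> ('u \<Rightarrow> 'u), 'u \<Rightarrow> 'u, 'x) cwf_mor_scheme"
  assumes "is_cwf C" and "is_cwf_mor C (set_cwf P) M"
    and \<Delta>: "\<Delta> \<in> obj C" and \<Gamma>: "\<Gamma> \<in> obj C" and \<sigma>: "\<sigma> \<in> hom C \<Delta> \<Gamma>" and A: "A \<in> ty C \<Gamma>"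
    and B: "tysub C \<Delta> \<Gamma> \<sigma> A = B" and \<rho>: "\<rho> \<in> hom C (ext C \<Delta> B) (ext C \<Gamma> A)"
    and wk: "cmp C (ext C \<Delta> B) (ext C \<Gamma> A) \<Gamma> (wk C \<Gamma> A) \<rho> = cmp C (ext C \<Delta> B) \<Delta> \<Gamma> \<sigma> (wk C \<Delta> B)"
    and var: "tmsub C (ext C \<Delta> B) (ext C \<Gamma> A) \<rho> (tysub C (ext C \<Gamma> A) \<Gamma> (wk C \<Gamma> A) A) (var C \<Gamma> A)
      = var C \<Delta> B"
    and x: "x \<in> omap M (ext C \<Delta> B)"
  shows "amap M (ext C \<Delta> B) (ext C \<Gamma> A) \<rho> x
    = lift P (omap M \<Delta>) (omap M \<Gamma>) (amap M \<Delta> \<Gamma> \<sigma>) (tymap M \<Gamma> A) x"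
proof -
  interpret C: is_cwf C by fact
  interpret M: is_cwf_mor C "set_cwf P" M by fact
  let ?\<Delta>B = "ext C \<Delta> B" and ?\<Gamma>A = "ext C \<Gamma> A"
  define T where "T = tymap M \<Gamma> A"
  define S where "S = tymap M \<Delta> B"
  define g where "g = amap M \<Delta> \<Gamma> \<sigma>"
  define r where "r = amap M ?\<Delta>B ?\<Gamma>A \<rho>"
  have B_ty: "B \<in> ty C \<Delta>" using C.tysub_ty[OF \<Delta> \<Gamma> \<sigma> A] B by simp
  note \<Delta>B = C.ext_obj[OF \<Delta> B_ty] and \<Gamma>A = C.ext_obj[OF \<Gamma> A]
  note wkB = C.wk_hom[OF \<Delta> B_ty] and wkA = C.wk_hom[OF \<Gamma> A]
  have T: "T \<in> set_ty (omap M \<Gamma>)" using M.tymap_ty[OF \<Gamma> A] by (simp add: T_def set_cwf_simps)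
  have S: "S \<in> set_ty (omap M \<Delta>)" using M.tymap_ty[OF \<Delta> B_ty] by (simp add: S_def set_cwf_simps)
  have g: "g \<in> omap M \<Delta> \<rightarrow>\<^sub>E omap M \<Gamma>" using M.amap_hom[OF \<Delta> \<Gamma> \<sigma>] by (simp add: g_def set_cwf_simps)
  have ST: "S = pull P (omap M \<Delta>) (omap M \<Gamma>) g T"
    using M.tymap_nat[OF \<Delta> \<Gamma> \<sigma> A] by (simp add: S_def T_def g_def B set_cwf_simps)
  have oB: "omap M ?\<Delta>B = fst S" and oA: "omap M ?\<Gamma>A = fst T"
    using M.ext_pres[OF \<Delta> B_ty] M.ext_pres[OF \<Gamma> A] by (simp_all add: S_def T_def set_cwf_simps)
  have r: "r \<in> fst S \<rightarrow>\<^sub>E fst T" using M.amap_hom[OF \<Delta>B \<Gamma>A \<rho>] by (simp add: r_def set_cwf_simps oA oB)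
  note sS = set_ty_snd[OF S] and sT = set_ty_snd[OF T]
  have sq: "compose (fst S) (snd T) r = compose (fst S) g (snd S)"
    using M.amap_cmp[OF \<Delta>B \<Gamma>A \<Gamma> \<rho> wkA] M.amap_cmp[OF \<Delta>B \<Delta> \<Gamma> wkB \<sigma>]
      M.wk_pres[OF \<Delta> B_ty] M.wk_pres[OF \<Gamma> A]
    by (simp add: wk set_cwf_simps oB flip: r_def g_def T_def S_def)
  define W where "W = pull P (fst T) (omap M \<Gamma>) (snd T) T"
  let ?v = "var (set_cwf P) (omap M \<Delta>) S" and ?w = "var (set_cwf P) (omap M \<Gamma>) T"
  have W: "W \<in> set_ty (fst T)" unfolding W_def by (rule pull_ty[OF sT T])
  have tyW: "tymap M ?\<Gamma>A (tysub C ?\<Gamma>A \<Gamma> (wk C \<Gamma> A) A) = W"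
    using M.tymap_nat[OF \<Gamma>A \<Gamma> wkA A] M.wk_pres[OF \<Gamma> A]
    by (simp add: W_def set_cwf_simps oA flip: T_def)
  have "tysub C ?\<Delta>B ?\<Gamma>A \<rho> (tysub C ?\<Gamma>A \<Gamma> (wk C \<Gamma> A) A) = tysub C ?\<Delta>B \<Delta> (wk C \<Delta> B) B"
    using C.tysub_cmp[OF \<Delta>B \<Gamma>A \<Gamma> \<rho> wkA A] C.tysub_cmp[OF \<Delta>B \<Delta> \<Gamma> wkB \<sigma> A] by (simp add: wk B)
  \<comment> \<open>Since \<rho> preserves the generic variable, the generic section over
    \<open>S\<close> is the reindexing along \<open>r\<close> of the one over
    \<open>T\<close>.\<close>
  then have v: "?v = set_tmsub P (fst S) (fst T) r W ?w"
    using M.tmmap_nat[OF \<Delta>B \<Gamma>A \<rho> C.tysub_ty[OF \<Gamma>A \<Gamma> wkA A] C.var_tm[OF \<Gamma> A]]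
      M.var_pres[OF \<Delta> B_ty] M.var_pres[OF \<Gamma> A]
    by (simp add: var tyW oA oB set_cwf_simps(8) flip: r_def T_def S_def)
  have xS: "x \<in> fst S" using x by (simp add: oB)
  have vx: "?v x \<in> fst (pull P (fst S) (omap M \<Gamma>) (compose (fst S) g (snd S)) T)"
    using set_var(1)[OF S] xS pull_comp[OF sS g T] by (auto simp: set_tm_def simp flip: ST)
  \<comment> \<open>The lift of \<open>?v x\<close> along the common diagonal of the square
    \<open>sq\<close> is computed in two ways by \<open>lift_comp\<close>: through \<open>g\<close>
    it is the chosen lift of \<open>x\<close>, through \<open>r\<close> it is
    \<open>r x\<close>.\<close>
  have "lift P (fst S) (omap M \<Gamma>) (compose (fst S) g (snd S)) T (?v x)
      = lift P (omap M \<Delta>) (omap M \<Gamma>) g T x"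
    using vx set_var(2)[OF S xS] by (simp add: lift_comp[OF sS g T] compose_eq flip: ST)
  moreover have "lift P (fst S) (omap M \<Gamma>) (compose (fst S) (snd T) r) T (?v x)
      = lift P (fst T) (omap M \<Gamma>) (snd T) T (lift P (fst S) (fst T) r W (?v x))"
    using vx by (simp add: lift_comp[OF r sT T] compose_eq W_def flip: sq)
  moreover have "lift P (fst S) (fst T) r W (?v x) = ?w (r x)"
    unfolding v using set_var(1)[OF T] by (intro lift_set_tmsub[OF r W _ xS]) (simp add: W_def)
  moreover have "r x \<in> fst T" using r xS by auto
  ultimately show ?thesis using set_var(2)[OF T] sq by (simp add: r_def g_def T_def)
qed

end

section \<open>The globular set of a model\<close>

type_synonym 'u model =
  "(gty list, gtm list, gty, gtm, 'u set, 'u \<Rightarrow> 'u, 'u set \<times> ('u \<Rightarrow> 'u), 'u \<Rightarrow> 'u) cwf_mor"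

definition gset_of :: "'u model \<Rightarrow> (nat, globe_gen list set, 'u set, 'u \<Rightarrow> 'u) functr" where
  "gset_of M = \<lparr>omap = (\<lambda>n. omap M (disk n)),
     amap = (\<lambda>m n f. if f \<in> hom globe_cat n m then amap M (disk m) (disk n) (globe_sub n f)
       else undefined)\<rparr>"

text \<open>Evaluation of a point at all variables, each variable being a substitution into the disk
  of its dimension.\<close>

definition env_of :: "'u model \<Rightarrow> gty list \<Rightarrow> 'u \<Rightarrow> 'u list" where
  "env_of M \<Gamma> m = map (\<lambda>i. amap M \<Gamma> (disk (dim (\<Gamma> ! i))) (point (\<Gamma> ! i) (V i)) m) [0..<length \<Gamma>]"

lemma length_env_of [simp]: "length (env_of M \<Gamma> m) = length \<Gamma>"
  by (simp add: env_of_def)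

lemma tm_val_env_of:
  "wf_tm \<Gamma> t A \<Longrightarrow> tm_val (env_of M \<Gamma> m) t = amap M \<Gamma> (disk (dim A)) (point A t) m"
  by (auto simp: wf_tm_iff env_of_def)

locale glob_model = split_pullbacks P + is_cwf_mor syn_glob "set_cwf P" M
  for P :: "'u pullbacks" and M :: "'u model"
begin

lemma act_PiE: "wf_sub \<Delta> \<sigma> \<Gamma> \<Longrightarrow> amap M \<Delta> \<Gamma> \<sigma> \<in> omap M \<Delta> \<rightarrow>\<^sub>E omap M \<Gamma>"
  using amap_hom[of \<Delta> \<Gamma> \<sigma>] by (auto simp: syn_glob_simps set_cwf_simps wf_sub_iff)

lemma act_mem: "wf_sub \<Delta> \<sigma> \<Gamma> \<Longrightarrow> x \<in> omap M \<Delta> \<Longrightarrow> amap M \<Delta> \<Gamma> \<sigma> x \<in> omap M \<Gamma>"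
  using act_PiE by blast

lemma act_cmp:
  "wf_sub \<Theta> \<tau> \<Delta> \<Longrightarrow> wf_sub \<Delta> \<sigma> \<Gamma> \<Longrightarrow> x \<in> omap M \<Theta>
    \<Longrightarrow> amap M \<Theta> \<Gamma> (map (sub_tm \<tau>) \<sigma>) x = amap M \<Delta> \<Gamma> \<sigma> (amap M \<Theta> \<Delta> \<tau> x)"
  using amap_cmp[of \<Theta> \<Delta> \<Gamma> \<tau> \<sigma>] by (simp add: syn_glob_simps set_cwf_simps wf_sub_iff compose_eq)

lemma act_id: "wf_ctx \<Gamma> \<Longrightarrow> x \<in> omap M \<Gamma> \<Longrightarrow> amap M \<Gamma> \<Gamma> (map V [0..<length \<Gamma>]) x = x"
  using amap_idm[of \<Gamma>] by (simp add: syn_glob_simps set_cwf_simps)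

lemma omap_snoc: "wf_ctx (\<Gamma> @ [A]) \<Longrightarrow> omap M (\<Gamma> @ [A]) = fst (tymap M \<Gamma> A)"
  using ext_pres[of \<Gamma> A] by (simp add: syn_glob_simps set_cwf_simps wf_ctx_snoc)

lemma act_wk:
  "wf_ctx (\<Gamma> @ [A]) \<Longrightarrow> amap M (\<Gamma> @ [A]) \<Gamma> (map V [0..<length \<Gamma>]) = snd (tymap M \<Gamma> A)"
  using wk_pres[of \<Gamma> A] by (simp add: syn_glob_simps set_cwf_simps wf_ctx_snoc)

lemma wf_sub_wk: "wf_ctx (\<Gamma> @ [A]) \<Longrightarrow> wf_sub (\<Gamma> @ [A]) (map V [0..<length \<Gamma>]) \<Gamma>"
  using is_cwf.wk_hom[OF is_cwf_syn_glob, of \<Gamma> A] by (simp add: syn_glob_simps wf_ctx_snoc)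

lemma tymap_pull:
  "wf_ty \<Gamma> A \<Longrightarrow> tymap M \<Gamma> A = pull P (omap M \<Gamma>) (omap M (sphere (dim A)))
    (amap M \<Gamma> (sphere (dim A)) (boundary A)) (tymap M (sphere (dim A)) (globe_ty (dim A)))"
  using tymap_nat[of \<Gamma> "sphere (dim A)" "boundary A" "globe_ty (dim A)"]
  by (simp add: syn_glob_simps set_cwf_simps wf_sphere wf_sub_boundary wf_ty_ctx)

lemma tymap_set_ty: "wf_ty \<Gamma> A \<Longrightarrow> tymap M \<Gamma> A \<in> set_ty (omap M \<Gamma>)"
  using tymap_ty[of \<Gamma> A] by (simp add: syn_glob_simps set_cwf_simps wf_ty_ctx)

lemma gset_gset_of: "gset (gset_of M)"
proof (unfold_locales; unfold op_cat_def set_cat_def cat.simps globe_cat_simps(1,3))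
  show "omap (gset_of M) \<in> extensional UNIV" by simp
  fix a b c :: nat and f g
  show "amap (gset_of M) a b f = undefined" if "\<not> (a \<in> UNIV \<and> b \<in> UNIV \<and> f \<in> hom globe_cat b a)"
    using that by (simp add: gset_of_def)
  show "omap (gset_of M) a \<in> UNIV" by simp
  show "amap (gset_of M) a a (globe_class []) = (\<lambda>x \<in> omap (gset_of M) a. x)"
    using amap_idm[of "disk a"]
    by (simp add: gset_of_def globe_sub_Nil syn_glob_simps set_cwf_simps wf_disk globe_cat_simps)
  assume "f \<in> hom globe_cat b a"
  then obtain v where v: "f = globe_class v" "b + length v = a" by (auto simp: globe_cat_simps)
  show "amap (gset_of M) a b f \<in> omap (gset_of M) a \<rightarrow>\<^sub>E omap (gset_of M) b"
    using act_PiE[OF wf_sub_globe_sub[OF v(2)]] v by (simp add: gset_of_def globe_cat_simps) auto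
  assume "g \<in> hom globe_cat c b"
  then obtain w where w: "g = globe_class w" "c + length w = b" by (auto simp: globe_cat_simps)
  have "globe_class (w @ v) \<in> hom globe_cat c a"
    using v w by (auto simp: globe_cat_simps intro!: exI[of _ "w @ v"])
  then show "amap (gset_of M) a c (cmp globe_cat c b a f g)
      = compose (omap (gset_of M) a) (amap (gset_of M) b c g) (amap (gset_of M) a b f)"
    using amap_cmp[of "disk a" "disk b" "disk c" "globe_sub b f" "globe_sub c g"]
      wf_sub_globe_sub[OF v(2)] wf_sub_globe_sub[OF w(2)] \<open>f \<in> hom globe_cat b a\<close> \<open>g \<in> hom globe_cat c b\<close>
    by (simp add: v(1) w globe_cmp gset_of_def globe_sub_append syn_glob_simps set_cwf_simps wf_disk)
qed

lemma omap_gset_of: "omap (gset_of M) n = omap M (disk n)"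
  by (simp add: gset_of_def)

lemma face_gset_of:
  "face (gset_of M) g n = amap M (disk (Suc n)) (disk n) (globe_sub n (globe_class [g]))"
  by (auto simp: face_def gset_of_def globe_cat_simps)

text \<open>By \<open>face_point\<close> the faces of the value of a variable are the values of the
  endpoints in its type.\<close>

lemma env_of_env:
  assumes "wf_ctx \<Gamma>" and "m \<in> omap M \<Gamma>"
  shows "env_of M \<Gamma> m \<in> env (gset_of M) \<Gamma>"
proof -
  have "has_ty (gset_of M) (env_of M \<Gamma> m) (\<Gamma> ! i) (env_of M \<Gamma> m ! i)" if i: "i < length \<Gamma>" for i
  proof -
    have ti: "wf_tm \<Gamma> (V i) (\<Gamma> ! i)" using assms(1) i by (rule tm_var)
    note pi = wf_sub_point[OF ti]
    have val: "env_of M \<Gamma> m ! i = amap M \<Gamma> (disk (dim (\<Gamma> ! i))) (point (\<Gamma> ! i) (V i)) m"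
      using tm_val_env_of[OF ti] by simp
    note mem = act_mem[OF pi assms(2)]
    show ?thesis
    proof (cases "\<Gamma> ! i")
      case Star
      then show ?thesis using mem by (simp add: val omap_gset_of)
    next
      case (Arr A t u)
      have t: "wf_tm \<Gamma> t A" "wf_tm \<Gamma> u A" using wf_ty_nth[OF assms(1) i] by (simp_all add: Arr wf_ty_Arr)
      have "face (gset_of M) g (dim A) (env_of M \<Gamma> m ! i)
          = amap M \<Gamma> (disk (dim A)) (point A (case g of Src \<Rightarrow> t | Tgt \<Rightarrow> u)) m" for g
        using act_cmp[OF pi, of "globe_sub (dim A) (globe_class [g])" "disk (dim A)" m] assms(2)
          wf_sub_globe_sub[of "dim A" "[g]" "Suc (dim A)"] face_point[of A t u "V i" g]
        by (simp add: face_gset_of val Arr)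
      then show ?thesis using mem t by (simp add: Arr tm_val_env_of) (simp add: val omap_gset_of Arr)
    qed
  qed
  then show ?thesis by (simp add: env_def)
qed

lemma env_of_act:
  assumes "wf_sub \<Delta> \<sigma> \<Gamma>" and "m \<in> omap M \<Delta>"
  shows "env_of M \<Gamma> (amap M \<Delta> \<Gamma> \<sigma> m) = map (tm_val (env_of M \<Delta> m)) \<sigma>"
proof (rule nth_equalityI)
  have len: "length \<sigma> = length \<Gamma>" and \<Gamma>: "wf_ctx \<Gamma>" using assms(1) by (simp_all add: wf_sub_iff)
  show "length (env_of M \<Gamma> (amap M \<Delta> \<Gamma> \<sigma> m)) = length (map (tm_val (env_of M \<Delta> m)) \<sigma>)"
    by (simp add: len)
  fix i assume "i < length (env_of M \<Gamma> (amap M \<Delta> \<Gamma> \<sigma> m))"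
  then have i: "i < length \<Gamma>" by simp
  have ti: "wf_tm \<Gamma> (V i) (\<Gamma> ! i)" using \<Gamma> i by (rule tm_var)
  show "env_of M \<Gamma> (amap M \<Delta> \<Gamma> \<sigma> m) ! i = map (tm_val (env_of M \<Delta> m)) \<sigma> ! i"
    using act_cmp[OF assms(1) wf_sub_point[OF ti] assms(2)] tm_val_env_of[OF wf_tm_sub[OF assms(1) ti], of M m]
      tm_val_env_of[OF ti, of M "amap M \<Delta> \<Gamma> \<sigma> m"] i len
    by (simp add: map_sub_tm_point)
qed

text \<open>The two legs of the pullback \<open>tymap_pull\<close> become the two parts of the list:
  the display map keeps the old variables, and by \<open>amap_lift\<close> the chosen lift is the
  value of the new one.\<close>

lemma env_of_snoc:
  assumes "wf_ctx (\<Gamma> @ [A])" and m: "m \<in> omap M (\<Gamma> @ [A])"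
  shows "env_of M (\<Gamma> @ [A]) m = env_of M \<Gamma> (snd (tymap M \<Gamma> A) m) @
    [lift P (omap M \<Gamma>) (omap M (sphere (dim A))) (amap M \<Gamma> (sphere (dim A)) (boundary A))
      (tymap M (sphere (dim A)) (globe_ty (dim A))) m]"
proof -
  let ?n = "length \<Gamma>" and ?S = "sphere (dim A)" and ?U = "globe_ty (dim A)"
  have \<Gamma>: "wf_ctx \<Gamma>" and A: "wf_ty \<Gamma> A" using assms(1) by (simp_all add: wf_ctx_snoc)
  have "env_of M \<Gamma> (snd (tymap M \<Gamma> A) m) = take ?n (env_of M (\<Gamma> @ [A]) m)"
    using env_of_act[OF wf_sub_wk[OF assms(1)] m] map_tm_val_vars[of ?n "env_of M (\<Gamma> @ [A]) m"]
    by (simp add: act_wk[OF assms(1)])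
  moreover have "env_of M (\<Gamma> @ [A]) m ! ?n
      = lift P (omap M \<Gamma>) (omap M ?S) (amap M \<Gamma> ?S (boundary A)) (tymap M ?S ?U) m"
  proof -
    have tn: "wf_tm (\<Gamma> @ [A]) (V ?n) A" using assms(1) by (auto simp: wf_tm_iff)
    \<comment> \<open>Weakening fixes the boundary of \<open>A\<close>. Together with the next
      equation this is the commuting square that \<open>amap_lift\<close> requires, with
      \<open>point A (V ?n)\<close> in the role of \<rho>.\<close>
    have bA: "map (sub_tm (map V [0..<?n])) (boundary A) = boundary A"
      using sub_ty_vars[OF A, of ?n] by (simp add: boundary_sub_ty[symmetric])
    have "map (sub_tm (boundary A @ [V ?n])) (map V [0..<2 * dim A]) = boundary A"
      by (rule nth_equalityI) (auto simp: nth_append)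
    then show ?thesis
      using amap_lift[OF is_cwf_syn_glob is_cwf_mor_axioms, of \<Gamma> ?S "boundary A" ?U A "point A (V ?n)" m]
        wf_sub_point[OF tn] tm_val_env_of[OF tn, of M m] m bA
      by (simp add: syn_glob_simps \<Gamma> wf_sphere wf_sub_boundary[OF A] disk_def point_def nth_append
          del: map_map)
  qed
  moreover have "env_of M (\<Gamma> @ [A]) m = take ?n (env_of M (\<Gamma> @ [A]) m) @ [env_of M (\<Gamma> @ [A]) m ! ?n]"
    using take_Suc_conv_app_nth[of ?n "env_of M (\<Gamma> @ [A]) m"] by simp
  ultimately show ?thesis by simp
qed

text \<open>The substitution classifying the top variable of a disk is the identity.\<close>

lemma env_of_disk: "x \<in> omap M (disk n) \<Longrightarrow> env_of M (disk n) x ! (2 * n) = x"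
  using tm_val_env_of[OF tm_var[OF wf_disk[of n], of "2 * n"], of M x] act_id[OF wf_disk, of x n]
  by (simp add: disk_nth point_disk)

lemma env_of_inj: "wf_ctx \<Gamma> \<Longrightarrow> inj_on (env_of M \<Gamma>) (omap M \<Gamma>)"
proof (induction \<Gamma> rule: rev_induct)
  case Nil
  show ?case using emp_pres by (simp add: syn_glob_simps set_cwf_simps)
next
  case (snoc A \<Gamma>)
  have \<Gamma>: "wf_ctx \<Gamma>" and A: "wf_ty \<Gamma> A" using snoc.prems by (simp_all add: wf_ctx_snoc)
  note IH = snoc.IH[OF \<Gamma>]
  note b = act_PiE[OF wf_sub_boundary[OF A]] and U = tymap_set_ty[OF conjunct2[OF wf_sphere[of "dim A"]]]
  show ?case
  proof (rule inj_onI)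
    fix x y assume x: "x \<in> omap M (\<Gamma> @ [A])" and y: "y \<in> omap M (\<Gamma> @ [A])"
      and eq: "env_of M (\<Gamma> @ [A]) x = env_of M (\<Gamma> @ [A]) y"
    have mem: "z \<in> fst (tymap M \<Gamma> A)" "snd (tymap M \<Gamma> A) z \<in> omap M \<Gamma>"
      if "z \<in> omap M (\<Gamma> @ [A])" for z
      using that set_ty_snd[OF tymap_set_ty[OF A]] by (auto simp: omap_snoc[OF snoc.prems])
    have "snd (tymap M \<Gamma> A) x = snd (tymap M \<Gamma> A) y"
      using eq IH mem x y by (auto simp: env_of_snoc[OF snoc.prems] dest: inj_onD)
    then show "x = y"
      using eq mem(1)[OF x] mem(1)[OF y] x y
      by - (rule pull_eqI[OF b U], auto simp: env_of_snoc[OF snoc.prems] tymap_pull[OF A])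
  qed
qed

text \<open>The pullback provides a point only for data that agree in
  \<open>omap M (sphere (dim A))\<close>, whereas \<open>has_ty\<close> only yields an agreement of
  environments. Injectivity at the sphere bridges the gap, which is why \<open>env_of_inj\<close> is
  proved separately beforehand.\<close>

lemma env_of_surj: "wf_ctx \<Gamma> \<Longrightarrow> xs \<in> env (gset_of M) \<Gamma> \<Longrightarrow> \<exists>m \<in> omap M \<Gamma>. env_of M \<Gamma> m = xs"
proof (induction \<Gamma> arbitrary: xs rule: rev_induct)
  case Nil
  then show ?case using emp_pres by (simp add: syn_glob_simps set_cwf_simps env_of_def)
next
  case (snoc A \<Gamma>)
  interpret X: gset "gset_of M" by (rule gset_gset_of)
  let ?S = "sphere (dim A)" and ?U = "globe_ty (dim A)" and ?b = "boundary A"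
  have \<Gamma>: "wf_ctx \<Gamma>" and A: "wf_ty \<Gamma> A" using snoc.prems by (simp_all add: wf_ctx_snoc)
  have S: "wf_ctx ?S" and U: "wf_ty ?S ?U" and D: "wf_ctx (?S @ [?U])"
    using wf_sphere[of "dim A"] by (auto simp: wf_ctx_snoc)
  obtain ys y where xs: "xs = ys @ [y]" and ys: "ys \<in> env (gset_of M) \<Gamma>"
    and y: "has_ty (gset_of M) ys A y"
    using env_snocE[OF snoc.prems] by blast
  obtain m where m: "m \<in> omap M \<Gamma>" "env_of M \<Gamma> m = ys" using snoc.IH[OF \<Gamma> ys] by blast
  note b = wf_sub_boundary[OF A]
  have y_mem: "y \<in> omap M (disk (dim A))" using has_ty_omap[OF y] by (simp add: omap_gset_of)
  have "map (tm_val ys) ?b @ [y] \<in> env (gset_of M) (disk (dim A))"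
    unfolding disk_def env_snoc[OF D] using env_sub[OF b ys] y
    by (simp add: has_ty_sub[OF U])
  moreover have "take (2 * dim A) (env_of M (disk (dim A)) y) @ [y] = env_of M (disk (dim A)) y"
    using env_of_disk[OF y_mem] take_Suc_conv_app_nth[of "2 * dim A" "env_of M (disk (dim A)) y"]
    by simp
  \<comment> \<open>Both lists complete \<open>y\<close> to an environment for the disk, and
    \<open>env_disk\<close> leaves room for only one.\<close>
  ultimately have "map (tm_val ys) ?b = take (2 * dim A) (env_of M (disk (dim A)) y)"
    using X.env_disk[of y "dim A"] env_of_env[OF wf_disk y_mem] y_mem by (auto simp: omap_gset_of)
  then have "env_of M ?S (amap M \<Gamma> ?S ?b m)
      = env_of M ?S (amap M (?S @ [?U]) ?S (map V [0..<length ?S]) y)"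
    using env_of_act[OF b m(1)] env_of_act[OF wf_sub_wk[OF D], of y] y_mem
      map_tm_val_vars[of "length ?S" "env_of M (disk (dim A)) y"]
    by (simp add: m(2) disk_def)
  \<comment> \<open>The two points of the sphere have equal environments, hence coincide; this is
    the matching condition of the pullback.\<close>
  then have eq: "amap M \<Gamma> ?S ?b m = snd (tymap M ?S ?U) y"
    using inj_onD[OF env_of_inj[OF S]] act_mem[OF b m(1)] act_mem[OF wf_sub_wk[OF D]] y_mem act_wk[OF D]
    by (metis disk_def)
  have "y \<in> fst (tymap M ?S ?U)" using y_mem omap_snoc[OF D] by (simp add: disk_def)
  then obtain z where z: "z \<in> fst (tymap M \<Gamma> A)" "snd (tymap M \<Gamma> A) z = m"
      "lift P (omap M \<Gamma>) (omap M ?S) (amap M \<Gamma> ?S ?b) (tymap M ?S ?U) z = y"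
    using pull_ex[OF act_PiE[OF b] tymap_set_ty[OF U] m(1) _ eq] by (auto simp: tymap_pull[OF A])
  then have "env_of M (\<Gamma> @ [A]) z = xs"
    by (subst env_of_snoc[OF snoc.prems(1)]) (simp_all add: omap_snoc[OF snoc.prems(1)] m(2) xs)
  then show ?case using z(1) omap_snoc[OF snoc.prems(1)] by auto
qed

lemma env_of_bij: "wf_ctx \<Gamma> \<Longrightarrow> bij_betw (env_of M \<Gamma>) (omap M \<Gamma>) (env (gset_of M) \<Gamma>)"
  using env_of_inj[of \<Gamma>] env_of_surj[of \<Gamma>] env_of_env[of \<Gamma>] by (auto simp: bij_betw_def)

end

section \<open>Restriction of transformations to disks, and its full faithfulness\<close>

definition gset_functor :: "'u pullbacks \<Rightarrow> ('u model, gty list \<Rightarrow> 'u \<Rightarrow> 'u,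
    (nat, globe_gen list set, 'u set, 'u \<Rightarrow> 'u) functr, nat \<Rightarrow> 'u \<Rightarrow> 'u) functr" where
  "gset_functor P = \<lparr>omap = (\<lambda>M \<in> obj (cwf_hom_cat syn_glob (set_cwf P)). gset_of M),
     amap = (\<lambda>M N \<theta>. if M \<in> obj (cwf_hom_cat syn_glob (set_cwf P)) \<and>
         N \<in> obj (cwf_hom_cat syn_glob (set_cwf P)) \<and> \<theta> \<in> hom (cwf_hom_cat syn_glob (set_cwf P)) M N
       then (\<lambda>n. \<theta> (disk n)) else undefined)\<rparr>"

locale glob_models = M: glob_model P M + N: glob_model P N
  for P :: "'u pullbacks" and M N :: "'u model"
begin

lemma nat_trans_mem:
  "nat_trans syn_glob (set_cwf P) M N \<theta> \<Longrightarrow> wf_ctx \<Gamma> \<Longrightarrow> \<theta> \<Gamma> \<in> omap M \<Gamma> \<rightarrow>\<^sub>E omap N \<Gamma>"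
  using nat_trans.nt_hom[of syn_glob "set_cwf P" M N \<theta> \<Gamma>] by (simp add: syn_glob_simps set_cwf_simps)

lemma nat_trans_act:
  assumes "nat_trans syn_glob (set_cwf P) M N \<theta>" and "wf_sub \<Delta> \<sigma> \<Gamma>"
  shows "compose (omap M \<Delta>) (\<theta> \<Gamma>) (amap M \<Delta> \<Gamma> \<sigma>) = compose (omap M \<Delta>) (amap N \<Delta> \<Gamma> \<sigma>) (\<theta> \<Delta>)"
  using nat_trans.nt_nat[OF assms(1), of \<Delta> \<Gamma> \<sigma>] assms(2)
  by (simp add: syn_glob_simps set_cwf_simps wf_sub_iff)

lemma nat_trans_disk:
  assumes "nat_trans syn_glob (set_cwf P) M N \<theta>"
  shows "nat_trans (op_cat globe_cat) set_cat (gset_of M) (gset_of N) (\<lambda>n. \<theta> (disk n))"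
proof (unfold_locales; unfold op_cat_def set_cat_def cat.simps globe_cat_simps(1))
  fix a b :: nat and f
  show "\<theta> (disk a) \<in> omap (gset_of M) a \<rightarrow>\<^sub>E omap (gset_of N) a"
    using nat_trans_mem[OF assms wf_disk] by (simp add: M.omap_gset_of N.omap_gset_of)
  assume f: "f \<in> hom globe_cat b a"
  then have "wf_sub (disk a) (globe_sub b f) (disk b)"
    by (auto simp: globe_cat_simps wf_sub_globe_sub)
  then show "compose (omap (gset_of M) a) (\<theta> (disk b)) (amap (gset_of M) a b f)
      = compose (omap (gset_of M) a) (amap (gset_of N) a b f) (\<theta> (disk a))"
    using nat_trans_act[OF assms] f by (simp add: gset_of_def)
qed simp

lemma nat_trans_extend:
  assumes "nat_trans (op_cat globe_cat) set_cat (gset_of M) (gset_of N) \<psi>"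
  shows "\<exists>!\<theta>. nat_trans syn_glob (set_cwf P) M N \<theta> \<and> (\<lambda>n. \<theta> (disk n)) = \<psi>"
proof -
  interpret \<psi>: nat_trans "op_cat globe_cat" set_cat "gset_of M" "gset_of N" \<psi> by fact
  have \<psi>_PiE: "\<psi> n \<in> omap (gset_of M) n \<rightarrow>\<^sub>E omap (gset_of N) n" for n
    using \<psi>.nt_hom[of n] by (simp add: op_cat_def globe_cat_simps set_cat_def)
  have \<psi>_face: "face (gset_of N) g n (\<psi> (Suc n) x) = \<psi> n (face (gset_of M) g n x)"
    if "x \<in> omap (gset_of M) (Suc n)" for g n x
  proof -
    have "globe_class [g] \<in> hom globe_cat n (Suc n)" by (auto simp: globe_cat_simps)
    then have "compose (omap (gset_of M) (Suc n)) (\<psi> n) (face (gset_of M) g n)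
        = compose (omap (gset_of M) (Suc n)) (face (gset_of N) g n) (\<psi> (Suc n))"
      using \<psi>.nt_nat[of "Suc n" n "globe_class [g]"]
      by (simp add: op_cat_def globe_cat_simps(1) set_cat_def face_def)
    from fun_cong[OF this, of x] show ?thesis using that by (simp add: compose_eq)
  qed
  define L where "L = (\<lambda>\<Gamma> m. map (\<lambda>i. \<psi> (dim (\<Gamma> ! i)) (env_of M \<Gamma> m ! i)) [0..<length \<Gamma>])"
  have L_env: "L \<Gamma> m \<in> env (gset_of N) \<Gamma>" if "wf_ctx \<Gamma>" "m \<in> omap M \<Gamma>" for \<Gamma> m
    unfolding L_def using \<psi>_PiE
    by (intro env_map[OF that(1) M.env_of_env[OF that]] \<psi>_face) auto
  have L_act: "L \<Gamma> (amap M \<Delta> \<Gamma> \<sigma> m) = map (tm_val (L \<Delta> m)) \<sigma>"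
    if \<sigma>: "wf_sub \<Delta> \<sigma> \<Gamma>" and m: "m \<in> omap M \<Delta>" for \<Delta> \<Gamma> \<sigma> m
  proof (rule nth_equalityI)
    have len: "length \<sigma> = length \<Gamma>" using \<sigma> by (simp add: wf_sub_iff)
    then show "length (L \<Gamma> (amap M \<Delta> \<Gamma> \<sigma> m)) = length (map (tm_val (L \<Delta> m)) \<sigma>)" by (simp add: L_def)
    fix i assume "i < length (L \<Gamma> (amap M \<Delta> \<Gamma> \<sigma> m))"
    then have i: "i < length \<Gamma>" by (simp add: L_def)
    \<comment> \<open>A substitution replaces a variable by a variable of the substituted type,
      which has the same dimension. The same component of \<psi> is therefore applied on both
      sides.\<close>
    then obtain j where j: "j < length \<Delta>" "\<sigma> ! i = V j" "\<Delta> ! j = sub_ty \<sigma> (\<Gamma> ! i)"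
      using \<sigma> by (auto simp: wf_sub_iff wf_tm_iff)
    show "L \<Gamma> (amap M \<Delta> \<Gamma> \<sigma> m) ! i = map (tm_val (L \<Delta> m)) \<sigma> ! i"
      using i j len by (simp add: L_def M.env_of_act[OF \<sigma> m])
  qed
  define \<theta> where "\<theta> = (\<lambda>\<Gamma> \<in> {\<Gamma>. wf_ctx \<Gamma>}. \<lambda>m \<in> omap M \<Gamma>. inv_into (omap N \<Gamma>) (env_of N \<Gamma>) (L \<Gamma> m))"
  have \<theta>: "\<theta> \<Gamma> m \<in> omap N \<Gamma>" "env_of N \<Gamma> (\<theta> \<Gamma> m) = L \<Gamma> m" if "wf_ctx \<Gamma>" "m \<in> omap M \<Gamma>" for \<Gamma> m
  proof -
    have "L \<Gamma> m \<in> env_of N \<Gamma> ` omap N \<Gamma>"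
      using L_env[OF that] bij_betw_imp_surj_on[OF N.env_of_bij[OF that(1)]] by simp
    then show "\<theta> \<Gamma> m \<in> omap N \<Gamma>" "env_of N \<Gamma> (\<theta> \<Gamma> m) = L \<Gamma> m"
      using that by (auto simp: \<theta>_def f_inv_into_f inv_into_into)
  qed
  have \<theta>_PiE: "\<theta> \<Gamma> \<in> omap M \<Gamma> \<rightarrow>\<^sub>E omap N \<Gamma>" if "wf_ctx \<Gamma>" for \<Gamma>
    using \<theta>(1)[OF that] that by (intro PiE_I) (auto simp: \<theta>_def)
  show ?thesis
  proof (rule ex1I[of _ \<theta>], intro conjI)
    show "nat_trans syn_glob (set_cwf P) M N \<theta>"
    proof (unfold_locales; unfold syn_glob_simps set_cwf_simps mem_Collect_eq)
      show "\<theta> \<in> extensional {\<Gamma>. wf_ctx \<Gamma>}" by (simp add: \<theta>_def)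
      show "\<theta> \<Gamma> \<in> omap M \<Gamma> \<rightarrow>\<^sub>E omap N \<Gamma>" if "wf_ctx \<Gamma>" for \<Gamma> using \<theta>_PiE[OF that] .
      fix \<Delta> \<Gamma> \<sigma> assume \<Delta>: "wf_ctx \<Delta>" and \<Gamma>: "wf_ctx \<Gamma>" and \<sigma>: "wf_sub \<Delta> \<sigma> \<Gamma>"
      have "\<theta> \<Gamma> (amap M \<Delta> \<Gamma> \<sigma> m) = amap N \<Delta> \<Gamma> \<sigma> (\<theta> \<Delta> m)" if m: "m \<in> omap M \<Delta>" for m
      proof (rule inj_onD[OF N.env_of_inj[OF \<Gamma>]])
        note \<sigma>m = M.act_mem[OF \<sigma> m]
        show "env_of N \<Gamma> (\<theta> \<Gamma> (amap M \<Delta> \<Gamma> \<sigma> m)) = env_of N \<Gamma> (amap N \<Delta> \<Gamma> \<sigma> (\<theta> \<Delta> m))"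
          by (simp add: \<theta>[OF \<Gamma> \<sigma>m] \<theta>[OF \<Delta> m] N.env_of_act[OF \<sigma>] L_act[OF \<sigma> m])
        show "\<theta> \<Gamma> (amap M \<Delta> \<Gamma> \<sigma> m) \<in> omap N \<Gamma>" by (rule \<theta>(1)[OF \<Gamma> \<sigma>m])
        show "amap N \<Delta> \<Gamma> \<sigma> (\<theta> \<Delta> m) \<in> omap N \<Gamma>" by (rule N.act_mem[OF \<sigma> \<theta>(1)[OF \<Delta> m]])
      qed
      then show "compose (omap M \<Delta>) (\<theta> \<Gamma>) (amap M \<Delta> \<Gamma> \<sigma>) = compose (omap M \<Delta>) (amap N \<Delta> \<Gamma> \<sigma>) (\<theta> \<Delta>)"
        unfolding compose_def by (rule restrict_ext)
    qed
    show "(\<lambda>n. \<theta> (disk n)) = \<psi>"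
    proof
      fix n
      have \<psi>n: "\<psi> n \<in> omap M (disk n) \<rightarrow>\<^sub>E omap N (disk n)"
        using \<psi>_PiE[of n] by (simp add: M.omap_gset_of N.omap_gset_of)
      show "\<theta> (disk n) = \<psi> n"
      proof (rule PiE_ext[OF \<theta>_PiE[OF wf_disk] \<psi>n])
        fix m assume m: "m \<in> omap M (disk n)"
        \<comment> \<open>Position \<open>2 * n\<close> holds the top variable, at which
          \<open>env_of\<close> returns the point of the disk itself.\<close>
        have "\<theta> (disk n) m = L (disk n) m ! (2 * n)"
          using N.env_of_disk[OF \<theta>(1)[OF wf_disk m]] by (simp add: \<theta>(2)[OF wf_disk m])
        also have "\<dots> = \<psi> n m" using M.env_of_disk[OF m] by (simp add: L_def disk_nth nth_append)
        finally show "\<theta> (disk n) m = \<psi> n m" .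
      qed
    qed
  next
    fix \<theta>' assume "nat_trans syn_glob (set_cwf P) M N \<theta>' \<and> (\<lambda>n. \<theta>' (disk n)) = \<psi>"
    then have \<theta>': "nat_trans syn_glob (set_cwf P) M N \<theta>'" and \<psi>_eq: "\<And>n. \<theta>' (disk n) = \<psi> n" by auto
    show "\<theta>' = \<theta>"
    proof (rule extensionalityI[where A = "{\<Gamma>. wf_ctx \<Gamma>}"])
      show "\<theta>' \<in> extensional {\<Gamma>. wf_ctx \<Gamma>}"
        using nat_trans.nt_ext[OF \<theta>'] by (simp add: syn_glob_simps)
      show "\<theta> \<in> extensional {\<Gamma>. wf_ctx \<Gamma>}" by (simp add: \<theta>_def)
      fix \<Gamma> assume "\<Gamma> \<in> {\<Gamma>. wf_ctx \<Gamma>}"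
      then have \<Gamma>: "wf_ctx \<Gamma>" by simp
      note \<theta>'_PiE = nat_trans_mem[OF \<theta>' \<Gamma>]
      show "\<theta>' \<Gamma> = \<theta> \<Gamma>"
      proof (rule PiE_ext[OF \<theta>'_PiE \<theta>_PiE[OF \<Gamma>]])
        fix m assume m: "m \<in> omap M \<Gamma>"
        have "env_of N \<Gamma> (\<theta>' \<Gamma> m) = L \<Gamma> m"
        proof (rule nth_equalityI)
          fix i assume "i < length (env_of N \<Gamma> (\<theta>' \<Gamma> m))"
          then have i: "i < length \<Gamma>" by simp
          \<comment> \<open>Naturality of \<open>\<theta>'\<close> at this substitution expresses
            coordinate \<open>i\<close> by the component at a disk, where \<open>\<theta>'\<close>
            is \<psi>. This forces uniqueness.\<close>
          note p = wf_sub_point[OF tm_var[OF \<Gamma> i]]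
          show "env_of N \<Gamma> (\<theta>' \<Gamma> m) ! i = L \<Gamma> m ! i"
            using fun_cong[OF nat_trans_act[OF \<theta>' p], of m] m i
            by (simp add: env_of_def L_def compose_eq \<psi>_eq)
        qed (simp add: L_def)
        then show "\<theta>' \<Gamma> m = \<theta> \<Gamma> m"
          using \<theta>[OF \<Gamma> m] m PiE_mem[OF \<theta>'_PiE m]
          by (intro inj_onD[OF N.env_of_inj[OF \<Gamma>]]) auto
      qed
    qed
  qed
qed

end

lemma glob_modelI:
  "split_pullbacks P \<Longrightarrow> M \<in> obj (cwf_hom_cat syn_glob (set_cwf P)) \<Longrightarrow> glob_model P M"
  by (simp add: cwf_hom_cat_def glob_model_def)

text \<open>Compatibility with types and terms is automatic by \<open>is_cwf_2mor_iff\<close>, so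
  full faithfulness only concerns plain natural transformations.\<close>

lemma hom_cwf_hom_cat:
  assumes "glob_model P M" and "glob_model P N"
  shows "hom (cwf_hom_cat syn_glob (set_cwf P)) M N = {\<theta>. nat_trans syn_glob (set_cwf P) M N \<theta>}"
proof -
  have "split_pullbacks P" "is_cwf_mor syn_glob (set_cwf P) M" "is_cwf_mor syn_glob (set_cwf P) N"
    using assms by (simp_all add: glob_model_def)
  then have "is_cwf_2mor syn_glob (set_cwf P) M N \<theta> \<longleftrightarrow> nat_trans syn_glob (set_cwf P) M N \<theta>" for \<theta>
    by (intro is_cwf_2mor_iff is_cwf_syn_glob is_cwf_set_cwf)
  then show ?thesis by (auto simp: cwf_hom_cat_def)
qed

lemma is_functor_gset_functor:
  fixes P :: "'u pullbacks"
  assumes P: "split_pullbacks P"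
  shows "is_functor (cwf_hom_cat syn_glob (set_cwf P)) gset_cat (gset_functor P)"
proof -
  let ?C = "cwf_hom_cat syn_glob (set_cwf P)"
  interpret C: category ?C by (rule category_cwf_hom_cat[OF is_cwf_syn_glob is_cwf_set_cwf[OF P]])
  show ?thesis
  proof
    show "omap (gset_functor P) \<in> extensional (obj ?C)" by (simp add: gset_functor_def)
    show "amap (gset_functor P) M N \<theta> = undefined"
      if "\<not> (M \<in> obj ?C \<and> N \<in> obj ?C \<and> \<theta> \<in> hom ?C M N)" for M N \<theta>
      using that by (auto simp: gset_functor_def)
    show "omap (gset_functor P) M \<in> obj gset_cat" if M: "M \<in> obj ?C" for M
      using glob_model.gset_gset_of[OF glob_modelI[OF P M]] M
      by (simp add: gset_functor_def gset_cat_def functor_cat_def gset_def)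
    show "amap (gset_functor P) M N \<theta> \<in> hom gset_cat (omap (gset_functor P) M) (omap (gset_functor P) N)"
      if M: "M \<in> obj ?C" and N: "N \<in> obj ?C" and \<theta>: "\<theta> \<in> hom ?C M N" for M N \<theta>
    proof -
      note MN = glob_modelI[OF P M] glob_modelI[OF P N]
      interpret glob_models P M N using MN by (simp add: glob_models_def)
      have "nat_trans syn_glob (set_cwf P) M N \<theta>" using \<theta> hom_cwf_hom_cat[OF MN] by simp
      from nat_trans_disk[OF this] show ?thesis
        using M N \<theta> by (simp add: gset_functor_def gset_cat_def functor_cat_def)
    qed
    show "amap (gset_functor P) M M (idm ?C M) = idm gset_cat (omap (gset_functor P) M)"
      if M: "M \<in> obj ?C" for M
      using C.idm_hom[OF M] M
      by (simp add: gset_functor_def gset_cat_def functor_cat_def)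
        (auto simp: cwf_hom_cat_def nt_id_def op_cat_def globe_cat_simps set_cat_def set_cwf_simps
          syn_glob_simps wf_disk gset_of_def)
    show "amap (gset_functor P) K N (cmp ?C K M N \<eta> \<theta>)
        = cmp gset_cat (omap (gset_functor P) K) (omap (gset_functor P) M) (omap (gset_functor P) N)
            (amap (gset_functor P) M N \<eta>) (amap (gset_functor P) K M \<theta>)"
      if K: "K \<in> obj ?C" and M: "M \<in> obj ?C" and N: "N \<in> obj ?C" and \<theta>: "\<theta> \<in> hom ?C K M"
        and \<eta>: "\<eta> \<in> hom ?C M N" for K M N \<theta> \<eta>
      using C.cmp_hom[OF K M N \<theta> \<eta>] K M N \<theta> \<eta>
      by (simp add: gset_functor_def gset_cat_def functor_cat_def)
        (auto simp: cwf_hom_cat_def nt_cmp_def op_cat_def globe_cat_simps set_cat_def set_cwf_simps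
          syn_glob_simps wf_disk gset_of_def)
  qed
qed

lemma gset_functor_full_faithful:
  fixes P :: "'u pullbacks"
  assumes P: "split_pullbacks P"
    and M: "M \<in> obj (cwf_hom_cat syn_glob (set_cwf P))" and N: "N \<in> obj (cwf_hom_cat syn_glob (set_cwf P))"
    and \<psi>: "\<psi> \<in> hom gset_cat (omap (gset_functor P) M) (omap (gset_functor P) N)"
  shows "\<exists>!\<theta>. \<theta> \<in> hom (cwf_hom_cat syn_glob (set_cwf P)) M N \<and> amap (gset_functor P) M N \<theta> = \<psi>"
proof -
  note MN = glob_modelI[OF P M] glob_modelI[OF P N]
  interpret glob_models P M N using MN by (simp add: glob_models_def)
  have "nat_trans (op_cat globe_cat) set_cat (gset_of M) (gset_of N) \<psi>"
    using \<psi> M N by (simp add: gset_functor_def gset_cat_def functor_cat_def)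
  from nat_trans_extend[OF this] show ?thesis
    using M N hom_cwf_hom_cat[OF MN] by (simp add: gset_functor_def cong: conj_cong)
qed

section \<open>The model of a globular set\<close>

lemma is_iso_functor_cat_set:
  fixes F G :: "('o, 'a, 'u set, 'u \<Rightarrow> 'u) functr"
  assumes "is_functor C set_cat F" and "is_functor C set_cat G" and "nat_trans C set_cat F G \<theta>"
    and bij: "\<And>a. a \<in> obj C \<Longrightarrow> bij_betw (\<theta> a) (omap F a) (omap G a)"
  shows "is_iso (functor_cat C set_cat) F G \<theta>"
proof -
  interpret F: is_functor C set_cat F by fact
  interpret G: is_functor C set_cat G by fact
  interpret \<theta>: nat_trans C set_cat F G \<theta> by fact
  define \<eta> where "\<eta> = (\<lambda>a \<in> obj C. \<lambda>y \<in> omap G a. inv_into (omap F a) (\<theta> a) y)"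
  have \<eta>_mem: "\<eta> a y \<in> omap F a" and \<theta>\<eta>: "\<theta> a (\<eta> a y) = y" if "a \<in> obj C" "y \<in> omap G a" for a y
    using that bij_betw_imp_surj_on[OF bij[OF that(1)]]
    by (auto simp: \<eta>_def inv_into_into f_inv_into_f)
  have \<eta>\<theta>: "\<eta> a (\<theta> a x) = x" if "a \<in> obj C" "x \<in> omap F a" for a x
    using that bij_betwE[OF bij[OF that(1)]] bij_betw_inv_into_left[OF bij[OF that(1)]]
    by (auto simp: \<eta>_def)
  have "nat_trans C set_cat G F \<eta>"
  proof (unfold_locales; (unfold set_cat_def cat.simps)?)
    show "\<eta> \<in> extensional (obj C)" by (simp add: \<eta>_def)
    show "\<eta> a \<in> omap G a \<rightarrow>\<^sub>E omap F a" if "a \<in> obj C" for a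
      using that \<eta>_mem by (intro PiE_I) (auto simp: \<eta>_def)
    fix a b f assume a: "a \<in> obj C" and b: "b \<in> obj C" and f: "f \<in> hom C a b"
    have Ff: "amap F a b f \<in> omap F a \<rightarrow>\<^sub>E omap F b" using F.amap_hom[OF a b f] by (simp add: set_cat_def)
    have "\<eta> b (amap G a b f y) = amap F a b f (\<eta> a y)" if y: "y \<in> omap G a" for y
    proof -
      have "amap G a b f y = \<theta> b (amap F a b f (\<eta> a y))"
        using fun_cong[OF \<theta>.nt_nat[OF a b f], of "\<eta> a y"] \<eta>_mem[OF a y] \<theta>\<eta>[OF a y]
        by (simp add: set_cat_def compose_eq)
      then show ?thesis using \<eta>\<theta>[OF b] Ff \<eta>_mem[OF a y] by auto
    qed
    then show "compose (omap G a) (\<eta> b) (amap G a b f) = compose (omap G a) (amap F a b f) (\<eta> a)"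
      unfolding compose_def by (rule restrict_ext)
  qed
  moreover have "nt_cmp C set_cat F G F \<eta> \<theta> = nt_id C set_cat F"
    "nt_cmp C set_cat G F G \<theta> \<eta> = nt_id C set_cat G"
    by (auto simp: nt_cmp_def nt_id_def set_cat_def compose_def \<eta>\<theta> \<theta>\<eta> intro!: restrict_ext)
  ultimately show ?thesis unfolding is_iso_def functor_cat_def using assms(3) by auto
qed

text \<open>Types must be strictly natural in the context, so they are all obtained by reindexing one type
  for each dimension, that of the \<open>n\<close>-cells over their coded boundaries.\<close>

locale gset_model = split_pullbacks P + gset X
  for P :: "'u pullbacks" and X :: "(nat, globe_gen list set, 'u set, 'u \<Rightarrow> 'u) functr" +
  fixes pr :: "'u \<times> 'u \<Rightarrow> 'u"
  assumes inj_pr: "inj pr"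
begin

text \<open>Coding just the immediate source and target suffices because \<open>has_ty\<close> asks
  for nothing more. In dimension 0 the dummy value has to agree with that of \<open>ty_bd\<close> at
  \<open>Star\<close>.\<close>

definition cell_bd :: "nat \<Rightarrow> 'u \<Rightarrow> 'u" where
  "cell_bd n x = (case n of 0 \<Rightarrow> undefined | Suc k \<Rightarrow> pr (face X Src k x, face X Tgt k x))"

definition ty_bd :: "'u list \<Rightarrow> gty \<Rightarrow> 'u" where
  "ty_bd xs A = (case A of Star \<Rightarrow> undefined | Arr B t u \<Rightarrow> pr (tm_val xs t, tm_val xs u))"

text \<open>A type over \<open>UNIV\<close>: the base contains every code of a boundary, realised or
  not, so it serves all contexts at once. Pulling back discards the codes that are not hit.\<close>

definition cell_ty :: "nat \<Rightarrow> 'u set \<times> ('u \<Rightarrow> 'u)" where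
  "cell_ty n = (omap X n, restrict (cell_bd n) (omap X n))"

text \<open>The context is reversed because extension acts at its end. The set and its decoding are
  built together, as the classifying map of the next type needs the decoded environment. The initial
  set is exactly the chosen terminal object of \<open>set_cwf\<close>.\<close>

primrec rev_model :: "gty list \<Rightarrow> 'u set \<times> ('u \<Rightarrow> 'u list)" where
  "rev_model [] = ({undefined}, \<lambda>_. [])"
| "rev_model (A # \<Gamma>) =
    (let Z = fst (rev_model \<Gamma>); d = snd (rev_model \<Gamma>);
         g = (\<lambda>z \<in> Z. ty_bd (d z) A); T = pull P Z UNIV g (cell_ty (dim A))
     in (fst T, \<lambda>y. d (snd T y) @ [lift P Z UNIV g (cell_ty (dim A)) y]))"

definition carrier :: "gty list \<Rightarrow> 'u set" where
  "carrier \<Gamma> = fst (rev_model (rev \<Gamma>))"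

definition decode :: "gty list \<Rightarrow> 'u \<Rightarrow> 'u list" where
  "decode \<Gamma> = snd (rev_model (rev \<Gamma>))"

definition classify :: "gty list \<Rightarrow> gty \<Rightarrow> 'u \<Rightarrow> 'u" where
  "classify \<Gamma> A = (\<lambda>z \<in> carrier \<Gamma>. ty_bd (decode \<Gamma> z) A)"

definition fam :: "gty list \<Rightarrow> gty \<Rightarrow> 'u set \<times> ('u \<Rightarrow> 'u)" where
  "fam \<Gamma> A = pull P (carrier \<Gamma>) UNIV (classify \<Gamma> A) (cell_ty (dim A))"

definition cell :: "gty list \<Rightarrow> gty \<Rightarrow> 'u \<Rightarrow> 'u" where
  "cell \<Gamma> A = lift P (carrier \<Gamma>) UNIV (classify \<Gamma> A) (cell_ty (dim A))"

lemma carrier_Nil: "carrier [] = {undefined}" and decode_Nil: "decode [] z = []"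
  by (simp_all add: carrier_def decode_def)

lemma carrier_snoc: "carrier (\<Gamma> @ [A]) = fst (fam \<Gamma> A)"
  by (simp add: carrier_def decode_def fam_def classify_def Let_def)

lemma decode_snoc: "decode (\<Gamma> @ [A]) y = decode \<Gamma> (snd (fam \<Gamma> A) y) @ [cell \<Gamma> A y]"
  by (simp add: carrier_def decode_def fam_def cell_def classify_def Let_def)

text \<open>Typing becomes the matching condition of the pullback that defines \<open>fam\<close>;
  injectivity of \<open>pr\<close> separates the equations for source and target.\<close>

lemma has_ty_iff: "has_ty X xs A x \<longleftrightarrow> x \<in> omap X (dim A) \<and> cell_bd (dim A) x = ty_bd xs A"
  by (cases A) (auto simp: cell_bd_def ty_bd_def inj_eq[OF inj_pr])

lemma cell_ty_set_ty: "cell_ty n \<in> set_ty UNIV"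
  by (auto simp: cell_ty_def set_ty_def)

lemma classify_PiE: "classify \<Gamma> A \<in> carrier \<Gamma> \<rightarrow>\<^sub>E UNIV"
  by (auto simp: classify_def)

lemma fam_set_ty: "fam \<Gamma> A \<in> set_ty (carrier \<Gamma>)"
  unfolding fam_def by (rule pull_ty[OF classify_PiE cell_ty_set_ty])

lemma fam_square:
  assumes "y \<in> fst (fam \<Gamma> A)"
  shows "snd (fam \<Gamma> A) y \<in> carrier \<Gamma>" "has_ty X (decode \<Gamma> (snd (fam \<Gamma> A) y)) A (cell \<Gamma> A y)"
proof -
  note sq = pull_square[OF classify_PiE cell_ty_set_ty assms[unfolded fam_def], folded fam_def cell_def]
  show c: "snd (fam \<Gamma> A) y \<in> carrier \<Gamma>" by (rule sq(1))
  have m: "cell \<Gamma> A y \<in> omap X (dim A)" using sq(2) by (simp add: cell_ty_def)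
  have "snd (cell_ty (dim A)) x = cell_bd (dim A) x" if "x \<in> omap X (dim A)" for x
    using that by (simp add: cell_ty_def)
  moreover have "classify \<Gamma> A z = ty_bd (decode \<Gamma> z) A" if "z \<in> carrier \<Gamma>" for z
    using that by (simp add: classify_def)
  ultimately show "has_ty X (decode \<Gamma> (snd (fam \<Gamma> A) y)) A (cell \<Gamma> A y)"
    using sq(3) c m by (simp add: has_ty_iff)
qed

lemma fam_eqI:
  "y \<in> fst (fam \<Gamma> A) \<Longrightarrow> y' \<in> fst (fam \<Gamma> A) \<Longrightarrow> snd (fam \<Gamma> A) y = snd (fam \<Gamma> A) y'
    \<Longrightarrow> cell \<Gamma> A y = cell \<Gamma> A y' \<Longrightarrow> y = y'"
  unfolding fam_def cell_def by (rule pull_eqI[OF classify_PiE cell_ty_set_ty])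

lemma fam_ex:
  assumes "z \<in> carrier \<Gamma>" and "has_ty X (decode \<Gamma> z) A x"
  shows "\<exists>y \<in> fst (fam \<Gamma> A). snd (fam \<Gamma> A) y = z \<and> cell \<Gamma> A y = x"
  unfolding fam_def cell_def using assms
  by (intro pull_ex[OF classify_PiE cell_ty_set_ty]) (auto simp: has_ty_iff cell_ty_def classify_def)

text \<open>A point of the pullback \<open>fam \<Gamma> A\<close> is a coded environment together
  with a cell of type \<open>A\<close> in it, which is what \<open>env_snoc\<close> asks of an
  extended environment.\<close>

lemma decode_bij: "wf_ctx \<Gamma> \<Longrightarrow> bij_betw (decode \<Gamma>) (carrier \<Gamma>) (env X \<Gamma>)"
proof (induction \<Gamma> rule: rev_induct)
  case Nil
  then show ?case by (simp add: bij_betw_def carrier_Nil decode_Nil)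
next
  case (snoc A \<Gamma>)
  have IH: "bij_betw (decode \<Gamma>) (carrier \<Gamma>) (env X \<Gamma>)" using snoc by (simp add: wf_ctx_snoc)
  note env = env_snoc[OF snoc.prems, of _ _ X]
  show ?case
  proof (rule bij_betw_imageI)
    show "inj_on (decode (\<Gamma> @ [A])) (carrier (\<Gamma> @ [A]))"
    proof (rule inj_onI)
      fix y y' assume y: "y \<in> carrier (\<Gamma> @ [A])" "y' \<in> carrier (\<Gamma> @ [A])"
        and eq: "decode (\<Gamma> @ [A]) y = decode (\<Gamma> @ [A]) y'"
      have "snd (fam \<Gamma> A) y = snd (fam \<Gamma> A) y'"
        using eq y fam_square(1)[of y \<Gamma> A] fam_square(1)[of y' \<Gamma> A]
        by (intro inj_onD[OF bij_betw_imp_inj_on[OF IH]]) (auto simp: decode_snoc carrier_snoc)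
      then show "y = y'" using eq y by - (rule fam_eqI, auto simp: decode_snoc carrier_snoc)
    qed
    show "decode (\<Gamma> @ [A]) ` carrier (\<Gamma> @ [A]) = env X (\<Gamma> @ [A])"
    proof (intro equalityI subsetI)
      fix xs assume "xs \<in> decode (\<Gamma> @ [A]) ` carrier (\<Gamma> @ [A])"
      then show "xs \<in> env X (\<Gamma> @ [A])"
        using fam_square bij_betwE[OF IH] by (auto simp: decode_snoc carrier_snoc env)
    next
      fix xs assume "xs \<in> env X (\<Gamma> @ [A])"
      then obtain ys y where xs: "xs = ys @ [y]" "ys \<in> env X \<Gamma>" "has_ty X ys A y"
        using env_snocE[OF snoc.prems] by blast
      have "ys \<in> decode \<Gamma> ` carrier \<Gamma>" using xs(2) bij_betw_imp_surj_on[OF IH] by simp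
      then obtain z where z: "z \<in> carrier \<Gamma>" "decode \<Gamma> z = ys" by auto
      obtain w where "w \<in> fst (fam \<Gamma> A)" "snd (fam \<Gamma> A) w = z" "cell \<Gamma> A w = y"
        using fam_ex[OF z(1), of A y] xs(3) z(2) by auto
      then show "xs \<in> decode (\<Gamma> @ [A]) ` carrier (\<Gamma> @ [A])"
        using z xs by (intro image_eqI[where x = w]) (auto simp: decode_snoc carrier_snoc)
    qed
  qed
qed

lemma decode_env: "wf_ctx \<Gamma> \<Longrightarrow> z \<in> carrier \<Gamma> \<Longrightarrow> decode \<Gamma> z \<in> env X \<Gamma>"
  using bij_betwE[OF decode_bij] by blast

lemma decode_eqI:
  "wf_ctx \<Gamma> \<Longrightarrow> z \<in> carrier \<Gamma> \<Longrightarrow> z' \<in> carrier \<Gamma> \<Longrightarrow> decode \<Gamma> z = decode \<Gamma> z' \<Longrightarrow> z = z'"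
  using bij_betw_imp_inj_on[OF decode_bij] by (auto dest: inj_onD)

lemma length_decode: "wf_ctx \<Gamma> \<Longrightarrow> z \<in> carrier \<Gamma> \<Longrightarrow> length (decode \<Gamma> z) = length \<Gamma>"
  using decode_env by (auto simp: env_def)

section \<open>Substitutions, reindexing of types, and terms as sections\<close>

definition act :: "gty list \<Rightarrow> gty list \<Rightarrow> gtm list \<Rightarrow> 'u \<Rightarrow> 'u" where
  "act \<Delta> \<Gamma> \<sigma> = (\<lambda>z \<in> carrier \<Delta>. inv_into (carrier \<Gamma>) (decode \<Gamma>) (map (tm_val (decode \<Delta> z)) \<sigma>))"

lemma act:
  assumes "wf_sub \<Delta> \<sigma> \<Gamma>" and "z \<in> carrier \<Delta>"
  shows "act \<Delta> \<Gamma> \<sigma> z \<in> carrier \<Gamma>" "decode \<Gamma> (act \<Delta> \<Gamma> \<sigma> z) = map (tm_val (decode \<Delta> z)) \<sigma>"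
proof -
  have \<Delta>: "wf_ctx \<Delta>" and \<Gamma>: "wf_ctx \<Gamma>" using assms(1) by (simp_all add: wf_sub_iff)
  have "map (tm_val (decode \<Delta> z)) \<sigma> \<in> decode \<Gamma> ` carrier \<Gamma>"
    using env_sub[OF assms(1) decode_env[OF \<Delta> assms(2)]] bij_betw_imp_surj_on[OF decode_bij[OF \<Gamma>]]
    by simp
  then show "act \<Delta> \<Gamma> \<sigma> z \<in> carrier \<Gamma>" "decode \<Gamma> (act \<Delta> \<Gamma> \<sigma> z) = map (tm_val (decode \<Delta> z)) \<sigma>"
    using assms(2) by (auto simp: act_def inv_into_into f_inv_into_f)
qed

lemma act_PiE: "wf_sub \<Delta> \<sigma> \<Gamma> \<Longrightarrow> act \<Delta> \<Gamma> \<sigma> \<in> carrier \<Delta> \<rightarrow>\<^sub>E carrier \<Gamma>"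
  using act(1) by (intro PiE_I) (auto simp: act_def)

text \<open>Decoding is injective, so identities, composites and projections can be recognised by
  their effect on lists.\<close>

lemma act_eqI:
  assumes "wf_sub \<Delta> \<sigma> \<Gamma>" and "h \<in> carrier \<Delta> \<rightarrow>\<^sub>E carrier \<Gamma>"
    and "\<And>z. z \<in> carrier \<Delta> \<Longrightarrow> decode \<Gamma> (h z) = map (tm_val (decode \<Delta> z)) \<sigma>"
  shows "act \<Delta> \<Gamma> \<sigma> = h"
proof (rule PiE_ext[OF act_PiE[OF assms(1)] assms(2)])
  fix z assume z: "z \<in> carrier \<Delta>"
  have "wf_ctx \<Gamma>" using assms(1) by (simp add: wf_sub_iff)
  then show "act \<Delta> \<Gamma> \<sigma> z = h z"
    using act[OF assms(1) z] assms(3)[OF z] PiE_mem[OF assms(2) z] by (intro decode_eqI[of \<Gamma>]) auto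
qed

lemma ty_bd_sub:
  "wf_ty \<Gamma> A \<Longrightarrow> length \<sigma> = length \<Gamma> \<Longrightarrow> ty_bd (map (tm_val xs) \<sigma>) A = ty_bd xs (sub_ty \<sigma> A)"
  by (cases A) (auto simp: ty_bd_def wf_ty_Arr wf_tm_iff)

lemma classify_sub:
  assumes "wf_sub \<Delta> \<sigma> \<Gamma>" and "wf_ty \<Gamma> A"
  shows "classify \<Delta> (sub_ty \<sigma> A) = compose (carrier \<Delta>) (classify \<Gamma> A) (act \<Delta> \<Gamma> \<sigma>)"
  using ty_bd_sub[OF assms(2), of \<sigma>] assms(1) act[OF assms(1)]
  by (auto simp: classify_def compose_def wf_sub_iff intro!: restrict_ext)

text \<open>Both sides are chosen pullbacks of the same \<open>cell_ty (dim A)\<close>, the right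
  one taken in two stages. Splitness of \<open>P\<close> makes them equal and not merely
  isomorphic.\<close>

lemma fam_sub:
  assumes "wf_sub \<Delta> \<sigma> \<Gamma>" and "wf_ty \<Gamma> A"
  shows "fam \<Delta> (sub_ty \<sigma> A) = pull P (carrier \<Delta>) (carrier \<Gamma>) (act \<Delta> \<Gamma> \<sigma>) (fam \<Gamma> A)"
  using pull_comp[OF act_PiE[OF assms(1)] classify_PiE cell_ty_set_ty]
  by (simp add: fam_def classify_sub[OF assms])

lemma cell_sub:
  assumes "wf_sub \<Delta> \<sigma> \<Gamma>" and "wf_ty \<Gamma> A" and "y \<in> fst (fam \<Delta> (sub_ty \<sigma> A))"
  shows "cell \<Gamma> A (lift P (carrier \<Delta>) (carrier \<Gamma>) (act \<Delta> \<Gamma> \<sigma>) (fam \<Gamma> A) y) = cell \<Delta> (sub_ty \<sigma> A) y"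
  using lift_comp[OF act_PiE[OF assms(1)] classify_PiE cell_ty_set_ty, of A "dim A"] assms(3)
  by (simp add: fam_def cell_def classify_sub[OF assms(1,2)] compose_eq)

text \<open>A term is interpreted by the action of the substitution pairing the identity with
  \<open>t\<close>. Its values lie in \<open>fst (fam \<Gamma> A)\<close> because this set is the
  carrier of the extended context.\<close>

definition sect :: "gty list \<Rightarrow> gty \<Rightarrow> gtm \<Rightarrow> 'u \<Rightarrow> 'u" where
  "sect \<Gamma> A t = act \<Gamma> (\<Gamma> @ [A]) (map V [0..<length \<Gamma>] @ [t])"

lemma wf_sub_id: "wf_ctx \<Gamma> \<Longrightarrow> wf_sub \<Gamma> (map V [0..<length \<Gamma>]) \<Gamma>"
  using category.idm_hom[OF is_cwf.axioms(1)[OF is_cwf_syn_glob], of \<Gamma>] by (simp add: syn_glob_simps)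

lemma wf_sub_sect:
  assumes "wf_tm \<Gamma> t A"
  shows "wf_sub \<Gamma> (map V [0..<length \<Gamma>] @ [t]) (\<Gamma> @ [A])"
  using assms wf_tm_ty[OF assms] wf_ty_ctx[OF wf_tm_ty[OF assms]]
  by (intro sub_ext wf_sub_id) (simp_all add: sub_ty_vars)

lemma decode_sect:
  assumes "wf_tm \<Gamma> t A" and "z \<in> carrier \<Gamma>"
  shows "sect \<Gamma> A t z \<in> fst (fam \<Gamma> A)" "snd (fam \<Gamma> A) (sect \<Gamma> A t z) = z"
    "cell \<Gamma> A (sect \<Gamma> A t z) = tm_val (decode \<Gamma> z) t"
proof -
  have \<Gamma>: "wf_ctx \<Gamma>" using wf_ty_ctx[OF wf_tm_ty[OF assms(1)]] .
  note a = act[OF wf_sub_sect[OF assms(1)] assms(2), folded sect_def]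
  show mem: "sect \<Gamma> A t z \<in> fst (fam \<Gamma> A)" using a(1) by (simp add: carrier_snoc)
  have "decode (\<Gamma> @ [A]) (sect \<Gamma> A t z) = decode \<Gamma> z @ [tm_val (decode \<Gamma> z) t]"
    using a(2) map_tm_val_vars[of "length \<Gamma>" "decode \<Gamma> z"] length_decode[OF \<Gamma> assms(2)]
    by simp
  then show "snd (fam \<Gamma> A) (sect \<Gamma> A t z) = z" "cell \<Gamma> A (sect \<Gamma> A t z) = tm_val (decode \<Gamma> z) t"
    using decode_eqI[OF \<Gamma> fam_square(1)[OF mem] assms(2)] by (simp_all add: decode_snoc)
qed

lemma sect_set_tm: "wf_tm \<Gamma> t A \<Longrightarrow> sect \<Gamma> A t \<in> set_tm (carrier \<Gamma>) (fam \<Gamma> A)"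
  using decode_sect act_PiE[OF wf_sub_sect] by (auto simp: set_tm_def sect_def carrier_snoc)

text \<open>The computation behind both naturality of terms and preservation of the generic
  variable: the lifted section hits the point whose environment consists of the substituted values
  followed by the value of \<open>u\<close>.\<close>

lemma lift_sect:
  assumes \<sigma>: "wf_sub \<Delta> \<sigma> \<Gamma>" and A: "wf_ty \<Gamma> A" and u: "wf_tm \<Delta> u (sub_ty \<sigma> A)" and z: "z \<in> carrier \<Delta>"
    and w: "w \<in> carrier (\<Gamma> @ [A])"
      "decode (\<Gamma> @ [A]) w = map (tm_val (decode \<Delta> z)) \<sigma> @ [tm_val (decode \<Delta> z) u]"
  shows "lift P (carrier \<Delta>) (carrier \<Gamma>) (act \<Delta> \<Gamma> \<sigma>) (fam \<Gamma> A) (sect \<Delta> (sub_ty \<sigma> A) u z) = w"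
proof (rule decode_eqI[OF _ _ w(1)])
  have \<Gamma>: "wf_ctx \<Gamma>" using A by (rule wf_ty_ctx)
  then show "wf_ctx (\<Gamma> @ [A])" using A by (rule ctx_ext)
  note s = decode_sect[OF u z]
  note sq = pull_square[OF act_PiE[OF \<sigma>] fam_set_ty s(1)[unfolded fam_sub[OF \<sigma> A]], folded fam_sub[OF \<sigma> A]]
  then show "lift P (carrier \<Delta>) (carrier \<Gamma>) (act \<Delta> \<Gamma> \<sigma>) (fam \<Gamma> A) (sect \<Delta> (sub_ty \<sigma> A) u z)
      \<in> carrier (\<Gamma> @ [A])"
    by (simp add: carrier_snoc)
  show "decode (\<Gamma> @ [A]) (lift P (carrier \<Delta>) (carrier \<Gamma>) (act \<Delta> \<Gamma> \<sigma>) (fam \<Gamma> A) (sect \<Delta> (sub_ty \<sigma> A) u z))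
      = decode (\<Gamma> @ [A]) w"
    using sq(3) s w(2)[unfolded decode_snoc] by (simp add: decode_snoc cell_sub[OF \<sigma> A s(1)] act(2)[OF \<sigma> z])
qed

section \<open>The coded environments as a strict morphism of CwFs\<close>

definition model_of :: "'u model" where
  "model_of = \<lparr>omap = (\<lambda>\<Gamma> \<in> {\<Gamma>. wf_ctx \<Gamma>}. carrier \<Gamma>),
     amap = (\<lambda>\<Delta> \<Gamma> \<sigma>. if wf_sub \<Delta> \<sigma> \<Gamma> then act \<Delta> \<Gamma> \<sigma> else undefined),
     tymap = (\<lambda>\<Gamma> A. if wf_ty \<Gamma> A then fam \<Gamma> A else undefined),
     tmmap = (\<lambda>\<Gamma> A t. if wf_tm \<Gamma> t A then sect \<Gamma> A t else undefined)\<rparr>"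

lemma model_of_simps:
  "wf_ctx \<Gamma> \<Longrightarrow> omap model_of \<Gamma> = carrier \<Gamma>"
  "wf_sub \<Delta> \<sigma> \<Gamma> \<Longrightarrow> amap model_of \<Delta> \<Gamma> \<sigma> = act \<Delta> \<Gamma> \<sigma>"
  "wf_ty \<Gamma> A \<Longrightarrow> tymap model_of \<Gamma> A = fam \<Gamma> A"
  "wf_tm \<Gamma> t A \<Longrightarrow> tmmap model_of \<Gamma> A t = sect \<Gamma> A t"
  by (simp_all add: model_of_def)

lemma act_wk:
  assumes "wf_ctx (\<Gamma> @ [A])" and "wf_sub (\<Gamma> @ [A]) (map V [0..<length \<Gamma>]) \<Gamma>"
  shows "act (\<Gamma> @ [A]) \<Gamma> (map V [0..<length \<Gamma>]) = snd (fam \<Gamma> A)"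
proof (rule act_eqI[OF assms(2)])
  show "snd (fam \<Gamma> A) \<in> carrier (\<Gamma> @ [A]) \<rightarrow>\<^sub>E carrier \<Gamma>"
    using set_ty_snd[OF fam_set_ty] by (simp add: carrier_snoc)
  fix z assume z: "z \<in> carrier (\<Gamma> @ [A])"
  then have "length (decode \<Gamma> (snd (fam \<Gamma> A) z)) = length \<Gamma>"
    using assms(1) fam_square(1)[of z \<Gamma> A] by (intro length_decode) (auto simp: wf_ctx_snoc carrier_snoc)
  then show "decode \<Gamma> (snd (fam \<Gamma> A) z) = map (tm_val (decode (\<Gamma> @ [A]) z)) (map V [0..<length \<Gamma>])"
    by (subst map_tm_val_vars) (simp_all add: decode_snoc)
qed

lemma is_cwf_mor_model_of: "is_cwf_mor syn_glob (set_cwf P) model_of"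
proof -
  interpret S: is_cwf syn_glob by (rule is_cwf_syn_glob)
  note S = S.cmp_hom S.wk_hom S.tysub_ty S.tmsub_tm S.var_tm S.ext_obj
  note S = S[unfolded syn_glob_simps mem_Collect_eq]
  show ?thesis
  proof (unfold_locales; unfold syn_glob_simps mem_Collect_eq)
    show "omap model_of \<in> extensional {\<Gamma>. wf_ctx \<Gamma>}" by (simp add: model_of_def)
    show "amap model_of a b f = undefined" if "\<not> (wf_ctx a \<and> wf_ctx b \<and> wf_sub a f b)" for a b f
      using that by (auto simp: model_of_def wf_sub_iff)
    show "omap model_of a \<in> obj (set_cwf P)" for a by (simp add: set_cwf_simps)
    show "amap model_of a b f \<in> hom (set_cwf P) (omap model_of a) (omap model_of b)"
      if "wf_ctx a" "wf_ctx b" "wf_sub a f b" for a b f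
      using that act_PiE by (simp add: model_of_simps set_cwf_simps)
    show "amap model_of a a (map V [0..<length a]) = idm (set_cwf P) (omap model_of a)"
      if "wf_ctx a" for a
    proof -
      have "act a a (map V [0..<length a]) = (\<lambda>x \<in> carrier a. x)"
      proof (rule act_eqI[OF wf_sub_id[OF that]])
        fix z assume z: "z \<in> carrier a"
        show "decode a ((\<lambda>x \<in> carrier a. x) z) = map (tm_val (decode a z)) (map V [0..<length a])"
          using z length_decode[OF that z] by (subst map_tm_val_vars) simp_all
      qed simp
      then show ?thesis using that wf_sub_id[OF that] by (simp add: model_of_simps set_cwf_simps)
    qed
    show "amap model_of a c (map (sub_tm f) g) = cmp (set_cwf P) (omap model_of a) (omap model_of b)
        (omap model_of c) (amap model_of b c g) (amap model_of a b f)"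
      if "wf_ctx a" "wf_ctx b" "wf_ctx c" and f: "wf_sub a f b" and g: "wf_sub b g c" for a b c f g
    proof -
      note gf = S(1)[OF that]
      have "act a c (map (sub_tm f) g) = compose (carrier a) (act b c g) (act a b f)"
      proof (rule act_eqI[OF gf compose_PiE[OF act_PiE[OF f] act_PiE[OF g]]])
        fix z assume z: "z \<in> carrier a"
        have "tm_val (map (tm_val (decode a z)) f) t = tm_val (decode a z) (sub_tm f t)"
          if t: "t \<in> set g" for t
        proof -
          obtain i where "i < length c" "t = g ! i" using t g by (auto simp: in_set_conv_nth wf_sub_iff)
          then show ?thesis using g by (intro tm_val_map[OF f]) (auto simp: wf_sub_iff[of b])
        qed
        then show "decode c (compose (carrier a) (act b c g) (act a b f) z)
            = map (tm_val (decode a z)) (map (sub_tm f) g)"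
          using z by (simp add: compose_eq act(2)[OF g act(1)[OF f z]] act(2)[OF f z])
      qed
      then show ?thesis using that gf by (simp add: model_of_simps set_cwf_simps)
    qed
    show "tymap model_of \<Gamma> A = undefined" if "\<not> (wf_ctx \<Gamma> \<and> wf_ty \<Gamma> A)" for \<Gamma> A
      using that by (auto simp: model_of_def dest: wf_ty_ctx)
    show "tmmap model_of \<Gamma> A t = undefined" if "\<not> (wf_ctx \<Gamma> \<and> wf_ty \<Gamma> A \<and> wf_tm \<Gamma> t A)" for \<Gamma> A t
      using that by (auto simp: model_of_def dest: wf_ty_ctx wf_tm_ty)
    show "tymap model_of \<Gamma> A \<in> ty (set_cwf P) (omap model_of \<Gamma>)" if "wf_ctx \<Gamma>" "wf_ty \<Gamma> A" for \<Gamma> A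
      using that fam_set_ty by (simp add: model_of_simps set_cwf_simps)
    show "tmmap model_of \<Gamma> A t \<in> tm (set_cwf P) (omap model_of \<Gamma>) (tymap model_of \<Gamma> A)"
      if "wf_ctx \<Gamma>" "wf_ty \<Gamma> A" "wf_tm \<Gamma> t A" for \<Gamma> A t
      using that sect_set_tm by (simp add: model_of_simps set_cwf_simps)
    show "tymap model_of \<Delta> (sub_ty \<sigma> A) = tysub (set_cwf P) (omap model_of \<Delta>) (omap model_of \<Gamma>)
        (amap model_of \<Delta> \<Gamma> \<sigma>) (tymap model_of \<Gamma> A)"
      if "wf_ctx \<Delta>" "wf_ctx \<Gamma>" "wf_sub \<Delta> \<sigma> \<Gamma>" "wf_ty \<Gamma> A" for \<Delta> \<Gamma> \<sigma> A
      using that fam_sub by (simp add: model_of_simps set_cwf_simps wf_ty_sub)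
    show "tmmap model_of \<Delta> (sub_ty \<sigma> A) (sub_tm \<sigma> t) = tmsub (set_cwf P) (omap model_of \<Delta>)
        (omap model_of \<Gamma>) (amap model_of \<Delta> \<Gamma> \<sigma>) (tymap model_of \<Gamma> A) (tmmap model_of \<Gamma> A t)"
      if \<Delta>: "wf_ctx \<Delta>" and \<Gamma>: "wf_ctx \<Gamma>" and \<sigma>: "wf_sub \<Delta> \<sigma> \<Gamma>" and A: "wf_ty \<Gamma> A" and t: "wf_tm \<Gamma> t A"
      for \<Delta> \<Gamma> \<sigma> A t
    proof -
      note t' = wf_tm_sub[OF \<sigma> t]
      have "set_tmsub P (carrier \<Delta>) (carrier \<Gamma>) (act \<Delta> \<Gamma> \<sigma>) (fam \<Gamma> A) (sect \<Gamma> A t)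
          = sect \<Delta> (sub_ty \<sigma> A) (sub_tm \<sigma> t)"
      proof (rule set_tmsub_eqI[OF act_PiE[OF \<sigma>] fam_set_ty sect_set_tm[OF t]])
        show "sect \<Delta> (sub_ty \<sigma> A) (sub_tm \<sigma> t)
            \<in> set_tm (carrier \<Delta>) (pull P (carrier \<Delta>) (carrier \<Gamma>) (act \<Delta> \<Gamma> \<sigma>) (fam \<Gamma> A))"
          using sect_set_tm[OF t'] by (simp add: fam_sub[OF \<sigma> A])
        fix z assume z: "z \<in> carrier \<Delta>"
        note s = decode_sect[OF t act(1)[OF \<sigma> z]]
        show "lift P (carrier \<Delta>) (carrier \<Gamma>) (act \<Delta> \<Gamma> \<sigma>) (fam \<Gamma> A) (sect \<Delta> (sub_ty \<sigma> A) (sub_tm \<sigma> t) z)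
            = sect \<Gamma> A t (act \<Delta> \<Gamma> \<sigma> z)"
          using s act(2)[OF \<sigma> z] tm_val_map[OF \<sigma> t, of "decode \<Delta> z"]
          by (intro lift_sect[OF \<sigma> A t' z]) (simp_all add: carrier_snoc decode_snoc)
      qed
      then show ?thesis using that t' by (simp add: model_of_simps set_cwf_simps)
    qed
    show "omap model_of [] = emp (set_cwf P)" by (simp add: model_of_simps ctx_empty carrier_Nil set_cwf_simps)
    fix \<Gamma> A assume \<Gamma>: "wf_ctx \<Gamma>" and A: "wf_ty \<Gamma> A"
    note E = S(6)[OF \<Gamma> A] and wk = S(2)[OF \<Gamma> A] and v = S(5)[OF \<Gamma> A]
    show "omap model_of (\<Gamma> @ [A]) = ext (set_cwf P) (omap model_of \<Gamma>) (tymap model_of \<Gamma> A)"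
      using E A by (simp add: model_of_simps carrier_snoc set_cwf_simps)
    show "amap model_of (\<Gamma> @ [A]) \<Gamma> (map V [0..<length \<Gamma>])
        = cwf.wk (set_cwf P) (omap model_of \<Gamma>) (tymap model_of \<Gamma> A)"
      using act_wk[OF E wk] wk A by (simp add: model_of_simps set_cwf_simps)
    let ?\<sigma> = "map V [0..<length \<Gamma>]"
    have "sect (\<Gamma> @ [A]) (sub_ty ?\<sigma> A) (V (length \<Gamma>)) = var (set_cwf P) (carrier \<Gamma>) (fam \<Gamma> A)"
    proof (rule set_var_eqI[OF fam_set_ty])
      note c = carrier_snoc[of \<Gamma> A]
      show "sect (\<Gamma> @ [A]) (sub_ty ?\<sigma> A) (V (length \<Gamma>))
          \<in> set_tm (fst (fam \<Gamma> A)) (pull P (fst (fam \<Gamma> A)) (carrier \<Gamma>) (snd (fam \<Gamma> A)) (fam \<Gamma> A))"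
        using sect_set_tm[OF v] fam_sub[OF wk A] by (simp add: act_wk[OF E wk] c)
      fix z assume z: "z \<in> fst (fam \<Gamma> A)"
      then have zc: "z \<in> carrier (\<Gamma> @ [A])" by (simp add: c)
      have len: "length (decode (\<Gamma> @ [A]) z) = Suc (length \<Gamma>)" using length_decode[OF E zc] by simp
      \<comment> \<open>With the weakening as substitution and the new variable as term,
        \<open>z\<close> is its own target point in \<open>lift_sect\<close>. This is the equation
        characterising the generic section.\<close>
      have "decode (\<Gamma> @ [A]) z
          = map (tm_val (decode (\<Gamma> @ [A]) z)) ?\<sigma> @ [tm_val (decode (\<Gamma> @ [A]) z) (V (length \<Gamma>))]"
        using take_Suc_conv_app_nth[of "length \<Gamma>" "decode (\<Gamma> @ [A]) z"] len
        by (subst map_tm_val_vars) simp_all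
      from lift_sect[OF wk A v zc zc this]
      show "lift P (fst (fam \<Gamma> A)) (carrier \<Gamma>) (snd (fam \<Gamma> A)) (fam \<Gamma> A)
          (sect (\<Gamma> @ [A]) (sub_ty ?\<sigma> A) (V (length \<Gamma>)) z) = z"
        by (simp add: act_wk[OF E wk] c)
    qed
    then show "tmmap model_of (\<Gamma> @ [A]) (sub_ty ?\<sigma> A) (V (length \<Gamma>))
        = var (set_cwf P) (omap model_of \<Gamma>) (tymap model_of \<Gamma> A)"
      using v \<Gamma> A by (simp add: model_of_simps)
  qed
qed

text \<open>Each component is \<open>decode_bij\<close> followed by the Yoneda bijection
  \<open>env_disk_bij\<close>; naturality is \<open>env_disk_face\<close>.\<close>

lemma gset_of_model_of:
  "is_iso gset_cat (gset_of model_of) X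
    (\<lambda>n. \<lambda>z \<in> carrier (disk n). last (decode (disk n) z))"
  unfolding gset_cat_def
proof (rule is_iso_functor_cat_set)
  let ?\<theta> = "\<lambda>n. \<lambda>z \<in> carrier (disk n). last (decode (disk n) z)"
  interpret M: glob_model P model_of
    using is_cwf_mor_model_of split_pullbacks_axioms by (simp add: glob_model_def)
  show "is_functor (op_cat globe_cat) set_cat (gset_of model_of)"
    using M.gset_gset_of by (simp add: gset_def)
  show "is_functor (op_cat globe_cat) set_cat X" by unfold_locales
  have o: "omap (gset_of model_of) n = carrier (disk n)" for n
    by (simp add: gset_of_def model_of_simps wf_disk)
  have bij: "bij_betw (?\<theta> n) (carrier (disk n)) (omap X n)" for n
    using bij_betw_trans[OF decode_bij[OF wf_disk] env_disk_bij]
    by (subst bij_betw_cong[where g = "last \<circ> decode (disk n)"]) auto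
  then show "bij_betw (?\<theta> n) (omap (gset_of model_of) n) (omap X n)" for n by (simp add: o)
  show "nat_trans (op_cat globe_cat) set_cat (gset_of model_of) X ?\<theta>"
  proof (unfold_locales; unfold op_cat_def set_cat_def cat.simps globe_cat_simps(1) o)
    fix m n :: nat and f
    show "?\<theta> m \<in> carrier (disk m) \<rightarrow>\<^sub>E omap X m"
      using bij_betwE[OF bij[of m]] by (intro PiE_I) auto
    assume f: "f \<in> hom globe_cat n m"
    then obtain w where w: "f = globe_class w" "n + length w = m" by (auto simp: globe_cat_simps)
    note s = wf_sub_globe_sub[OF w(2)]
    have "amap (gset_of model_of) m n f = act (disk m) (disk n) (globe_sub n f)"
      using f s by (simp add: gset_of_def model_of_simps w(1))
    then show "compose (carrier (disk m)) (?\<theta> n) (amap (gset_of model_of) m n f)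
        = compose (carrier (disk m)) (amap X m n f) (?\<theta> m)"
      using env_disk_face[OF decode_env[OF wf_disk] w(2)] act[OF s]
      by (auto simp: compose_def w(1) intro!: restrict_ext)
  qed simp
qed

end

theorem theorem2p15:
  fixes P :: "'u pullbacks"
  assumes "split_pullbacks P"
  shows "equivalent_categories (cwf_hom_cat syn_glob (set_cwf P))
    (gset_cat :: ((nat, globe_gen list set, 'u set, 'u \<Rightarrow> 'u) functr, nat \<Rightarrow> 'u \<Rightarrow> 'u) cat)"
proof (rule equivalent_categoriesI)
  show "category (cwf_hom_cat syn_glob (set_cwf P))"
    by (rule category_cwf_hom_cat[OF is_cwf_syn_glob is_cwf_set_cwf[OF assms]])
  show "category (gset_cat :: ((nat, globe_gen list set, 'u set, 'u \<Rightarrow> 'u) functr, nat \<Rightarrow> 'u \<Rightarrow> 'u) cat)"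
    unfolding gset_cat_def by (rule category_functor_cat[OF category_set_cat])
  show "is_functor (cwf_hom_cat syn_glob (set_cwf P)) gset_cat (gset_functor P)"
    by (rule is_functor_gset_functor[OF assms])
  show "\<exists>!\<theta>. \<theta> \<in> hom (cwf_hom_cat syn_glob (set_cwf P)) M N \<and> amap (gset_functor P) M N \<theta> = \<psi>"
    if "M \<in> obj (cwf_hom_cat syn_glob (set_cwf P))" "N \<in> obj (cwf_hom_cat syn_glob (set_cwf P))"
      "\<psi> \<in> hom gset_cat (omap (gset_functor P) M) (omap (gset_functor P) N)" for M N \<psi>
    by (rule gset_functor_full_faithful[OF assms that])
  fix X :: "(nat, globe_gen list set, 'u set, 'u \<Rightarrow> 'u) functr"
  assume X: "X \<in> obj gset_cat"
  \<comment> \<open>The pairing that codes boundaries is supplied by the chosen pullbacks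
    themselves.\<close>
  obtain pr :: "'u \<times> 'u \<Rightarrow> 'u" where "inj pr" using split_pullbacks.pairing_exists[OF assms] by blast
  then interpret gset_model P X pr
    using assms X
    by (simp add: gset_model_def gset_model_axioms_def gset_def gset_cat_def functor_cat_def)
  have M: "model_of \<in> obj (cwf_hom_cat syn_glob (set_cwf P))"
    using is_cwf_mor_model_of by (simp add: cwf_hom_cat_def)
  then show "\<exists>M \<in> obj (cwf_hom_cat syn_glob (set_cwf P)). \<exists>e. is_iso gset_cat (omap (gset_functor P) M) X e"
    using gset_of_model_of by (intro bexI[OF _ M]) (auto simp: gset_functor_def)
qed

end
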